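(* Let $R$ be a ring and $G$ a group. The group ring $R(G)$ is left $FP$-injective if and only if the ring $R$ is left $FP$-injective and the group $G$ is locally finite.
   Context: Rings are associative with unit, not necessarily commutative. $R(G)$ denotes the group ring of $G$ with coefficients in $R$. A left module $M$ over a ring $S$ is $FP$-injective if $\mathrm{Ext}^1_S(F,M)=0$ for every finitely presented left $S$-module $F$; the ring $S$ is left $FP$-injective if the left module ${}_SS$ is $FP$-injective. A group is locally finite if every finitely generated subgroup is finite.
   Formalization: The ring R is assumed nonzero (for R = 0 and G infinite cyclic the claim fails, as R(G) = 0 is FP-injective); the finitely presented modules F range over one fixed carrier type containing an isomorphic copy of every finitely presented module. *)

theory Defs
  imports "HOL-Algebra.Module" "HOL-Algebra.AbelCoset" "HOL-Algebra.Generated_Groups" "HOL-Algebra.Elementary_Groups"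
begin

section \<open>Left modules over a not necessarily commutative ring\<close>

text \<open>The library locale \<^locale>\<open>module\<close> requires a commutative ring of scalars; only the record
  type of modules is reused. Its fields \<^const>\<open>mult\<close> and \<^const>\<open>one\<close> play no role here.\<close>

locale left_module = S?: ring S + M?: abelian_group M
  for S :: "('s, 'm) ring_scheme" (structure) and M :: "('s, 'a, 'k) module_scheme" (structure) +
  assumes smult_closed:
      "\<lbrakk>a \<in> carrier S; x \<in> carrier M\<rbrakk> \<Longrightarrow> a \<odot>\<^bsub>M\<^esub> x \<in> carrier M"
    and smult_l_distr:
      "\<lbrakk>a \<in> carrier S; b \<in> carrier S; x \<in> carrier M\<rbrakk> \<Longrightarrow>
        (a \<oplus>\<^bsub>S\<^esub> b) \<odot>\<^bsub>M\<^esub> x = a \<odot>\<^bsub>M\<^esub> x \<oplus>\<^bsub>M\<^esub> b \<odot>\<^bsub>M\<^esub> x"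
    and smult_r_distr:
      "\<lbrakk>a \<in> carrier S; x \<in> carrier M; y \<in> carrier M\<rbrakk> \<Longrightarrow>
        a \<odot>\<^bsub>M\<^esub> (x \<oplus>\<^bsub>M\<^esub> y) = a \<odot>\<^bsub>M\<^esub> x \<oplus>\<^bsub>M\<^esub> a \<odot>\<^bsub>M\<^esub> y"
    and smult_assoc:
      "\<lbrakk>a \<in> carrier S; b \<in> carrier S; x \<in> carrier M\<rbrakk> \<Longrightarrow>
        (a \<otimes>\<^bsub>S\<^esub> b) \<odot>\<^bsub>M\<^esub> x = a \<odot>\<^bsub>M\<^esub> (b \<odot>\<^bsub>M\<^esub> x)"
    and smult_one: "x \<in> carrier M \<Longrightarrow> \<one>\<^bsub>S\<^esub> \<odot>\<^bsub>M\<^esub> x = x"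

definition left_regular_module :: "('s, 'm) ring_scheme \<Rightarrow> ('s, 's) module" where
  "left_regular_module S =
    \<lparr>carrier = carrier S, mult = mult S, one = one S,
     zero = zero S, add = add S, smult = mult S\<rparr>"

text \<open>Homomorphisms are extensional, so that equality of homomorphisms is equality of functions.\<close>

definition left_hom ::
  "('s, 'm) ring_scheme \<Rightarrow> ('s, 'a, 'k) module_scheme \<Rightarrow> ('s, 'b, 'l) module_scheme \<Rightarrow> ('a \<Rightarrow> 'b) set"
where
  "left_hom S A B = {f \<in> carrier A \<rightarrow>\<^sub>E carrier B.
     (\<forall>x\<in>carrier A. \<forall>y\<in>carrier A. f (x \<oplus>\<^bsub>A\<^esub> y) = f x \<oplus>\<^bsub>B\<^esub> f y) \<and>
     (\<forall>s\<in>carrier S. \<forall>x\<in>carrier A. f (s \<odot>\<^bsub>A\<^esub> x) = s \<odot>\<^bsub>B\<^esub> f x)}"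

definition left_hom_group ::
  "('s, 'm) ring_scheme \<Rightarrow> ('s, 'a, 'k) module_scheme \<Rightarrow> ('s, 'b, 'l) module_scheme \<Rightarrow> ('a \<Rightarrow> 'b) monoid"
where
  "left_hom_group S A B =
    \<lparr>carrier = left_hom S A B,
     mult = (\<lambda>f g. \<lambda>x\<in>carrier A. f x \<oplus>\<^bsub>B\<^esub> g x),
     one = (\<lambda>x\<in>carrier A. \<zero>\<^bsub>B\<^esub>)\<rparr>"


section \<open>Free modules and the first Ext group\<close>

definition fin_supp_funs :: "('r, 'm) ring_scheme \<Rightarrow> 'x set \<Rightarrow> ('x \<Rightarrow> 'r) set" where
  "fin_supp_funs R X =
    {f. (\<forall>x\<in>X. f x \<in> carrier R) \<and> (\<forall>x. x \<notin> X \<longrightarrow> f x = \<zero>\<^bsub>R\<^esub>) \<and> finite {x. f x \<noteq> \<zero>\<^bsub>R\<^esub>}}"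

definition free_left_module :: "('s, 'm) ring_scheme \<Rightarrow> 'x set \<Rightarrow> ('s, 'x \<Rightarrow> 's) module" where
  "free_left_module S X =
    \<lparr>carrier = fin_supp_funs S X, mult = undefined, one = undefined,
     zero = (\<lambda>x. \<zero>\<^bsub>S\<^esub>), add = (\<lambda>f g x. f x \<oplus>\<^bsub>S\<^esub> g x), smult = (\<lambda>s f x. s \<otimes>\<^bsub>S\<^esub> f x)\<rparr>"

text \<open>For \<open>X \<subseteq> carrier M\<close>, the homomorphism from the free module on \<open>X\<close> to \<open>M\<close> that is the
  identity on \<open>X\<close>.\<close>

definition free_eval ::
  "('s, 'm) ring_scheme \<Rightarrow> ('s, 'a, 'k) module_scheme \<Rightarrow> 'a set \<Rightarrow> ('a \<Rightarrow> 's) \<Rightarrow> 'a"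
where
  "free_eval S M X =
    (\<lambda>f\<in>carrier (free_left_module S X). finsum M (\<lambda>x. f x \<odot>\<^bsub>M\<^esub> x) {x. f x \<noteq> \<zero>\<^bsub>S\<^esub>})"

text \<open>The beginning \<open>P2 \<rightarrow> P1 \<rightarrow> P0 \<rightarrow> F \<rightarrow> 0\<close> of the canonical free resolution of \<open>F\<close>: \<open>P0\<close> is free on
  the elements of \<open>F\<close>, and each later term is free on the elements of the preceding kernel.\<close>

definition res0 :: "('s, 'm) ring_scheme \<Rightarrow> ('s, 'f, 'k) module_scheme \<Rightarrow> ('s, 'f \<Rightarrow> 's) module" where
  "res0 S F = free_left_module S (carrier F)"

definition res_ker0 :: "('s, 'm) ring_scheme \<Rightarrow> ('s, 'f, 'k) module_scheme \<Rightarrow> ('f \<Rightarrow> 's) set" where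
  "res_ker0 S F = a_kernel (res0 S F) F (free_eval S F (carrier F))"

definition res1 ::
  "('s, 'm) ring_scheme \<Rightarrow> ('s, 'f, 'k) module_scheme \<Rightarrow> ('s, ('f \<Rightarrow> 's) \<Rightarrow> 's) module" where
  "res1 S F = free_left_module S (res_ker0 S F)"

definition res_d1 ::
  "('s, 'm) ring_scheme \<Rightarrow> ('s, 'f, 'k) module_scheme \<Rightarrow> (('f \<Rightarrow> 's) \<Rightarrow> 's) \<Rightarrow> 'f \<Rightarrow> 's" where
  "res_d1 S F = free_eval S (res0 S F) (res_ker0 S F)"

definition res_ker1 ::
  "('s, 'm) ring_scheme \<Rightarrow> ('s, 'f, 'k) module_scheme \<Rightarrow> (('f \<Rightarrow> 's) \<Rightarrow> 's) set" where
  "res_ker1 S F = a_kernel (res1 S F) (res0 S F) (res_d1 S F)"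

definition res2 ::
  "('s, 'm) ring_scheme \<Rightarrow> ('s, 'f, 'k) module_scheme \<Rightarrow> ('s, (('f \<Rightarrow> 's) \<Rightarrow> 's) \<Rightarrow> 's) module" where
  "res2 S F = free_left_module S (res_ker1 S F)"

definition res_d2 ::
  "('s, 'm) ring_scheme \<Rightarrow> ('s, 'f, 'k) module_scheme \<Rightarrow> ((('f \<Rightarrow> 's) \<Rightarrow> 's) \<Rightarrow> 's) \<Rightarrow> ('f \<Rightarrow> 's) \<Rightarrow> 's"
where
  "res_d2 S F = free_eval S (res1 S F) (res_ker1 S F)"

text \<open>The cohomology at \<open>Hom(P1, M)\<close> of \<open>Hom(P0, M) \<rightarrow> Hom(P1, M) \<rightarrow> Hom(P2, M)\<close>.\<close>

definition ext1_cocycles ::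
  "('s, 'm) ring_scheme \<Rightarrow> ('s, 'f, 'k) module_scheme \<Rightarrow> ('s, 'a, 'l) module_scheme \<Rightarrow>
    ((('f \<Rightarrow> 's) \<Rightarrow> 's) \<Rightarrow> 'a) set"
where
  "ext1_cocycles S F M =
    kernel (left_hom_group S (res1 S F) M) (left_hom_group S (res2 S F) M)
      (\<lambda>f. compose (carrier (res2 S F)) f (res_d2 S F))"

definition ext1_coboundaries ::
  "('s, 'm) ring_scheme \<Rightarrow> ('s, 'f, 'k) module_scheme \<Rightarrow> ('s, 'a, 'l) module_scheme \<Rightarrow>
    ((('f \<Rightarrow> 's) \<Rightarrow> 's) \<Rightarrow> 'a) set"
where
  "ext1_coboundaries S F M =
    (\<lambda>f. compose (carrier (res1 S F)) f (res_d1 S F)) ` left_hom S (res0 S F) M"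

definition Ext1 ::
  "('s, 'm) ring_scheme \<Rightarrow> ('s, 'f, 'k) module_scheme \<Rightarrow> ('s, 'a, 'l) module_scheme \<Rightarrow>
    ((('f \<Rightarrow> 's) \<Rightarrow> 's) \<Rightarrow> 'a) set monoid"
where
  "Ext1 S F M =
    (left_hom_group S (res1 S F) M)\<lparr>carrier := ext1_cocycles S F M\<rparr> Mod ext1_coboundaries S F M"


section \<open>Finitely presented modules and FP-injectivity\<close>

text \<open>An exact sequence \<open>S^m \<rightarrow> S^n \<rightarrow> F \<rightarrow> 0\<close>.\<close>

definition finitely_presented :: "('s, 'm) ring_scheme \<Rightarrow> ('s, 'f, 'k) module_scheme \<Rightarrow> bool" where
  "finitely_presented S F \<longleftrightarrow> left_module S F \<and>
    (\<exists>(m::nat) (n::nat) d p.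
      d \<in> left_hom S (free_left_module S {..<m}) (free_left_module S {..<n}) \<and>
      p \<in> left_hom S (free_left_module S {..<n}) F \<and>
      p ` carrier (free_left_module S {..<n}) = carrier F \<and>
      d ` carrier (free_left_module S {..<m}) = a_kernel (free_left_module S {..<n}) F p)"

text \<open>A definition cannot quantify over types, so the carriers of the modules \<open>F\<close> below are sets in
  one fixed type. It contains the quotients of all the modules \<open>S^n\<close>; by
  \<open>finitely_presented_copy\<close> below no finitely presented module is lost up to isomorphism.\<close>

definition FP_injective :: "('s, 'm) ring_scheme \<Rightarrow> ('s, 'a, 'l) module_scheme \<Rightarrow> bool" where
  "FP_injective S M \<longleftrightarrow> left_module S M \<and>
    (\<forall>F :: ('s, (nat \<Rightarrow> 's) set) module. finitely_presented S F \<longrightarrow> trivial_group (Ext1 S F M))"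

definition left_FP_injective_ring :: "('s, 'm) ring_scheme \<Rightarrow> bool" where
  "left_FP_injective_ring S \<longleftrightarrow> FP_injective S (left_regular_module S)"

lemma left_module_transport:
  fixes F :: "('s, 'f, 'k) module_scheme" and h :: "'f \<Rightarrow> 'c"
  assumes F: "left_module S F" and inj: "inj_on h (carrier F)"
  obtains F' :: "('s, 'c) module"
  where "left_module S F'" and "restrict h (carrier F) \<in> left_hom S F F'"
    and "bij_betw h (carrier F) (carrier F')"
proof -
  interpret left_module S F by (rule F)
  define k where "k = inv_into (carrier F) h"
  have kh: "k (h x) = x" if "x \<in> carrier F" for x
    using that inj by (simp add: k_def)
  define F' :: "('s, 'c) module" where
    "F' = \<lparr>carrier = h ` carrier F, mult = undefined, one = undefined, zero = h \<zero>\<^bsub>F\<^esub>,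
           add = (\<lambda>x y. h (k x \<oplus>\<^bsub>F\<^esub> k y)), smult = (\<lambda>s x. h (s \<odot>\<^bsub>F\<^esub> k x))\<rparr>"
  have "abelian_group F'"
  proof (rule abelian_groupI)
    fix x assume "x \<in> carrier F'"
    then obtain a where a: "a \<in> carrier F" "x = h a" by (auto simp: F'_def)
    show "\<exists>y\<in>carrier F'. y \<oplus>\<^bsub>F'\<^esub> x = \<zero>\<^bsub>F'\<^esub>"
      using a by (intro bexI[of _ "h (\<ominus>\<^bsub>F\<^esub> a)"]) (auto simp: F'_def kh M.l_neg)
  qed (auto simp: F'_def kh M.a_ac)
  then have "left_module S F'"
    by (intro left_module.intro left_module_axioms.intro S.ring_axioms)
       (auto simp: F'_def kh smult_closed smult_l_distr smult_r_distr smult_assoc smult_one)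
  moreover have "restrict h (carrier F) \<in> left_hom S F F'"
    by (auto simp: left_hom_def F'_def kh smult_closed)
  moreover have "bij_betw h (carrier F) (carrier F')"
    using inj by (simp add: bij_betw_def F'_def)
  ultimately show thesis by (rule that)
qed

lemma finitely_presented_copy:
  fixes F :: "('s, 'f, 'k) module_scheme"
  assumes F: "finitely_presented S F"
  shows "\<exists>(F' :: ('s, (nat \<Rightarrow> 's) set) module) h.
    finitely_presented S F' \<and> h \<in> left_hom S F F' \<and> bij_betw h (carrier F) (carrier F')"
proof -
  obtain m n :: nat and d p where lm: "left_module S F"
    and d: "d \<in> left_hom S (free_left_module S {..<m}) (free_left_module S {..<n})"
    and p: "p \<in> left_hom S (free_left_module S {..<n}) F"
    and surj: "p ` carrier (free_left_module S {..<n}) = carrier F"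
    and ex: "d ` carrier (free_left_module S {..<m}) = a_kernel (free_left_module S {..<n}) F p"
    using F unfolding finitely_presented_def by (elim conjE exE) (rule that)
  let ?N = "free_left_module S {..<n}"
  define h where "h x = {v \<in> carrier ?N. p v = x}" for x
  have "inj_on h (carrier F)"
    unfolding inj_on_def h_def surj[symmetric] by blast
  then obtain F' :: "('s, (nat \<Rightarrow> 's) set) module" where F': "left_module S F'"
    and hom: "restrict h (carrier F) \<in> left_hom S F F'"
    and bij: "bij_betw h (carrier F) (carrier F')"
    by (rule left_module_transport[OF lm])
  interpret F: left_module S F by (rule lm)
  interpret F': left_module S F' by (rule F')
  have pin: "p v \<in> carrier F" if "v \<in> carrier ?N" for v using that surj by blast
  have hin: "h x \<in> carrier F'" if "x \<in> carrier F" for x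
    using that bij by (auto simp: bij_betw_def)
  have hadd: "h (x \<oplus>\<^bsub>F\<^esub> y) = h x \<oplus>\<^bsub>F'\<^esub> h y" if "x \<in> carrier F" "y \<in> carrier F" for x y
    using hom that by (auto simp: left_hom_def)
  have hsm: "h (s \<odot>\<^bsub>F\<^esub> x) = s \<odot>\<^bsub>F'\<^esub> h x" if "s \<in> carrier S" "x \<in> carrier F" for s x
    using hom that by (auto simp: left_hom_def F.smult_closed)
  have h0: "h \<zero>\<^bsub>F\<^esub> = \<zero>\<^bsub>F'\<^esub>"
    using hadd[of "\<zero>\<^bsub>F\<^esub>" "\<zero>\<^bsub>F\<^esub>"] hin[of "\<zero>\<^bsub>F\<^esub>"] by (simp add: F'.M.add.l_cancel_one')
  define q where "q = compose (carrier ?N) h p"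
  have cl_add: "v \<oplus>\<^bsub>?N\<^esub> w \<in> carrier ?N" if "v \<in> carrier ?N" "w \<in> carrier ?N" for v w
  proof -
    have "finite ({x. v x \<noteq> \<zero>\<^bsub>S\<^esub>} \<union> {x. w x \<noteq> \<zero>\<^bsub>S\<^esub>})"
      using that by (auto simp: free_left_module_def fin_supp_funs_def)
    then have "finite {x. v x \<oplus>\<^bsub>S\<^esub> w x \<noteq> \<zero>\<^bsub>S\<^esub>}" by (rule rev_finite_subset) auto
    then show ?thesis using that by (auto simp: free_left_module_def fin_supp_funs_def)
  qed
  have cl_smult: "s \<odot>\<^bsub>?N\<^esub> v \<in> carrier ?N" if "s \<in> carrier S" "v \<in> carrier ?N" for s v
  proof -
    have "finite {x. v x \<noteq> \<zero>\<^bsub>S\<^esub>}"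
      using that by (auto simp: free_left_module_def fin_supp_funs_def)
    then have "finite {x. s \<otimes>\<^bsub>S\<^esub> v x \<noteq> \<zero>\<^bsub>S\<^esub>}"
      by (rule rev_finite_subset) (use that in auto)
    then show ?thesis using that by (auto simp: free_left_module_def fin_supp_funs_def)
  qed
  have "q \<in> left_hom S ?N F'"
  proof -
    have "p (v \<oplus>\<^bsub>?N\<^esub> w) = p v \<oplus>\<^bsub>F\<^esub> p w" if "v \<in> carrier ?N" "w \<in> carrier ?N" for v w
      using p that by (simp add: left_hom_def)
    moreover have "p (s \<odot>\<^bsub>?N\<^esub> v) = s \<odot>\<^bsub>F\<^esub> p v" if "s \<in> carrier S" "v \<in> carrier ?N" for s v
      using p that by (simp add: left_hom_def)
    ultimately show ?thesis
      by (simp add: left_hom_def q_def compose_def hadd hsm hin pin cl_add cl_smult)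
  qed
  moreover have "q ` carrier ?N = carrier F'"
  proof -
    have "q ` carrier ?N = h ` p ` carrier ?N" by (force simp: q_def compose_def)
    then show ?thesis using surj bij by (simp add: bij_betw_def)
  qed
  moreover have "a_kernel ?N F' q = a_kernel ?N F p"
  proof -
    have "h (p v) = \<zero>\<^bsub>F'\<^esub> \<longleftrightarrow> p v = \<zero>\<^bsub>F\<^esub>" if "v \<in> carrier ?N" for v
      using inj_on_eq_iff[OF bij_betw_imp_inj_on[OF bij] pin[OF that] F.M.zero_closed] h0 by simp
    then show ?thesis by (auto simp: a_kernel_def kernel_def q_def compose_def)
  qed
  ultimately have "finitely_presented S F'"
    unfolding finitely_presented_def using F' d ex
    by (intro conjI exI[of _ m] exI[of _ n] exI[of _ d] exI[of _ q]) simp_all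
  moreover have "bij_betw (restrict h (carrier F)) (carrier F) (carrier F')"
    using bij by (simp cong: bij_betw_cong)
  ultimately show ?thesis using hom by blast
qed


section \<open>Group rings and locally finite groups\<close>

text \<open>Multiplication is convolution: the coefficient of \<open>ab\<close> at \<open>x\<close> is the sum of \<open>a(y) b(z)\<close> over
  all \<open>y, z\<close> with \<open>yz = x\<close>.\<close>

definition group_ring ::
  "('r, 'm) ring_scheme \<Rightarrow> ('g, 'n) monoid_scheme \<Rightarrow> ('g \<Rightarrow> 'r) ring"
where
  "group_ring R G =
    \<lparr>carrier = fin_supp_funs R (carrier G),
     mult = (\<lambda>a b x. if x \<in> carrier G
       then finsum R (\<lambda>y. a y \<otimes>\<^bsub>R\<^esub> b (inv\<^bsub>G\<^esub> y \<otimes>\<^bsub>G\<^esub> x)) {y. a y \<noteq> \<zero>\<^bsub>R\<^esub>}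
       else \<zero>\<^bsub>R\<^esub>),
     one = (\<lambda>x. if x = \<one>\<^bsub>G\<^esub> then \<one>\<^bsub>R\<^esub> else \<zero>\<^bsub>R\<^esub>),
     zero = (\<lambda>x. \<zero>\<^bsub>R\<^esub>),
     add = (\<lambda>a b x. a x \<oplus>\<^bsub>R\<^esub> b x)\<rparr>"

definition locally_finite_group :: "('g, 'n) monoid_scheme \<Rightarrow> bool" where
  "locally_finite_group G \<longleftrightarrow>
    (\<forall>H. subgroup H G \<and> (\<exists>A. finite A \<and> A \<subseteq> carrier G \<and> H = generate G A) \<longrightarrow> finite H)"

end

theory Submission
  imports Defs
begin

text \<open>Dimension shifting along \<open>0 \<rightarrow> K \<rightarrow> S\<^sup>n \<rightarrow> F \<rightarrow> 0\<close> identifies \<open>Ext\<^sup>1(F, S)\<close> with the obstruction to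
  extending homomorphisms \<open>K \<rightarrow> S\<close> to \<open>S\<^sup>n\<close>. In coordinates, \<open>S\<close> is left FP-injective iff every finite
  linear system \<open>A b = c\<close> is solvable as soon as \<open>s A = 0\<close> implies \<open>s c = 0\<close> for all rows \<open>s\<close>.

  A system over \<open>R\<close> can be solved over \<open>R(G)\<close> and its coefficients at \<open>1\<close> compared, so \<open>R\<close> inherits the
  property from \<open>R(G)\<close>. If \<open>g\<^sub>1, \<dots>, g\<^sub>n\<close> generate an infinite subgroup, an element \<open>s\<close> of \<open>R(G)\<close> with
  \<open>s (1 - g\<^sub>j) = 0\<close> for all \<open>j\<close> is constant on infinite cosets, hence zero; so \<open>\<Sum>\<^sub>j (1 - g\<^sub>j) b\<^sub>j = 1\<close> would
  be solvable, and the augmentation would give \<open>0 = 1\<close>. Conversely, the entries of a finite system over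
  \<open>R(G)\<close> with \<open>G\<close> locally finite lie in \<open>R(H)\<close> for a finite subgroup \<open>H\<close>, and over \<open>R(H)\<close> the system
  is a finite system over \<open>R\<close>.\<close>

section \<open>Left modules and extensions of homomorphisms\<close>

text \<open>\<open>Ext1\<close> uses the canonical resolution, in which every element of
  \<open>F\<close> is a basis vector, while a finite presentation provides some other free module
  \<open>S^n\<close> over \<open>F\<close>. The bridge is that extendability of homomorphisms from
  the kernel does not depend on the free module mapped onto \<open>F\<close>. Matrices then replace
  modules altogether: a change of ring along \<open>R \<subseteq> R(H) \<subseteq> R(G)\<close>
  becomes a comparison of coefficients, and systems may carry any finite index sets, such as
  \<open>I \<times> H\<close>, although \<open>FP_injective\<close> speaks about a single type of
  modules. Sides matter because nothing commutes: the test rows \<open>s\<close> multiply from the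
  left, the unknowns \<open>b\<close> from the right. Where an auxiliary map built with signs has to
  be linear all the same, this is so because 1 and -1 are central. Over the zero ring
  \<open>R(G)\<close> is zero, hence FP-injective for every \<open>G\<close>; that 1 and 0 differ in
  \<open>R\<close> is what makes the augmentation argument a contradiction.\<close>

lemma (in abelian_monoid) finsum_swap:
  assumes "finite A" "finite B" and "\<And>a b. \<lbrakk>a \<in> A; b \<in> B\<rbrakk> \<Longrightarrow> f a b \<in> carrier G"
  shows "(\<Oplus>a\<in>A. \<Oplus>b\<in>B. f a b) = (\<Oplus>b\<in>B. \<Oplus>a\<in>A. f a b)"
  using assms(1,3)
proof (induction A rule: finite_induct)
  case empty
  then show ?case by (simp add: add.finprod_one_eqI)
next
  case (insert x F)
  have "(\<Oplus>a\<in>insert x F. \<Oplus>b\<in>B. f a b) = (\<Oplus>b\<in>B. f x b) \<oplus> (\<Oplus>b\<in>B. \<Oplus>a\<in>F. f a b)"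
    using insert by (subst finsum_insert) (auto intro!: finsum_closed)
  also have "\<dots> = (\<Oplus>b\<in>B. f x b \<oplus> (\<Oplus>a\<in>F. f a b))"
    using insert by (subst finsum_addf) (auto intro!: finsum_closed)
  also have "\<dots> = (\<Oplus>b\<in>B. \<Oplus>a\<in>insert x F. f a b)"
    using insert by (intro finsum_cong') (auto intro!: finsum_closed)
  finally show ?case .
qed

context left_module begin

lemma smult_l_null: "x \<in> carrier M \<Longrightarrow> \<zero>\<^bsub>S\<^esub> \<odot>\<^bsub>M\<^esub> x = \<zero>\<^bsub>M\<^esub>"
  using smult_l_distr[of "\<zero>\<^bsub>S\<^esub>" "\<zero>\<^bsub>S\<^esub>" x] smult_closed[of "\<zero>\<^bsub>S\<^esub>" x]
  by (simp add: M.add.l_cancel_one')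

lemma smult_r_null: "a \<in> carrier S \<Longrightarrow> a \<odot>\<^bsub>M\<^esub> \<zero>\<^bsub>M\<^esub> = \<zero>\<^bsub>M\<^esub>"
  using smult_r_distr[of a "\<zero>\<^bsub>M\<^esub>" "\<zero>\<^bsub>M\<^esub>"] smult_closed[of a "\<zero>\<^bsub>M\<^esub>"]
  by (simp add: M.add.l_cancel_one')

text \<open>Subtraction in a module is mostly expressed as adding a multiple by -1. Linearity and
  closure under scalars then cover negatives, in submodules as well as under homomorphisms.\<close>

lemma add_smult_minus_one:
  assumes "x \<in> carrier M"
  shows "x \<oplus>\<^bsub>M\<^esub> (\<ominus>\<^bsub>S\<^esub> \<one>\<^bsub>S\<^esub>) \<odot>\<^bsub>M\<^esub> x = \<zero>\<^bsub>M\<^esub>"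
  using smult_l_distr[of "\<one>\<^bsub>S\<^esub>" "\<ominus>\<^bsub>S\<^esub> \<one>\<^bsub>S\<^esub>" x] assms
  by (simp add: smult_one smult_l_null S.r_neg)

text \<open>An infinite \<open>I\<close> is harmless: both sums then have the default value zero,
  and \<open>a\<close> times zero is zero.\<close>

lemma smult_finsum:
  assumes "a \<in> carrier S" "\<And>i. i \<in> I \<Longrightarrow> f i \<in> carrier M"
  shows "a \<odot>\<^bsub>M\<^esub> (\<Oplus>\<^bsub>M\<^esub>i\<in>I. f i) = (\<Oplus>\<^bsub>M\<^esub>i\<in>I. a \<odot>\<^bsub>M\<^esub> f i)"
  using assms(2)
  by (induction I rule: infinite_finite_induct)
     (simp_all add: smult_r_null assms(1) smult_r_distr smult_closed Pi_def M.finsum_closed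
        M.finsum_infinite)

lemma submodule:
  assumes K: "K \<subseteq> carrier M" "\<zero>\<^bsub>M\<^esub> \<in> K" "\<And>x y. \<lbrakk>x \<in> K; y \<in> K\<rbrakk> \<Longrightarrow> x \<oplus>\<^bsub>M\<^esub> y \<in> K"
    "\<And>s x. \<lbrakk>s \<in> carrier S; x \<in> K\<rbrakk> \<Longrightarrow> s \<odot>\<^bsub>M\<^esub> x \<in> K"
  shows "left_module S (M\<lparr>carrier := K\<rparr>)"
proof -
  have K': "x \<in> carrier M" if "x \<in> K" for x using that K(1) by blast
  have "abelian_group (M\<lparr>carrier := K\<rparr>)"
  proof (rule abelian_groupI)
    fix x assume "x \<in> carrier (M\<lparr>carrier := K\<rparr>)"
    then have x: "x \<in> K" by simp
    with add_smult_minus_one[of x]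
    show "\<exists>y\<in>carrier (M\<lparr>carrier := K\<rparr>). y \<oplus>\<^bsub>M\<lparr>carrier := K\<rparr>\<^esub> x = \<zero>\<^bsub>M\<lparr>carrier := K\<rparr>\<^esub>"
      by (intro bexI[of _ "(\<ominus>\<^bsub>S\<^esub> \<one>\<^bsub>S\<^esub>) \<odot>\<^bsub>M\<^esub> x"]) (auto simp: K K' M.a_comm smult_closed)
  qed (auto simp: K K' M.a_ac)
  then show ?thesis
    by (intro left_module.intro left_module_axioms.intro S.ring_axioms)
       (auto simp: K K' smult_l_distr smult_r_distr smult_assoc smult_one)
qed

end

section \<open>The regular module; homomorphisms, their kernels and images\<close>

lemma left_module_regular:
  assumes "ring S" shows "left_module S (left_regular_module S)"
proof -
  interpret ring S by fact
  have "abelian_group (left_regular_module S)"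
    by (rule abelian_groupI) (auto simp: left_regular_module_def a_ac intro: l_neg)
  then show ?thesis
    by (intro left_module.intro left_module_axioms.intro assms)
       (auto simp: left_regular_module_def l_distr r_distr m_assoc)
qed

lemma finsum_left_regular_module [simp]:
  "finsum (left_regular_module S) f X = finsum S f X"
  by (simp add: finsum_def left_regular_module_def finprod_def)

lemma left_regular_module_simps [simp]:
  "carrier (left_regular_module S) = carrier S"
  "smult (left_regular_module S) = mult S"
  "add (left_regular_module S) = add S"
  "zero (left_regular_module S) = zero S"
  by (simp_all add: left_regular_module_def)

lemma left_homD:
  assumes "f \<in> left_hom S A B"
  shows "x \<in> carrier A \<Longrightarrow> f x \<in> carrier B"
    and "\<lbrakk>x \<in> carrier A; y \<in> carrier A\<rbrakk> \<Longrightarrow> f (x \<oplus>\<^bsub>A\<^esub> y) = f x \<oplus>\<^bsub>B\<^esub> f y"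
    and "\<lbrakk>s \<in> carrier S; x \<in> carrier A\<rbrakk> \<Longrightarrow> f (s \<odot>\<^bsub>A\<^esub> x) = s \<odot>\<^bsub>B\<^esub> f x"
  using assms by (auto simp: left_hom_def)

lemma left_hom_zero:
  assumes "f \<in> left_hom S A B" "left_module S A" "left_module S B"
  shows "f \<zero>\<^bsub>A\<^esub> = \<zero>\<^bsub>B\<^esub>"
proof -
  interpret A: left_module S A by fact
  interpret B: left_module S B by fact
  show ?thesis
    using left_homD(3)[OF assms(1), of "\<zero>\<^bsub>S\<^esub>" "\<zero>\<^bsub>A\<^esub>"] left_homD(1)[OF assms(1), of "\<zero>\<^bsub>A\<^esub>"]
    by (simp add: A.smult_l_null B.smult_l_null)
qed

lemma left_homI:
  assumes "left_module S A"
    and "\<And>x. x \<in> carrier A \<Longrightarrow> f x \<in> carrier B"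
    and "\<And>x y. \<lbrakk>x \<in> carrier A; y \<in> carrier A\<rbrakk> \<Longrightarrow> f (x \<oplus>\<^bsub>A\<^esub> y) = f x \<oplus>\<^bsub>B\<^esub> f y"
    and "\<And>s x. \<lbrakk>s \<in> carrier S; x \<in> carrier A\<rbrakk> \<Longrightarrow> f (s \<odot>\<^bsub>A\<^esub> x) = s \<odot>\<^bsub>B\<^esub> f x"
  shows "restrict f (carrier A) \<in> left_hom S A B"
proof -
  interpret A: left_module S A by fact
  show ?thesis using assms(2-) by (auto simp: left_hom_def A.smult_closed)
qed

lemma left_hom_compose:
  assumes "left_module S A" "f \<in> left_hom S A B" "g \<in> left_hom S B C"
  shows "compose (carrier A) g f \<in> left_hom S A C"
  unfolding compose_def
  by (rule left_homI[OF assms(1)]) (simp_all add: left_homD[OF assms(2)] left_homD[OF assms(3)])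

lemma left_hom_finsum:
  assumes "f \<in> left_hom S A B" "left_module S A" "left_module S B"
    and "\<And>i. i \<in> I \<Longrightarrow> x i \<in> carrier A"
  shows "f (\<Oplus>\<^bsub>A\<^esub>i\<in>I. x i) = (\<Oplus>\<^bsub>B\<^esub>i\<in>I. f (x i))"
proof -
  interpret A: left_module S A by fact
  interpret B: left_module S B by fact
  show ?thesis using assms(4)
    by (induction I rule: infinite_finite_induct)
       (simp_all add: left_hom_zero[OF assms(1-3)] left_homD[OF assms(1)] Pi_def A.M.finsum_closed
         A.M.finsum_infinite B.M.finsum_infinite)
qed

lemma left_hom_extensional: "f \<in> left_hom S A B \<Longrightarrow> f \<in> extensional (carrier A)"
  by (auto simp: left_hom_def PiE_def)

lemma a_kernel_iff: "x \<in> a_kernel A B f \<longleftrightarrow> x \<in> carrier A \<and> f x = \<zero>\<^bsub>B\<^esub>"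
  by (simp add: a_kernel_def kernel_def)

lemma left_module_kernel:
  assumes "f \<in> left_hom S A B" "left_module S A" "left_module S B"
  shows "left_module S (A\<lparr>carrier := a_kernel A B f\<rparr>)"
proof -
  interpret A: left_module S A by fact
  interpret B: left_module S B by fact
  show ?thesis
    by (rule A.submodule)
       (auto simp: a_kernel_iff left_homD[OF assms(1)] left_hom_zero[OF assms] A.smult_closed
          B.smult_r_null)
qed

lemma left_module_image:
  assumes "f \<in> left_hom S A B" "left_module S A" "left_module S B"
  shows "left_module S (B\<lparr>carrier := f ` carrier A\<rparr>)"
proof -
  interpret A: left_module S A by fact
  interpret B: left_module S B by fact
  note h = left_homD[OF assms(1)]
  show ?thesis
  proof (rule B.submodule)
    show "\<zero>\<^bsub>B\<^esub> \<in> f ` carrier A"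
      using left_hom_zero[OF assms] by (metis A.M.zero_closed imageI)
  qed (auto simp: h A.smult_closed simp flip: h(2) h(3))
qed

text \<open>For \<open>K\<close> the kernel of a map from a free module \<open>N\<close> onto
  \<open>F\<close>, this says that restriction from Hom(N, M) to Hom(K, M) is surjective; the
  cokernel of that restriction is the first Ext group of \<open>F\<close> and
  \<open>M\<close>.\<close>

definition hom_extension ::
  "('s, 'm) ring_scheme \<Rightarrow> ('s, 'a, 'k) module_scheme \<Rightarrow> 'a set \<Rightarrow> ('s, 'b, 'l) module_scheme \<Rightarrow> bool"
where
  "hom_extension S N K M \<longleftrightarrow>
    (\<forall>f\<in>left_hom S (N\<lparr>carrier := K\<rparr>) M. \<exists>g\<in>left_hom S N M. \<forall>k\<in>K. g k = f k)"

text \<open>\<open>N\<close> and \<open>P\<close> are two modules over \<open>F\<close>, with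
  comparison maps \<open>\<alpha>\<close> and \<open>\<beta>\<close> that commute with the maps to
  \<open>F\<close>. They need not be inverse to each other, but
  \<open>v - \<alpha> (\<beta> v)\<close> lies in the kernel of \<open>p\<close>, where
  \<open>\<phi>\<close> is already defined. This difference corrects the extension obtained by way
  of \<open>P\<close>.\<close>

lemma hom_extension_transfer:
  fixes N :: "('s, 'a, 'k) module_scheme" and P :: "('s, 'b, 'l) module_scheme"
  assumes mods: "left_module S N" "left_module S P" "left_module S F" "left_module S M"
    and homs: "p \<in> left_hom S N F" "e \<in> left_hom S P F"
      "\<alpha> \<in> left_hom S P N" "\<beta> \<in> left_hom S N P"
    and comm: "\<And>u. u \<in> carrier P \<Longrightarrow> p (\<alpha> u) = e u" "\<And>v. v \<in> carrier N \<Longrightarrow> e (\<beta> v) = p v"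
    and ext: "hom_extension S P (a_kernel P F e) M"
  shows "hom_extension S N (a_kernel N F p) M"
  unfolding hom_extension_def
proof
  let ?K = "N\<lparr>carrier := a_kernel N F p\<rparr>" and ?L = "P\<lparr>carrier := a_kernel P F e\<rparr>"
  interpret N: left_module S N by fact
  interpret P: left_module S P by fact
  interpret F: left_module S F by fact
  interpret M: left_module S M by fact
  note p = left_homD[OF homs(1)] and e = left_homD[OF homs(2)]
    and a = left_homD[OF homs(3)] and b = left_homD[OF homs(4)]
  fix \<phi> assume \<phi>: "\<phi> \<in> left_hom S ?K M"
  note ph = left_homD[OF this, simplified]
  have aK: "\<alpha> u \<in> a_kernel N F p" if "u \<in> a_kernel P F e" for u
    using that by (simp add: a_kernel_iff a comm)
  have "(\<lambda>u\<in>carrier ?L. \<phi> (\<alpha> u)) \<in> left_hom S ?L M"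
    by (rule left_homI[OF left_module_kernel[OF homs(2) mods(2,3)]])
       (use aK in \<open>auto simp: ph a_kernel_iff a\<close>)
  then obtain \<psi> where psi: "\<psi> \<in> left_hom S P M"
    and psi_eq: "\<And>u. u \<in> a_kernel P F e \<Longrightarrow> \<psi> u = \<phi> (\<alpha> u)"
    using ext unfolding hom_extension_def by force
  note ps = left_homD[OF psi]
  define m1 where "m1 = \<ominus>\<^bsub>S\<^esub> \<one>\<^bsub>S\<^esub>"
  have m1: "m1 \<in> carrier S" by (simp add: m1_def)
  \<comment> \<open>-1 is central, so \<open>\<gamma>\<close> is linear although \<open>S\<close>
    need not be commutative.\<close>
  have m1_comm: "m1 \<odot>\<^bsub>N\<^esub> (s \<odot>\<^bsub>N\<^esub> v) = s \<odot>\<^bsub>N\<^esub> (m1 \<odot>\<^bsub>N\<^esub> v)"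
    if "s \<in> carrier S" "v \<in> carrier N" for s v
    using that by (simp add: m1_def N.S.l_minus N.S.r_minus flip: N.smult_assoc)
  define \<gamma> where "\<gamma> v = v \<oplus>\<^bsub>N\<^esub> m1 \<odot>\<^bsub>N\<^esub> \<alpha> (\<beta> v)" for v
  have gK: "\<gamma> v \<in> a_kernel N F p" if "v \<in> carrier N" for v
    using that F.add_smult_minus_one[of "p v"]
    by (simp add: \<gamma>_def a_kernel_iff p a b comm m1 N.smult_closed flip: m1_def)
  have gadd: "\<gamma> (v \<oplus>\<^bsub>N\<^esub> w) = \<gamma> v \<oplus>\<^bsub>N\<^esub> \<gamma> w" if "v \<in> carrier N" "w \<in> carrier N" for v w
    using that by (simp add: \<gamma>_def a b m1 N.smult_r_distr N.smult_closed N.M.a_ac)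
  have gsm: "\<gamma> (s \<odot>\<^bsub>N\<^esub> v) = s \<odot>\<^bsub>N\<^esub> \<gamma> v" if "v \<in> carrier N" "s \<in> carrier S" for s v
    using that by (simp add: \<gamma>_def a b m1 N.smult_r_distr N.smult_closed m1_comm)
  \<comment> \<open>On the kernel of \<open>p\<close> the map \<open>\<psi> \<circ> \<beta>\<close>
    alone restricts to \<open>\<phi> \<circ> \<alpha> \<circ> \<beta>\<close>; the summand
    \<open>\<phi> \<circ> \<gamma>\<close> supplies the missing
    \<open>\<phi> k - \<phi> (\<alpha> (\<beta> k))\<close>.\<close>
  define \<theta> where "\<theta> v = \<psi> (\<beta> v) \<oplus>\<^bsub>M\<^esub> \<phi> (\<gamma> v)" for v
  have "restrict \<theta> (carrier N) \<in> left_hom S N M"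
    by (rule left_homI[OF mods(1)])
       (simp_all add: \<theta>_def gadd gsm gK b ps ph M.M.a_ac M.smult_r_distr M.smult_closed)
  moreover have "restrict \<theta> (carrier N) k = \<phi> k" if k: "k \<in> a_kernel N F p" for k
  proof -
    have kN: "k \<in> carrier N" using k by (simp add: a_kernel_iff)
    then have bk: "\<beta> k \<in> a_kernel P F e" using k by (simp add: a_kernel_iff b comm)
    have "m1 \<odot>\<^bsub>N\<^esub> \<alpha> (\<beta> k) \<in> a_kernel N F p"
      using aK[OF bk] by (simp add: a_kernel_iff p m1 N.smult_closed F.smult_r_null)
    then have "\<theta> k = \<phi> (\<alpha> (\<beta> k)) \<oplus>\<^bsub>M\<^esub> (\<phi> k \<oplus>\<^bsub>M\<^esub> m1 \<odot>\<^bsub>M\<^esub> \<phi> (\<alpha> (\<beta> k)))"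
      by (simp add: \<theta>_def \<gamma>_def psi_eq bk ph k m1 aK)
    also have "\<dots> = \<phi> k \<oplus>\<^bsub>M\<^esub> (\<phi> (\<alpha> (\<beta> k)) \<oplus>\<^bsub>M\<^esub> m1 \<odot>\<^bsub>M\<^esub> \<phi> (\<alpha> (\<beta> k)))"
      using ph(1)[OF k] ph(1)[OF aK[OF bk]] m1 by (simp add: M.M.a_ac M.smult_closed)
    also have "\<dots> = \<phi> k"
      using ph(1)[OF k] ph(1)[OF aK[OF bk]] by (simp add: m1_def M.add_smult_minus_one)
    finally show ?thesis by (simp add: kN)
  qed
  ultimately show "\<exists>g\<in>left_hom S N M. \<forall>k\<in>a_kernel N F p. g k = \<phi> k" by blast
qed

section \<open>Free modules\<close>

lemma free_left_module_simps [simp]: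
  "carrier (free_left_module S X) = fin_supp_funs S X"
  "zero (free_left_module S X) = (\<lambda>x. \<zero>\<^bsub>S\<^esub>)"
  "add (free_left_module S X) = (\<lambda>f g x. f x \<oplus>\<^bsub>S\<^esub> g x)"
  "smult (free_left_module S X) = (\<lambda>s f x. s \<otimes>\<^bsub>S\<^esub> f x)"
  by (simp_all add: free_left_module_def)

lemma fin_supp_funsD:
  assumes "f \<in> fin_supp_funs S X"
  shows "x \<in> X \<Longrightarrow> f x \<in> carrier S" "x \<notin> X \<Longrightarrow> f x = \<zero>\<^bsub>S\<^esub>" "finite {x. f x \<noteq> \<zero>\<^bsub>S\<^esub>}"
    "{x. f x \<noteq> \<zero>\<^bsub>S\<^esub>} \<subseteq> X"
  using assms by (auto simp: fin_supp_funs_def)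

context ring begin

lemma fin_supp_funs_in_carrier: "f \<in> fin_supp_funs R X \<Longrightarrow> f x \<in> carrier R"
  by (cases "x \<in> X") (auto simp: fin_supp_funs_def)

lemma fin_supp_funsI:
  assumes "finite Y" "Y \<subseteq> X" "\<And>x. x \<in> Y \<Longrightarrow> f x \<in> carrier R" "\<And>x. x \<notin> Y \<Longrightarrow> f x = \<zero>"
  shows "f \<in> fin_supp_funs R X"
proof -
  have "{x. f x \<noteq> \<zero>} \<subseteq> Y" using assms(4) by blast
  with assms show ?thesis unfolding fin_supp_funs_def
    by (auto intro: finite_subset) (metis zero_closed)
qed

lemma fin_supp_funs_add:
  assumes "f \<in> fin_supp_funs R X" "g \<in> fin_supp_funs R X"
  shows "(\<lambda>x. f x \<oplus> g x) \<in> fin_supp_funs R X"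
  by (rule fin_supp_funsI[of "{x. f x \<noteq> \<zero>} \<union> {x. g x \<noteq> \<zero>}"])
     (use assms in \<open>auto simp: fin_supp_funsD(3) fin_supp_funs_in_carrier dest: fin_supp_funsD(2)\<close>)

lemma fin_supp_funs_smult:
  assumes "s \<in> carrier R" "f \<in> fin_supp_funs R X"
  shows "(\<lambda>x. s \<otimes> f x) \<in> fin_supp_funs R X"
  by (rule fin_supp_funsI[of "{x. f x \<noteq> \<zero>}"])
     (use assms in \<open>auto simp: fin_supp_funsD(3) fin_supp_funs_in_carrier dest: fin_supp_funsD(2)\<close>)

lemma fin_supp_funs_zero: "(\<lambda>x. \<zero>) \<in> fin_supp_funs R X"
  by (simp add: fin_supp_funs_def)

lemma left_module_free: "left_module R (free_left_module R X)"
proof -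
  have "abelian_group (free_left_module R X)"
  proof (rule abelian_groupI)
    fix f assume f: "f \<in> carrier (free_left_module R X)"
    then have "(\<lambda>x. \<ominus> f x) \<in> fin_supp_funs R X"
      using fin_supp_funs_smult[of "\<ominus> \<one>" f X] by (simp add: l_minus fin_supp_funs_in_carrier)
    with f show "\<exists>g\<in>carrier (free_left_module R X).
        g \<oplus>\<^bsub>free_left_module R X\<^esub> f = \<zero>\<^bsub>free_left_module R X\<^esub>"
      by (intro bexI[of _ "\<lambda>x. \<ominus> f x"]) (auto simp: fin_supp_funs_in_carrier l_neg)
  qed (auto simp: fin_supp_funs_add fin_supp_funs_zero fin_supp_funs_in_carrier a_ac)
  then show ?thesis
    by (intro left_module.intro left_module_axioms.intro ring_axioms)
       (auto simp: fin_supp_funs_add fin_supp_funs_smult fin_supp_funs_in_carrier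
          l_distr r_distr m_assoc)
qed

definition unit_fun :: "'x \<Rightarrow> 'x \<Rightarrow> 'a" where
  "unit_fun x = (\<lambda>y. if y = x then \<one> else \<zero>)"

lemma unit_fun_closed: "x \<in> X \<Longrightarrow> unit_fun x \<in> fin_supp_funs R X"
  by (rule fin_supp_funsI[of "{x}"]) (auto simp: unit_fun_def)

end

context left_module begin

text \<open>The homomorphism given by the universal property of the free module on \<open>X\<close>.
  It is restricted to the carrier because members of \<open>left_hom\<close> are extensional; for
  \<open>\<sigma>\<close> the identity it is \<open>free_eval\<close>.\<close>

definition free_lift :: "'x set \<Rightarrow> ('x \<Rightarrow> 'a) \<Rightarrow> ('x \<Rightarrow> 's) \<Rightarrow> 'a" where
  "free_lift X \<sigma> = (\<lambda>f\<in>fin_supp_funs S X. \<Oplus>\<^bsub>M\<^esub>x\<in>{x. f x \<noteq> \<zero>\<^bsub>S\<^esub>}. f x \<odot>\<^bsub>M\<^esub> \<sigma> x)"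

text \<open>The freedom in \<open>Y\<close> allows functions with different supports to be compared
  over one index set, which additivity of the lift requires.\<close>

lemma free_lift_eq:
  assumes "f \<in> fin_supp_funs S X" "finite Y" "{x. f x \<noteq> \<zero>\<^bsub>S\<^esub>} \<subseteq> Y" "Y \<subseteq> X"
    "\<And>x. x \<in> X \<Longrightarrow> \<sigma> x \<in> carrier M"
  shows "free_lift X \<sigma> f = (\<Oplus>\<^bsub>M\<^esub>x\<in>Y. f x \<odot>\<^bsub>M\<^esub> \<sigma> x)"
proof -
  have "(\<Oplus>\<^bsub>M\<^esub>x\<in>{x. f x \<noteq> \<zero>\<^bsub>S\<^esub>}. f x \<odot>\<^bsub>M\<^esub> \<sigma> x) = (\<Oplus>\<^bsub>M\<^esub>x\<in>Y. f x \<odot>\<^bsub>M\<^esub> \<sigma> x)"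
    using assms
    by (intro M.add.finprod_mono_neutral_cong_left)
       (auto simp: smult_l_null smult_closed S.fin_supp_funs_in_carrier subset_iff)
  with assms(1) show ?thesis by (simp add: free_lift_def)
qed

lemma free_lift_hom:
  assumes \<sigma>: "\<And>x. x \<in> X \<Longrightarrow> \<sigma> x \<in> carrier M"
  shows "free_lift X \<sigma> \<in> left_hom S (free_left_module S X) M"
proof -
  interpret P: left_module S "free_left_module S X" by (rule S.left_module_free)
  let ?s = "\<lambda>f :: 'c \<Rightarrow> 's. {x. f x \<noteq> \<zero>\<^bsub>S\<^esub>}"
  have eq: "free_lift X \<sigma> f = (\<Oplus>\<^bsub>M\<^esub>x\<in>Y. f x \<odot>\<^bsub>M\<^esub> \<sigma> x)"
    if "f \<in> fin_supp_funs S X" "finite Y" "?s f \<subseteq> Y" "Y \<subseteq> X" for f Y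
    using that by (intro free_lift_eq \<sigma>)
  have "restrict (free_lift X \<sigma>) (carrier (free_left_module S X))
    \<in> left_hom S (free_left_module S X) M"
  proof (rule left_homI[OF S.left_module_free])
    fix f assume f: "f \<in> carrier (free_left_module S X)"
    then show "free_lift X \<sigma> f \<in> carrier M"
      using \<sigma> fin_supp_funsD(4)[of f S X] S.fin_supp_funs_in_carrier[of f X]
      by (auto simp: free_lift_def intro!: M.finsum_closed smult_closed)
    fix s assume s: "s \<in> carrier S"
    have sf: "(\<lambda>x. s \<otimes>\<^bsub>S\<^esub> f x) \<in> fin_supp_funs S X"
      using f s by (simp add: S.fin_supp_funs_smult)
    have "free_lift X \<sigma> (\<lambda>x. s \<otimes>\<^bsub>S\<^esub> f x) = (\<Oplus>\<^bsub>M\<^esub>x\<in>?s f. (s \<otimes>\<^bsub>S\<^esub> f x) \<odot>\<^bsub>M\<^esub> \<sigma> x)"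
      using f s by (intro eq sf) (auto simp: fin_supp_funsD(3) dest: fin_supp_funsD(2))
    also have "\<dots> = s \<odot>\<^bsub>M\<^esub> (\<Oplus>\<^bsub>M\<^esub>x\<in>?s f. f x \<odot>\<^bsub>M\<^esub> \<sigma> x)"
      using f s \<sigma> fin_supp_funsD(4)[of f S X]
      by (subst smult_finsum)
         (auto intro!: M.finsum_cong' simp: smult_closed smult_assoc S.fin_supp_funs_in_carrier subset_iff)
    also have "(\<Oplus>\<^bsub>M\<^esub>x\<in>?s f. f x \<odot>\<^bsub>M\<^esub> \<sigma> x) = free_lift X \<sigma> f"
      using f by (intro eq[symmetric]) (auto simp: fin_supp_funsD(3) dest: fin_supp_funsD(2))
    finally show "free_lift X \<sigma> (s \<odot>\<^bsub>free_left_module S X\<^esub> f) = s \<odot>\<^bsub>M\<^esub> free_lift X \<sigma> f" by simp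
  next
    fix f g assume fg: "f \<in> carrier (free_left_module S X)" "g \<in> carrier (free_left_module S X)"
    let ?Y = "?s f \<union> ?s g"
    have Y: "finite ?Y" "?Y \<subseteq> X"
      using fg fin_supp_funsD(3,4)[of f S X] fin_supp_funsD(3,4)[of g S X] by auto
    have cl: "f x \<odot>\<^bsub>M\<^esub> \<sigma> x \<in> carrier M" "g x \<odot>\<^bsub>M\<^esub> \<sigma> x \<in> carrier M" if "x \<in> ?Y" for x
      using fg Y(2) that S.fin_supp_funs_in_carrier[of f X] S.fin_supp_funs_in_carrier[of g X]
      by (auto intro!: smult_closed \<sigma>)
    have "free_lift X \<sigma> (\<lambda>x. f x \<oplus>\<^bsub>S\<^esub> g x) = (\<Oplus>\<^bsub>M\<^esub>x\<in>?Y. (f x \<oplus>\<^bsub>S\<^esub> g x) \<odot>\<^bsub>M\<^esub> \<sigma> x)"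
      using fg Y by (intro eq S.fin_supp_funs_add) auto
    also have "\<dots> = (\<Oplus>\<^bsub>M\<^esub>x\<in>?Y. f x \<odot>\<^bsub>M\<^esub> \<sigma> x \<oplus>\<^bsub>M\<^esub> g x \<odot>\<^bsub>M\<^esub> \<sigma> x)"
      using fg Y(2) cl
      by (intro M.finsum_cong' refl smult_l_distr S.fin_supp_funs_in_carrier \<sigma>) auto
    also have "\<dots> = (\<Oplus>\<^bsub>M\<^esub>x\<in>?Y. f x \<odot>\<^bsub>M\<^esub> \<sigma> x) \<oplus>\<^bsub>M\<^esub> (\<Oplus>\<^bsub>M\<^esub>x\<in>?Y. g x \<odot>\<^bsub>M\<^esub> \<sigma> x)"
      using cl by (intro M.finsum_addf) auto
    also have "(\<Oplus>\<^bsub>M\<^esub>x\<in>?Y. f x \<odot>\<^bsub>M\<^esub> \<sigma> x) = free_lift X \<sigma> f"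
      using fg Y by (intro eq[symmetric]) auto
    also have "(\<Oplus>\<^bsub>M\<^esub>x\<in>?Y. g x \<odot>\<^bsub>M\<^esub> \<sigma> x) = free_lift X \<sigma> g"
      using fg Y by (intro eq[symmetric]) auto
    finally show "free_lift X \<sigma> (f \<oplus>\<^bsub>free_left_module S X\<^esub> g) =
        free_lift X \<sigma> f \<oplus>\<^bsub>M\<^esub> free_lift X \<sigma> g" by simp
  qed
  then show ?thesis by (simp add: free_lift_def)
qed

lemma free_lift_unit:
  assumes "\<And>x. x \<in> X \<Longrightarrow> \<sigma> x \<in> carrier M" "x \<in> X"
  shows "free_lift X \<sigma> (S.unit_fun x) = \<sigma> x"
proof -
  have "free_lift X \<sigma> (S.unit_fun x) = (\<Oplus>\<^bsub>M\<^esub>y\<in>{x}. S.unit_fun x y \<odot>\<^bsub>M\<^esub> \<sigma> y)"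
    using assms by (intro free_lift_eq S.unit_fun_closed) (auto simp: S.unit_fun_def)
  also have "\<dots> = \<sigma> x" using assms by (simp add: S.unit_fun_def smult_one)
  finally show ?thesis .
qed

lemma free_hom_eqI:
  assumes "f \<in> left_hom S (free_left_module S X) M" "g \<in> left_hom S (free_left_module S X) M"
    and "\<And>x. x \<in> X \<Longrightarrow> f (S.unit_fun x) = g (S.unit_fun x)"
  shows "f = g"
proof -
  note f = left_homD[OF assms(1), simplified] and g = left_homD[OF assms(2), simplified]
  \<comment> \<open>The induction is on a finite bound for the support, with \<open>u\<close>
    universally quantified, so that \<open>u\<close> with one point removed falls under the
    induction hypothesis.\<close>
  have "\<forall>u. u \<in> fin_supp_funs S X \<longrightarrow> {x. u x \<noteq> \<zero>\<^bsub>S\<^esub>} \<subseteq> Y \<longrightarrow> f u = g u" if "finite Y" for Y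
    using that
  proof (induction Y rule: finite_induct)
    case empty
    have "f (\<lambda>x. \<zero>\<^bsub>S\<^esub>) = g (\<lambda>x. \<zero>\<^bsub>S\<^esub>)"
      using left_hom_zero[OF assms(1) S.left_module_free left_module_axioms]
        left_hom_zero[OF assms(2) S.left_module_free left_module_axioms] by simp
    then show ?case by (auto simp flip: fun_eq_iff)
  next
    case (insert y Y)
    show ?case
    proof (intro allI impI)
      fix u assume u: "u \<in> fin_supp_funs S X" "{x. u x \<noteq> \<zero>\<^bsub>S\<^esub>} \<subseteq> insert y Y"
      have uc: "u x \<in> carrier S" for x using u by (simp add: S.fin_supp_funs_in_carrier)
      define v where "v = u(y := \<zero>\<^bsub>S\<^esub>)"
      have v: "v \<in> fin_supp_funs S X" "{x. v x \<noteq> \<zero>\<^bsub>S\<^esub>} \<subseteq> Y"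
        using u by (auto intro!: S.fin_supp_funsI[of "{x. u x \<noteq> \<zero>\<^bsub>S\<^esub>}"]
          simp: v_def uc fin_supp_funsD(3) dest: fin_supp_funsD(2) split: if_splits)
      show "f u = g u"
      proof (cases "y \<in> X")
        case True
        let ?e = "S.unit_fun y"
        have e: "?e \<in> fin_supp_funs S X" using True by (rule S.unit_fun_closed)
        have "u = (\<lambda>x. u y \<otimes>\<^bsub>S\<^esub> ?e x \<oplus>\<^bsub>S\<^esub> v x)" by (auto simp: S.unit_fun_def uc v_def)
        moreover have "f (\<lambda>x. u y \<otimes>\<^bsub>S\<^esub> ?e x \<oplus>\<^bsub>S\<^esub> v x) = g (\<lambda>x. u y \<otimes>\<^bsub>S\<^esub> ?e x \<oplus>\<^bsub>S\<^esub> v x)"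
          using insert.IH v by (simp add: f g e uc S.fin_supp_funs_smult assms(3) True)
        ultimately show ?thesis by simp
      next
        case False
        then have "v = u" using u(1) fin_supp_funsD(2) by (fastforce simp: v_def)
        then show ?thesis using insert.IH v by simp
      qed
    qed
  qed
  then have "f u = g u" if "u \<in> fin_supp_funs S X" for u
    using that fin_supp_funsD(3)[OF that] by blast
  then show ?thesis
    using extensionalityI[OF left_hom_extensional[OF assms(1)] left_hom_extensional[OF assms(2)]]
    by simp
qed

lemma free_eval_eq: "free_eval S M X = free_lift X (\<lambda>x. x)"
  by (simp add: free_eval_def free_lift_def)

text \<open>By uniqueness \<open>f\<close> is the lift of its own values on the basis; as
  \<open>X\<close> is finite, the sum may run over all of it.\<close>

lemma free_hom_eq_sum:
  assumes f: "f \<in> left_hom S (free_left_module S X) M" and X: "finite X" and u: "u \<in> fin_supp_funs S X"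
  shows "f u = (\<Oplus>\<^bsub>M\<^esub>x\<in>X. u x \<odot>\<^bsub>M\<^esub> f (S.unit_fun x))"
proof -
  have c: "f (S.unit_fun x) \<in> carrier M" if "x \<in> X" for x
    using left_homD(1)[OF f] S.unit_fun_closed[OF that] by simp
  have "f = free_lift X (\<lambda>x. f (S.unit_fun x))"
    by (rule free_hom_eqI[OF f free_lift_hom[OF c]]) (simp_all add: free_lift_unit c)
  then have "f u = free_lift X (\<lambda>x. f (S.unit_fun x)) u" by simp
  also have "\<dots> = (\<Oplus>\<^bsub>M\<^esub>x\<in>X. u x \<odot>\<^bsub>M\<^esub> f (S.unit_fun x))"
    by (rule free_lift_eq[OF u X fin_supp_funsD(4)[OF u] order_refl c])
  finally show ?thesis .
qed

end

section \<open>The first Ext group as an obstruction to extending homomorphisms\<close>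

lemma free_eval_hom:
  assumes "left_module S M" "X \<subseteq> carrier M"
  shows "free_eval S M X \<in> left_hom S (free_left_module S X) M"
    and "x \<in> X \<Longrightarrow> free_eval S M X (ring.unit_fun S x) = x"
proof -
  interpret left_module S M by fact
  show "free_eval S M X \<in> left_hom S (free_left_module S X) M"
    unfolding free_eval_eq by (rule free_lift_hom) (use assms in auto)
  show "x \<in> X \<Longrightarrow> free_eval S M X (S.unit_fun x) = x"
    unfolding free_eval_eq by (rule free_lift_unit) (use assms in auto)
qed

text \<open>This is why consecutive maps of the resolution compose to zero: a linear combination of
  kernel elements is mapped to zero term by term. It serves for the kernel in \<open>N\<close> and,
  one step further, for the kernel of \<open>d1\<close>.\<close>

lemma free_eval_in_kernel:
  assumes "left_module S N" "left_module S F" "e \<in> left_hom S N F"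
    and "u \<in> carrier (free_left_module S (a_kernel N F e))"
  shows "free_eval S N (a_kernel N F e) u \<in> a_kernel N F e"
proof -
  interpret N: left_module S N by fact
  interpret F: left_module S F by fact
  let ?K = "a_kernel N F e"
  have K: "?K \<subseteq> carrier N" by (auto simp: a_kernel_iff)
  have u: "u \<in> fin_supp_funs S ?K" using assms(4) by simp
  note supp = fin_supp_funsD(4)[OF u] and uc = N.S.fin_supp_funs_in_carrier[OF u]
  have "e (free_eval S N ?K u) = (\<Oplus>\<^bsub>F\<^esub>x\<in>{x. u x \<noteq> \<zero>\<^bsub>S\<^esub>}. e (u x \<odot>\<^bsub>N\<^esub> x))"
    using supp K u
    by (simp add: free_eval_def)
       (intro left_hom_finsum[OF assms(3,1,2)] N.smult_closed uc, auto)
  also have "\<dots> = \<zero>\<^bsub>F\<^esub>"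
    using supp
    by (intro F.M.add.finprod_one_eqI)
       (auto simp: left_homD[OF assms(3)] uc a_kernel_iff F.smult_r_null dest!: subsetD)
  finally show ?thesis
    using left_homD(1)[OF free_eval_hom(1)[OF assms(1) K] assms(4)] by (simp add: a_kernel_iff)
qed

text \<open>\<open>N\<close> stands for the term \<open>P0\<close>. The map \<open>d1\<close> sends
  the basis vector of \<open>k\<close> to \<open>k\<close>, hence maps \<open>P1\<close> onto
  \<open>K\<close>; likewise \<open>d2\<close> maps \<open>P2\<close> onto \<open>K1\<close>. A
  cocycle is thus a homomorphism on \<open>P1\<close> that vanishes on the kernel of
  \<open>d1\<close>, which amounts to a homomorphism on \<open>K\<close>; it is a coboundary exactly
  when the latter extends to \<open>N\<close>.\<close>

lemma cocycles_coboundaries_iff_hom_extension: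
  fixes N :: "('s, 'a, 'k) module_scheme"
  assumes mods: "left_module S N" "left_module S F" "left_module S M" and e: "e \<in> left_hom S N F"
  defines "K \<equiv> a_kernel N F e"
  defines "P1 \<equiv> free_left_module S K" and "d1 \<equiv> free_eval S N K"
  defines "K1 \<equiv> a_kernel P1 N d1"
  defines "P2 \<equiv> free_left_module S K1" and "d2 \<equiv> free_eval S P1 K1"
  shows "(\<forall>f\<in>left_hom S P1 M. (\<forall>t\<in>carrier P2. f (d2 t) = \<zero>\<^bsub>M\<^esub>) \<longrightarrow>
      (\<exists>g\<in>left_hom S N M. f = compose (carrier P1) g d1)) \<longleftrightarrow> hom_extension S N K M"
    (is "?L \<longleftrightarrow> ?R")
proof -
  interpret N: left_module S N by fact
  interpret F: left_module S F by fact
  interpret M: left_module S M by fact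
  have K: "K \<subseteq> carrier N" by (auto simp: K_def a_kernel_iff)
  have modP1: "left_module S P1" unfolding P1_def by (rule N.S.left_module_free)
  interpret P1: left_module S P1 by (rule modP1)
  have modK: "left_module S (N\<lparr>carrier := K\<rparr>)"
    unfolding K_def by (rule left_module_kernel[OF e mods(1,2)])
  interpret K: left_module S "N\<lparr>carrier := K\<rparr>" by (rule modK)
  note Kc = K.M.zero_closed[simplified] K.M.a_closed[simplified] K.smult_closed[simplified]
  note d1 = free_eval_hom(1)[OF mods(1) K, folded d1_def P1_def]
  have d1u: "d1 (N.S.unit_fun u) = u" if "u \<in> K" for u
    unfolding d1_def using free_eval_hom(2)[OF mods(1) K that] .
  have u1: "N.S.unit_fun u \<in> carrier P1" if "u \<in> K" for u
    using N.S.unit_fun_closed[OF that] by (simp add: P1_def)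
  have d1K: "d1 w \<in> K" if "w \<in> carrier P1" for w
    using free_eval_in_kernel[OF mods(1,2) e, folded K_def, folded P1_def d1_def, OF that] .
  have K1: "K1 \<subseteq> carrier P1" by (auto simp: K1_def a_kernel_iff)
  have d2K: "d2 t \<in> K1" if "t \<in> carrier P2" for t
    using free_eval_in_kernel[OF modP1 mods(1) d1, folded K1_def, folded P2_def d2_def, OF that] .
  have d2u: "d2 (N.S.unit_fun u) = u" if "u \<in> K1" for u
    unfolding d2_def using free_eval_hom(2)[OF modP1 K1 that] .
  have u2: "N.S.unit_fun u \<in> carrier P2" if "u \<in> K1" for u
    using N.S.unit_fun_closed[OF that] by (simp add: P2_def)
  show ?thesis
  proof
    assume L: ?L
    show ?R unfolding hom_extension_def
    proof
      fix f assume f: "f \<in> left_hom S (N\<lparr>carrier := K\<rparr>) M"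
      note fD = left_homD[OF f, simplified]
      have f1: "compose (carrier P1) f d1 \<in> left_hom S P1 M"
        unfolding compose_def
        by (rule left_homI[OF modP1]) (simp_all add: left_homD[OF d1] fD d1K)
      have "compose (carrier P1) f d1 (d2 t) = \<zero>\<^bsub>M\<^esub>" if "t \<in> carrier P2" for t
        using d2K[OF that] left_hom_zero[OF f modK mods(3)]
        by (simp add: compose_def K1_def a_kernel_iff)
      then obtain g where g: "g \<in> left_hom S N M"
        and eq: "compose (carrier P1) f d1 = compose (carrier P1) g d1"
        using L f1 by blast
      \<comment> \<open>Evaluation at the basis vector of \<open>k\<close>, which \<open>d1\<close>
        maps to \<open>k\<close>.\<close>
      have "g k = f k" if "k \<in> K" for k
        using fun_cong[OF eq, of "N.S.unit_fun k"] by (simp add: compose_def u1 d1u that)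
      with g show "\<exists>g\<in>left_hom S N M. \<forall>k\<in>K. g k = f k" by blast
    qed
  next
    assume R: ?R
    show ?L
    proof (intro ballI impI)
      fix f assume f: "f \<in> left_hom S P1 M" and z: "\<forall>t\<in>carrier P2. f (d2 t) = \<zero>\<^bsub>M\<^esub>"
      note fD = left_homD[OF f]
      have fK1: "f w = \<zero>\<^bsub>M\<^esub>" if "w \<in> K1" for w
        using z u2[OF that] d2u[OF that] by metis
      let ?m = "\<ominus>\<^bsub>S\<^esub> \<one>\<^bsub>S\<^esub>"
      \<comment> \<open>A cocycle factors through \<open>d1\<close>: two elements with the same
        image differ by an element of \<open>K1\<close>, on which \<open>f\<close> vanishes.\<close>
      have feq: "f w = f w'" if "w \<in> carrier P1" "w' \<in> carrier P1" "d1 w = d1 w'" for w w'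
      proof -
        have "w \<oplus>\<^bsub>P1\<^esub> ?m \<odot>\<^bsub>P1\<^esub> w' \<in> K1"
          using that
          by (simp add: K1_def a_kernel_iff left_homD[OF d1] P1.smult_closed N.add_smult_minus_one)
        then have "f w \<oplus>\<^bsub>M\<^esub> ?m \<odot>\<^bsub>M\<^esub> f w' = \<zero>\<^bsub>M\<^esub>"
          using fK1 that fD(2)[of w "?m \<odot>\<^bsub>P1\<^esub> w'"] by (simp add: fD P1.smult_closed)
        also have "\<zero>\<^bsub>M\<^esub> = f w' \<oplus>\<^bsub>M\<^esub> ?m \<odot>\<^bsub>M\<^esub> f w'"
          using that by (simp add: M.add_smult_minus_one fD)
        finally show ?thesis
          using that by (simp add: fD M.smult_closed M.M.add.right_cancel)
      qed
      let ?u = "N.S.unit_fun"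
      \<comment> \<open>Sending \<open>k\<close> to its basis vector is a section of
        \<open>d1\<close> but not additive; followed by \<open>f\<close> it becomes linear, by
        \<open>feq\<close>.\<close>
      have "(\<lambda>u\<in>carrier (N\<lparr>carrier := K\<rparr>). f (?u u)) \<in> left_hom S (N\<lparr>carrier := K\<rparr>) M"
      proof (rule left_homI[OF modK]; simp)
        show "f (?u x) \<in> carrier M" if "x \<in> K" for x using that by (simp add: fD u1)
        show "f (?u (x \<oplus>\<^bsub>N\<^esub> y)) = f (?u x) \<oplus>\<^bsub>M\<^esub> f (?u y)" if "x \<in> K" "y \<in> K" for x y
          using that feq[of "?u (x \<oplus>\<^bsub>N\<^esub> y)" "?u x \<oplus>\<^bsub>P1\<^esub> ?u y"]
          by (simp add: u1 d1u Kc left_homD[OF d1] fD)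
        show "f (?u (s \<odot>\<^bsub>N\<^esub> x)) = s \<odot>\<^bsub>M\<^esub> f (?u x)" if "s \<in> carrier S" "x \<in> K" for s x
          using that feq[of "?u (s \<odot>\<^bsub>N\<^esub> x)" "s \<odot>\<^bsub>P1\<^esub> ?u x"]
          by (simp add: u1 d1u Kc left_homD[OF d1] fD P1.smult_closed)
      qed
      then obtain g where g: "g \<in> left_hom S N M" and gK: "\<And>k. k \<in> K \<Longrightarrow> g k = f (?u k)"
        using R unfolding hom_extension_def by force
      have "f = compose (carrier P1) g d1"
      proof (rule extensionalityI[OF left_hom_extensional[OF f]])
        show "f w = compose (carrier P1) g d1 w" if "w \<in> carrier P1" for w
          using that feq[of w "?u (d1 w)"] by (simp add: compose_def gK d1K u1 d1u)
      qed (simp add: compose_def)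
      with g show "\<exists>g\<in>left_hom S N M. f = compose (carrier P1) g d1" by blast
    qed
  qed
qed

text \<open>\<open>Mod\<close> forms cosets of an arbitrary set, so the coboundaries can enter as a
  mere set that contains 1. From left to right, each \<open>z\<close> lies in its own coset, and the
  only coset is \<open>B\<close>. From right to left, \<open>B\<close> is the whole group and
  therefore normal.\<close>

lemma trivial_group_Mod_iff:
  assumes "group G" and "B \<subseteq> carrier G" and "\<one>\<^bsub>G\<^esub> \<in> B"
  shows "trivial_group (G Mod B) \<longleftrightarrow> carrier G \<subseteq> B"
proof -
  interpret group G by fact
  show ?thesis
  proof
    assume "trivial_group (G Mod B)"
    then have "carrier (G Mod B) = {B}" by (simp add: trivial_group_def)
    moreover have "z \<in> B #>\<^bsub>G\<^esub> z" if "z \<in> carrier G" for z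
      unfolding r_coset_def using that assms(3) by (force intro: rev_bexI)
    moreover have "B #>\<^bsub>G\<^esub> z \<in> carrier (G Mod B)" if "z \<in> carrier G" for z
      using that by (auto simp: FactGroup_def RCOSETS_def)
    ultimately show "carrier G \<subseteq> B" by blast
  next
    assume "carrier G \<subseteq> B"
    with assms(2) have B: "B = carrier G" by blast
    have "carrier G #>\<^bsub>G\<^esub> z = carrier G" if "z \<in> carrier G" for z
      using that by (simp add: coset_join2 subgroup_self)
    then have "carrier (G Mod B) = {\<one>\<^bsub>G Mod B\<^esub>}" by (auto simp: B carrier_FactGroup)
    moreover have "group (G Mod B)"
      unfolding B by (rule normal.factorgroup_is_group) (simp add: normal_invI subgroup_self)
    ultimately show "trivial_group (G Mod B)" by (simp add: trivial_group_def)
  qed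
qed

text \<open>\<open>Ext1\<close> replaces only the carrier of the group of homomorphisms, so the
  axioms are checked for cocycles under the pointwise operations.\<close>

lemma group_left_hom_kernel:
  assumes mods: "left_module S A" "left_module S B" "left_module S M" and d: "d \<in> left_hom S B A"
  shows "group ((left_hom_group S A M)\<lparr>carrier := kernel (left_hom_group S A M) (left_hom_group S B M)
    (\<lambda>f. compose (carrier B) f d)\<rparr>)" (is "group ?Z")
proof (rule groupI)
  interpret A: left_module S A by fact
  interpret M: left_module S M by fact
  have in_Z: "f \<in> kernel (left_hom_group S A M) (left_hom_group S B M) (\<lambda>f. compose (carrier B) f d) \<longleftrightarrow>
      f \<in> left_hom S A M \<and> (\<forall>x\<in>carrier B. f (d x) = \<zero>\<^bsub>M\<^esub>)" for f
    by (auto simp: kernel_def left_hom_group_def compose_def fun_eq_iff restrict_def)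
  note dA = left_homD(1)[OF d]
  show "x \<otimes>\<^bsub>?Z\<^esub> y \<in> carrier ?Z" if x: "x \<in> carrier ?Z" and y: "y \<in> carrier ?Z" for x y
  proof -
    from x y have h: "x \<in> left_hom S A M" "y \<in> left_hom S A M" by (simp_all add: in_Z)
    have "(\<lambda>t\<in>carrier A. x t \<oplus>\<^bsub>M\<^esub> y t) \<in> left_hom S A M"
      by (rule left_homI[OF mods(1)])
         (simp_all add: left_homD[OF h(1)] left_homD[OF h(2)] M.M.a_ac M.smult_r_distr)
    then show ?thesis using x y by (simp add: in_Z dA) (simp add: left_hom_group_def dA)
  qed
  show "\<one>\<^bsub>?Z\<^esub> \<in> carrier ?Z"
  proof -
    have "(\<lambda>t\<in>carrier A. \<zero>\<^bsub>M\<^esub>) \<in> left_hom S A M"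
      by (rule left_homI[OF mods(1)]) (simp_all add: M.smult_r_null)
    then show ?thesis by (simp add: in_Z dA) (simp add: left_hom_group_def dA)
  qed
  fix x assume x: "x \<in> carrier ?Z"
  then have xh: "x \<in> left_hom S A M" by (simp add: in_Z)
  note xD = left_homD[OF xh]
  show "\<one>\<^bsub>?Z\<^esub> \<otimes>\<^bsub>?Z\<^esub> x = x"
    by (rule extensionalityI[OF _ left_hom_extensional[OF xh]]) (auto simp: left_hom_group_def xD)
  show "x \<otimes>\<^bsub>?Z\<^esub> y \<otimes>\<^bsub>?Z\<^esub> z = x \<otimes>\<^bsub>?Z\<^esub> (y \<otimes>\<^bsub>?Z\<^esub> z)"
    if "y \<in> carrier ?Z" "z \<in> carrier ?Z" for y z
  proof -
    have yz: "y \<in> left_hom S A M" "z \<in> left_hom S A M"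
      using that by (simp_all add: in_Z)
    show ?thesis
      by (simp add: left_hom_group_def fun_eq_iff restrict_def xD(1) left_homD(1)[OF yz(1)]
          left_homD(1)[OF yz(2)] M.M.a_assoc)
  qed
  \<comment> \<open>The inverse of \<open>x\<close> is written as its multiple by -1; this is again
    linear because -1 is central.\<close>
  have "(\<lambda>t\<in>carrier A. (\<ominus>\<^bsub>S\<^esub> \<one>\<^bsub>S\<^esub>) \<odot>\<^bsub>M\<^esub> x t) \<in> left_hom S A M"
    by (rule left_homI[OF mods(1)])
       (simp_all add: xD M.smult_closed M.smult_r_distr A.S.l_minus A.S.r_minus flip: M.smult_assoc)
  then have "(\<lambda>t\<in>carrier A. (\<ominus>\<^bsub>S\<^esub> \<one>\<^bsub>S\<^esub>) \<odot>\<^bsub>M\<^esub> x t) \<in> carrier ?Z"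
    using x by (simp add: in_Z dA M.smult_r_null)
  moreover have "(\<lambda>t\<in>carrier A. (\<ominus>\<^bsub>S\<^esub> \<one>\<^bsub>S\<^esub>) \<odot>\<^bsub>M\<^esub> x t) \<otimes>\<^bsub>?Z\<^esub> x = \<one>\<^bsub>?Z\<^esub>"
    using M.add_smult_minus_one
    by (auto simp: left_hom_group_def xD M.M.a_comm M.smult_closed fun_eq_iff)
  ultimately show "\<exists>y\<in>carrier ?Z. y \<otimes>\<^bsub>?Z\<^esub> x = \<one>\<^bsub>?Z\<^esub>" by blast
qed

text \<open>The quotient is trivial when every cocycle is a coboundary, and
  \<open>cocycles_coboundaries_iff_hom_extension\<close> applies with \<open>res0 S F\<close> as
  \<open>N\<close>. Of the resolution only the first kernel remains visible.\<close>

lemma trivial_Ext1_iff: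
  fixes F :: "('s, 'f, 'k) module_scheme"
  assumes F: "left_module S F" and M: "left_module S M"
  shows "trivial_group (Ext1 S F M) \<longleftrightarrow> hom_extension S (res0 S F) (res_ker0 S F) M"
proof -
  interpret F: left_module S F by fact
  interpret M: left_module S M by fact
  let ?e = "free_eval S F (carrier F)"
  have modP0: "left_module S (res0 S F)" unfolding res0_def by (rule F.S.left_module_free)
  have modP1: "left_module S (res1 S F)" unfolding res1_def by (rule F.S.left_module_free)
  have modP2: "left_module S (res2 S F)" unfolding res2_def by (rule F.S.left_module_free)
  have e: "?e \<in> left_hom S (res0 S F) F"
    unfolding res0_def by (rule free_eval_hom(1)[OF F]) simp
  have K0: "res_ker0 S F \<subseteq> carrier (res0 S F)" by (auto simp: res_ker0_def a_kernel_iff)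
  have K1: "res_ker1 S F \<subseteq> carrier (res1 S F)" by (auto simp: res_ker1_def a_kernel_iff)
  have d1: "res_d1 S F \<in> left_hom S (res1 S F) (res0 S F)"
    unfolding res_d1_def res1_def by (rule free_eval_hom(1)[OF modP0 K0])
  have d2: "res_d2 S F \<in> left_hom S (res2 S F) (res1 S F)"
    unfolding res_d2_def res2_def by (rule free_eval_hom(1)[OF modP1 K1])
  let ?Z = "(left_hom_group S (res1 S F) M)\<lparr>carrier := ext1_cocycles S F M\<rparr>"
  have grp: "group ?Z"
    unfolding ext1_cocycles_def by (rule group_left_hom_kernel[OF modP1 modP2 M d2])
  have cocyc: "f \<in> ext1_cocycles S F M \<longleftrightarrow>
      f \<in> left_hom S (res1 S F) M \<and> (\<forall>t\<in>carrier (res2 S F). f (res_d2 S F t) = \<zero>\<^bsub>M\<^esub>)" for f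
    by (auto simp: ext1_cocycles_def kernel_def left_hom_group_def compose_def fun_eq_iff
        restrict_def)
  have d2K: "res_d2 S F t \<in> res_ker1 S F" if "t \<in> carrier (res2 S F)" for t
    using free_eval_in_kernel[OF modP1 modP0 d1, folded res_ker1_def, folded res2_def res_d2_def, OF that] .
  have B: "ext1_coboundaries S F M \<subseteq> carrier ?Z"
  proof
    fix f assume "f \<in> ext1_coboundaries S F M"
    then obtain g where g: "g \<in> left_hom S (res0 S F) M"
      and f: "f = compose (carrier (res1 S F)) g (res_d1 S F)"
      by (auto simp: ext1_coboundaries_def)
    have "f (res_d2 S F t) = \<zero>\<^bsub>M\<^esub>" if "t \<in> carrier (res2 S F)" for t
      using d2K[OF that] left_hom_zero[OF g modP0 M]
      by (simp add: f compose_def res_ker1_def a_kernel_iff)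
    then show "f \<in> carrier ?Z" using left_hom_compose[OF modP1 d1 g] f by (simp add: cocyc)
  qed
  have one: "\<one>\<^bsub>?Z\<^esub> \<in> ext1_coboundaries S F M"
  proof -
    have "restrict (\<lambda>t. \<zero>\<^bsub>M\<^esub>) (carrier (res0 S F)) \<in> left_hom S (res0 S F) M"
      by (rule left_homI[OF modP0]) (simp_all add: M.smult_r_null)
    then show ?thesis
      unfolding ext1_coboundaries_def
      by (rule rev_image_eqI)
         (auto simp: left_hom_group_def compose_def left_homD(1)[OF d1] fun_eq_iff)
  qed
  have "trivial_group (Ext1 S F M) \<longleftrightarrow> ext1_cocycles S F M \<subseteq> ext1_coboundaries S F M"
    unfolding Ext1_def using trivial_group_Mod_iff[OF grp B one] by simp
  also have "\<dots> \<longleftrightarrow> (\<forall>f\<in>left_hom S (res1 S F) M.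
      (\<forall>t\<in>carrier (res2 S F). f (res_d2 S F t) = \<zero>\<^bsub>M\<^esub>) \<longrightarrow>
      (\<exists>g\<in>left_hom S (res0 S F) M. f = compose (carrier (res1 S F)) g (res_d1 S F)))"
    by (auto simp: cocyc subset_iff ext1_coboundaries_def image_iff)
  also have "\<dots> \<longleftrightarrow> hom_extension S (res0 S F) (res_ker0 S F) M"
    using cocycles_coboundaries_iff_hom_extension[OF modP0 F M e]
    by (simp only: res_d1_def res_d2_def res1_def res2_def res_ker0_def res_ker1_def)
  finally show ?thesis .
qed

section \<open>Finitely presented modules and linear systems\<close>

text \<open>The elements of the quotient are cosets; for \<open>N = S^n\<close> their type is the
  one over which \<open>FP_injective\<close> quantifies. The operations are computed on
  representatives chosen by \<open>c\<close>, and \<open>cE\<close> shows that these differ from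
  given ones only by elements of \<open>K\<close>.\<close>

lemma quotient_module:
  fixes N :: "('s, 'a, 'k) module_scheme"
  assumes N: "left_module S N" and K: "left_module S (N\<lparr>carrier := K\<rparr>)" "K \<subseteq> carrier N"
  obtains F :: "('s, 'a set) module" and p
  where "left_module S F" "p \<in> left_hom S N F" "p ` carrier N = carrier F" "a_kernel N F p = K"
proof -
  interpret N: left_module S N by fact
  interpret K: left_module S "N\<lparr>carrier := K\<rparr>" by fact
  note Kc = K.M.zero_closed[simplified] K.M.a_closed[simplified] K.smult_closed[simplified]
  define h where "h x = {y \<in> carrier N. \<exists>k\<in>K. y = x \<oplus>\<^bsub>N\<^esub> k}" for x
  have KN: "k \<in> carrier N" if "k \<in> K" for k using that K(2) by blast
  have h_self: "x \<in> h x" if "x \<in> carrier N" for x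
    using that Kc(1) by (auto simp: h_def intro!: bexI[of _ "\<zero>\<^bsub>N\<^esub>"])
  have h_shift: "h (x \<oplus>\<^bsub>N\<^esub> k) = h x" if "x \<in> carrier N" "k \<in> K" for x k
  proof (intro equalityI subsetI)
    fix y assume "y \<in> h (x \<oplus>\<^bsub>N\<^esub> k)"
    then obtain l where "l \<in> K" "y = x \<oplus>\<^bsub>N\<^esub> k \<oplus>\<^bsub>N\<^esub> l" by (auto simp: h_def)
    then show "y \<in> h x" using that Kc KN
      by (auto simp: h_def N.M.a_assoc intro!: bexI[of _ "k \<oplus>\<^bsub>N\<^esub> l"])
  next
    fix y assume "y \<in> h x"
    then obtain l where l: "l \<in> K" "y = x \<oplus>\<^bsub>N\<^esub> l" by (auto simp: h_def)
    let ?k = "(\<ominus>\<^bsub>S\<^esub> \<one>\<^bsub>S\<^esub>) \<odot>\<^bsub>N\<^esub> k"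
    have k: "?k \<in> K" "k \<oplus>\<^bsub>N\<^esub> ?k = \<zero>\<^bsub>N\<^esub>" using that Kc KN by (auto simp: N.add_smult_minus_one)
    have "x \<oplus>\<^bsub>N\<^esub> k \<oplus>\<^bsub>N\<^esub> (?k \<oplus>\<^bsub>N\<^esub> l) = x \<oplus>\<^bsub>N\<^esub> (k \<oplus>\<^bsub>N\<^esub> ?k \<oplus>\<^bsub>N\<^esub> l)"
      using that k(1) l KN by (simp add: N.M.a_assoc)
    also have "\<dots> = y" using k(2) l KN by simp
    finally have "y = x \<oplus>\<^bsub>N\<^esub> k \<oplus>\<^bsub>N\<^esub> (?k \<oplus>\<^bsub>N\<^esub> l)" ..
    moreover have "?k \<oplus>\<^bsub>N\<^esub> l \<in> K" using k l Kc by simp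
    ultimately show "y \<in> h (x \<oplus>\<^bsub>N\<^esub> k)" using that l KN by (auto simp: h_def)
  qed
  have h_eqD: "\<exists>k\<in>K. y = x \<oplus>\<^bsub>N\<^esub> k" if "h x = h y" "y \<in> carrier N" for x y
    using h_self[OF that(2)] that(1) by (auto simp: h_def)
  define c where "c = inv_into (carrier N) h"
  have c: "c (h x) \<in> carrier N" "h (c (h x)) = h x" if "x \<in> carrier N" for x
    using that by (simp_all add: c_def inv_into_into f_inv_into_f)
  have cE: "\<exists>k\<in>K. c (h x) = x \<oplus>\<^bsub>N\<^esub> k" if "x \<in> carrier N" for x
    using h_eqD[of x "c (h x)"] c[OF that] by simp
  define F :: "('s, 'a set) module" where
    "F = \<lparr>carrier = h ` carrier N, mult = undefined, one = undefined, zero = h \<zero>\<^bsub>N\<^esub>,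
          add = (\<lambda>x y. h (c x \<oplus>\<^bsub>N\<^esub> c y)), smult = (\<lambda>s x. h (s \<odot>\<^bsub>N\<^esub> c x))\<rparr>"
  have add: "h x \<oplus>\<^bsub>F\<^esub> h y = h (x \<oplus>\<^bsub>N\<^esub> y)" if "x \<in> carrier N" "y \<in> carrier N" for x y
  proof -
    obtain k where k: "k \<in> K" "c (h x) = x \<oplus>\<^bsub>N\<^esub> k"
      using cE[OF \<open>x \<in> carrier N\<close>] ..
    obtain l where l: "l \<in> K" "c (h y) = y \<oplus>\<^bsub>N\<^esub> l"
      using cE[OF \<open>y \<in> carrier N\<close>] ..
    from k l have "h x \<oplus>\<^bsub>F\<^esub> h y = h (x \<oplus>\<^bsub>N\<^esub> y \<oplus>\<^bsub>N\<^esub> (k \<oplus>\<^bsub>N\<^esub> l))"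
      using that KN by (simp add: F_def N.M.a_ac)
    then show ?thesis using that Kc \<open>k \<in> K\<close> \<open>l \<in> K\<close> by (simp add: h_shift)
  qed
  have smult: "s \<odot>\<^bsub>F\<^esub> h x = h (s \<odot>\<^bsub>N\<^esub> x)" if "s \<in> carrier S" "x \<in> carrier N" for s x
  proof -
    obtain k where "k \<in> K" "c (h x) = x \<oplus>\<^bsub>N\<^esub> k" using cE[OF \<open>x \<in> carrier N\<close>] ..
    then show ?thesis using that KN Kc by (simp add: F_def N.smult_r_distr h_shift N.smult_closed)
  qed
  have carr: "carrier F = h ` carrier N" and zero: "\<zero>\<^bsub>F\<^esub> = h \<zero>\<^bsub>N\<^esub>" by (simp_all add: F_def)
  have "abelian_group F"
  proof (rule abelian_groupI)
    fix x assume "x \<in> carrier F"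
    then obtain a where "a \<in> carrier N" "x = h a" by (auto simp: carr)
    then show "\<exists>y\<in>carrier F. y \<oplus>\<^bsub>F\<^esub> x = \<zero>\<^bsub>F\<^esub>"
      by (intro bexI[of _ "h (\<ominus>\<^bsub>N\<^esub> a)"]) (auto simp: carr zero add N.M.l_neg)
  qed (auto simp: carr zero add N.M.a_ac)
  moreover have "left_module_axioms S F"
  proof
    have F_cases: "\<exists>v\<in>carrier N. x = h v" if "x \<in> carrier F" for x
      using that by (auto simp: carr)
    fix a x assume a: "a \<in> carrier S" and "x \<in> carrier F"
    then obtain v where v: "v \<in> carrier N" "x = h v" using F_cases by blast
    show "a \<odot>\<^bsub>F\<^esub> x \<in> carrier F" using a v by (simp add: carr smult N.smult_closed)
    show "(a \<oplus>\<^bsub>S\<^esub> b) \<odot>\<^bsub>F\<^esub> x = a \<odot>\<^bsub>F\<^esub> x \<oplus>\<^bsub>F\<^esub> b \<odot>\<^bsub>F\<^esub> x"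
      and "(a \<otimes>\<^bsub>S\<^esub> b) \<odot>\<^bsub>F\<^esub> x = a \<odot>\<^bsub>F\<^esub> (b \<odot>\<^bsub>F\<^esub> x)" if "b \<in> carrier S" for b
      using a v that by (simp_all add: add smult N.smult_closed N.smult_l_distr N.smult_assoc)
    show "a \<odot>\<^bsub>F\<^esub> (x \<oplus>\<^bsub>F\<^esub> y) = a \<odot>\<^bsub>F\<^esub> x \<oplus>\<^bsub>F\<^esub> a \<odot>\<^bsub>F\<^esub> y" if "y \<in> carrier F" for y
    proof -
      from that obtain w where "w \<in> carrier N" "y = h w" using F_cases by blast
      then show ?thesis using a v by (simp add: add smult N.smult_closed N.smult_r_distr)
    qed
  next
    show "\<one>\<^bsub>S\<^esub> \<odot>\<^bsub>F\<^esub> x = x" if "x \<in> carrier F" for x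
      using that by (auto simp: carr smult N.smult_one)
  qed
  ultimately have modF: "left_module S F"
    by (intro left_module.intro N.S.ring_axioms)
  have "restrict h (carrier N) \<in> left_hom S N F"
    by (rule left_homI[OF N]) (auto simp: carr add smult)
  moreover have "restrict h (carrier N) ` carrier N = carrier F" by (auto simp: carr)
  moreover have "a_kernel N F (restrict h (carrier N)) = K"
  proof (intro equalityI subsetI)
    fix x assume "x \<in> a_kernel N F (restrict h (carrier N))"
    then have x: "x \<in> carrier N" and "restrict h (carrier N) x = \<zero>\<^bsub>F\<^esub>"
      by (simp_all only: a_kernel_iff)
    then have "h \<zero>\<^bsub>N\<^esub> = h x" unfolding zero by (metis restrict_apply')
    then obtain k where "k \<in> K" "x = \<zero>\<^bsub>N\<^esub> \<oplus>\<^bsub>N\<^esub> k" using h_eqD x by blast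
    then show "x \<in> K" using KN by simp
  next
    fix x assume "x \<in> K"
    then show "x \<in> a_kernel N F (restrict h (carrier N))"
      using h_shift[of "\<zero>\<^bsub>N\<^esub>" x] KN by (simp add: a_kernel_iff zero)
  qed
  ultimately show thesis using that modF by blast
qed

text \<open>Both free modules map onto \<open>F\<close>, and freeness gives lifts in both
  directions: \<open>\<alpha>\<close> sends the basis vector of \<open>x\<close> to a chosen
  preimage under \<open>p\<close>, and \<open>\<beta>\<close> sends a basis vector to the basis
  vector of its image in \<open>F\<close>. The triangles commute on basis vectors, hence everywhere,
  so \<open>hom_extension_transfer\<close> applies either way.\<close>

lemma hom_extension_presentation_iff:
  fixes F :: "('s, 'f, 'k) module_scheme"
  assumes F: "left_module S F" and M: "left_module S M"
    and p: "p \<in> left_hom S (free_left_module S X) F" "p ` carrier (free_left_module S X) = carrier F"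
  shows "hom_extension S (res0 S F) (res_ker0 S F) M \<longleftrightarrow>
    hom_extension S (free_left_module S X) (a_kernel (free_left_module S X) F p) M"
proof -
  let ?N = "free_left_module S X" and ?e = "free_eval S F (carrier F)"
  interpret F: left_module S F by fact
  have modP0: "left_module S (res0 S F)" unfolding res0_def by (rule F.S.left_module_free)
  have modN: "left_module S ?N" by (rule F.S.left_module_free)
  interpret P0: left_module S "res0 S F" by (rule modP0)
  interpret N: left_module S ?N by (rule modN)
  have e: "?e \<in> left_hom S (res0 S F) F" "\<And>x. x \<in> carrier F \<Longrightarrow> ?e (F.S.unit_fun x) = x"
    unfolding res0_def by (simp_all add: free_eval_hom[OF F])
  define c where "c = inv_into (carrier ?N) p"
  have c: "c x \<in> carrier ?N" "p (c x) = x" if "x \<in> carrier F" for x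
    using that p(2) by (simp_all only: c_def inv_into_into f_inv_into_f)
  have pu: "p (F.S.unit_fun x) \<in> carrier F" if "x \<in> X" for x
    using left_homD(1)[OF p(1)] F.S.unit_fun_closed[OF that] by simp
  have u0: "F.S.unit_fun y \<in> carrier (res0 S F)" if "y \<in> carrier F" for y
    using F.S.unit_fun_closed[OF that] by (simp add: res0_def)
  define \<alpha> where "\<alpha> = N.free_lift (carrier F) c"
  define \<beta> where "\<beta> = P0.free_lift X (\<lambda>x. F.S.unit_fun (p (F.S.unit_fun x)))"
  have a: "\<alpha> \<in> left_hom S (res0 S F) ?N" unfolding \<alpha>_def res0_def
    by (rule N.free_lift_hom) (rule c)
  have b: "\<beta> \<in> left_hom S ?N (res0 S F)" unfolding \<beta>_def
    by (rule P0.free_lift_hom) (intro u0 pu)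
  have au: "\<alpha> (F.S.unit_fun x) = c x" if "x \<in> carrier F" for x
    unfolding \<alpha>_def by (rule N.free_lift_unit[OF c(1) that])
  have bu: "\<beta> (F.S.unit_fun x) = F.S.unit_fun (p (F.S.unit_fun x))" if "x \<in> X" for x
    unfolding \<beta>_def by (rule P0.free_lift_unit[OF u0[OF pu] that])
  have pa_eq: "compose (carrier (res0 S F)) p \<alpha> = ?e"
    by (rule F.free_hom_eqI[of _ "carrier F"])
       (use left_hom_compose[OF modP0 a p(1)] e in
         \<open>simp_all add: compose_def u0 au c(2) flip: res0_def\<close>)
  have pa: "p (\<alpha> u) = ?e u" if "u \<in> carrier (res0 S F)" for u
    using fun_cong[OF pa_eq, of u] that by (simp add: compose_def)
  have eb_eq: "compose (carrier ?N) ?e \<beta> = p"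
    by (rule F.free_hom_eqI[of _ X])
       (use left_hom_compose[OF modN b e(1)] p(1) in
         \<open>simp_all add: compose_def F.S.unit_fun_closed bu e(2) pu\<close>)
  have eb: "?e (\<beta> u) = p u" if "u \<in> carrier ?N" for u
    using fun_cong[OF eb_eq, of u] that by (simp add: compose_def)
  show ?thesis
    unfolding res_ker0_def
  proof
    assume *: "hom_extension S (res0 S F) (a_kernel (res0 S F) F ?e) M"
    show "hom_extension S ?N (a_kernel ?N F p) M"
      by (rule hom_extension_transfer[OF modN modP0 F M p(1) e(1) a b _ _ *]) (simp_all only: pa eb)
  next
    assume *: "hom_extension S ?N (a_kernel ?N F p) M"
    show "hom_extension S (res0 S F) (a_kernel (res0 S F) F ?e) M"
      by (rule hom_extension_transfer[OF modP0 modN F M e(1) p(1) b a _ _ *]) (simp_all only: pa eb)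
  qed
qed

section \<open>Finite linear systems over a noncommutative ring\<close>

lemma (in ring) finsum_free_left_module:
  assumes "\<And>i. i \<in> I \<Longrightarrow> f i \<in> fin_supp_funs R X"
  shows "(\<Oplus>\<^bsub>free_left_module R X\<^esub>i\<in>I. f i) x = (\<Oplus>i\<in>I. f i x)"
proof -
  interpret P: left_module R "free_left_module R X" by (rule left_module_free)
  show ?thesis using assms
    by (induction I rule: infinite_finite_induct)
       (simp_all add: Pi_def fin_supp_funs_in_carrier[of _ X] P.M.finsum_infinite finsum_infinite)
qed

text \<open>The rows of \<open>A\<close> span a submodule of \<open>S^J\<close>, and the condition
  on \<open>s\<close> says that sending row \<open>i\<close> to \<open>c i\<close> gives a
  well-defined homomorphism on it. A solution \<open>b\<close> lists the values of an extension to
  \<open>S^J\<close> at the basis vectors. The index sets have arbitrary types so that sets of group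
  elements and products with subgroups can occur.\<close>

definition compatible_systems_solvable :: "('s, 'm) ring_scheme \<Rightarrow> 'i set \<Rightarrow> 'j set \<Rightarrow> bool" where
  "compatible_systems_solvable S I J \<longleftrightarrow>
    (\<forall>A c. (\<forall>i\<in>I. \<forall>j\<in>J. A i j \<in> carrier S) \<and> (\<forall>i\<in>I. c i \<in> carrier S) \<and>
      (\<forall>s. (\<forall>i\<in>I. s i \<in> carrier S) \<and> (\<forall>j\<in>J. (\<Oplus>\<^bsub>S\<^esub>i\<in>I. s i \<otimes>\<^bsub>S\<^esub> A i j) = \<zero>\<^bsub>S\<^esub>) \<longrightarrow>
        (\<Oplus>\<^bsub>S\<^esub>i\<in>I. s i \<otimes>\<^bsub>S\<^esub> c i) = \<zero>\<^bsub>S\<^esub>) \<longrightarrow>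
      (\<exists>b. (\<forall>j\<in>J. b j \<in> carrier S) \<and> (\<forall>i\<in>I. (\<Oplus>\<^bsub>S\<^esub>j\<in>J. A i j \<otimes>\<^bsub>S\<^esub> b j) = c i)))"

lemma compatible_systems_solvableD:
  assumes "compatible_systems_solvable S I J"
    and "\<And>i j. \<lbrakk>i \<in> I; j \<in> J\<rbrakk> \<Longrightarrow> A i j \<in> carrier S" "\<And>i. i \<in> I \<Longrightarrow> c i \<in> carrier S"
    and "\<And>s. \<lbrakk>\<And>i. i \<in> I \<Longrightarrow> s i \<in> carrier S;
        \<And>j. j \<in> J \<Longrightarrow> (\<Oplus>\<^bsub>S\<^esub>i\<in>I. s i \<otimes>\<^bsub>S\<^esub> A i j) = \<zero>\<^bsub>S\<^esub>\<rbrakk> \<Longrightarrow> (\<Oplus>\<^bsub>S\<^esub>i\<in>I. s i \<otimes>\<^bsub>S\<^esub> c i) = \<zero>\<^bsub>S\<^esub>"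
  obtains b where "\<And>j. j \<in> J \<Longrightarrow> b j \<in> carrier S"
    and "\<And>i. i \<in> I \<Longrightarrow> (\<Oplus>\<^bsub>S\<^esub>j\<in>J. A i j \<otimes>\<^bsub>S\<^esub> b j) = c i"
proof -
  have "\<exists>b. (\<forall>j\<in>J. b j \<in> carrier S) \<and> (\<forall>i\<in>I. (\<Oplus>\<^bsub>S\<^esub>j\<in>J. A i j \<otimes>\<^bsub>S\<^esub> b j) = c i)"
    using assms(1)[unfolded compatible_systems_solvable_def, rule_format, of A c] assms(2-4)
    by blast
  then show thesis using that by blast
qed

lemma compatible_systems_solvableI:
  assumes "\<And>A c. \<lbrakk>\<And>i j. \<lbrakk>i \<in> I; j \<in> J\<rbrakk> \<Longrightarrow> A i j \<in> carrier S; \<And>i. i \<in> I \<Longrightarrow> c i \<in> carrier S;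
      \<And>s. \<lbrakk>\<And>i. i \<in> I \<Longrightarrow> s i \<in> carrier S;
        \<And>j. j \<in> J \<Longrightarrow> (\<Oplus>\<^bsub>S\<^esub>i\<in>I. s i \<otimes>\<^bsub>S\<^esub> A i j) = \<zero>\<^bsub>S\<^esub>\<rbrakk> \<Longrightarrow> (\<Oplus>\<^bsub>S\<^esub>i\<in>I. s i \<otimes>\<^bsub>S\<^esub> c i) = \<zero>\<^bsub>S\<^esub>\<rbrakk>
    \<Longrightarrow> \<exists>b. (\<forall>j\<in>J. b j \<in> carrier S) \<and> (\<forall>i\<in>I. (\<Oplus>\<^bsub>S\<^esub>j\<in>J. A i j \<otimes>\<^bsub>S\<^esub> b j) = c i)"
  shows "compatible_systems_solvable S I J"
  unfolding compatible_systems_solvable_def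
  by (intro allI impI, elim conjE, rule assms) (blast, blast, simp)

text \<open>Finite presentations lead to index sets of natural numbers, while group rings call for
  group elements and pairs. Rows and unknowns are relabelled, and a test row for one system is
  pulled back to the other.\<close>

lemma (in ring) compatible_systems_solvable_reindex:
  assumes solv: "compatible_systems_solvable R I J" and f: "bij_betw f I I'" and g: "bij_betw g J J'"
  shows "compatible_systems_solvable R I' J'"
proof (rule compatible_systems_solvableI)
  fix A c
  assume A: "\<And>i j. \<lbrakk>i \<in> I'; j \<in> J'\<rbrakk> \<Longrightarrow> A i j \<in> carrier R" and c: "\<And>i. i \<in> I' \<Longrightarrow> c i \<in> carrier R"
    and comp: "\<And>s. \<lbrakk>\<And>i. i \<in> I' \<Longrightarrow> s i \<in> carrier R;
        \<And>j. j \<in> J' \<Longrightarrow> (\<Oplus>i\<in>I'. s i \<otimes> A i j) = \<zero>\<rbrakk> \<Longrightarrow> (\<Oplus>i\<in>I'. s i \<otimes> c i) = \<zero>"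
  have fI: "f ` I = I'" "inj_on f I" and gJ: "g ` J = J'" "inj_on g J"
    using f g by (simp_all add: bij_betw_def)
  have fin: "f i \<in> I'" if "i \<in> I" for i using that fI by blast
  have gin: "g j \<in> J'" if "j \<in> J" for j using that gJ by blast
  let ?f' = "inv_into I f" and ?g' = "inv_into J g"
  have f': "?f' i \<in> I" "f (?f' i) = i" if "i \<in> I'" for i
    using that by (auto simp: inv_into_into f_inv_into_f simp flip: fI(1))
  have g': "?g' j \<in> J" "g (?g' j) = j" if "j \<in> J'" for j
    using that by (auto simp: inv_into_into f_inv_into_f simp flip: gJ(1))
  have sumI: "(\<Oplus>i\<in>I'. h i) = (\<Oplus>i\<in>I. h (f i))" if "\<And>i. i \<in> I' \<Longrightarrow> h i \<in> carrier R" for h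
    using finsum_reindex[of h f I] that fI by auto
  have sumJ: "(\<Oplus>j\<in>J'. h j) = (\<Oplus>j\<in>J. h (g j))" if "\<And>j. j \<in> J' \<Longrightarrow> h j \<in> carrier R" for h
    using finsum_reindex[of h g J] that gJ by auto
  obtain b where b: "\<And>j. j \<in> J \<Longrightarrow> b j \<in> carrier R"
    and eq: "\<And>i. i \<in> I \<Longrightarrow> (\<Oplus>j\<in>J. A (f i) (g j) \<otimes> b j) = c (f i)"
  proof (rule compatible_systems_solvableD[OF solv, of "\<lambda>i j. A (f i) (g j)" "\<lambda>i. c (f i)"])
    show "A (f i) (g j) \<in> carrier R" if "i \<in> I" "j \<in> J" for i j using that by (simp add: A fin gin)
    show "c (f i) \<in> carrier R" if "i \<in> I" for i using that by (simp add: c fin)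
    fix s assume s: "\<And>i. i \<in> I \<Longrightarrow> s i \<in> carrier R"
      and z: "\<And>j. j \<in> J \<Longrightarrow> (\<Oplus>i\<in>I. s i \<otimes> A (f i) (g j)) = \<zero>"
    have sf: "s (?f' (f i)) = s i" if "i \<in> I" for i using that fI by simp
    have "(\<Oplus>i\<in>I'. s (?f' i) \<otimes> A i j) = \<zero>" if j: "j \<in> J'" for j
    proof -
      have "(\<Oplus>i\<in>I'. s (?f' i) \<otimes> A i j) = (\<Oplus>i\<in>I. s (?f' (f i)) \<otimes> A (f i) j)"
        by (rule sumI) (simp add: s f' A j)
      also have "\<dots> = (\<Oplus>i\<in>I. s i \<otimes> A (f i) (g (?g' j)))"
        by (rule finsum_cong') (auto simp: sf g' j s A fin)
      finally show ?thesis using z[OF g'(1)[OF j]] by simp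
    qed
    then have "(\<Oplus>i\<in>I'. s (?f' i) \<otimes> c i) = \<zero>" by (intro comp) (simp_all add: s f')
    moreover have "(\<Oplus>i\<in>I'. s (?f' i) \<otimes> c i) = (\<Oplus>i\<in>I. s (?f' (f i)) \<otimes> c (f i))"
      by (rule sumI) (simp add: s f' c)
    moreover have "\<dots> = (\<Oplus>i\<in>I. s i \<otimes> c (f i))"
      by (rule finsum_cong') (auto simp: sf s c fin)
    ultimately show "(\<Oplus>i\<in>I. s i \<otimes> c (f i)) = \<zero>" by simp
  qed blast
  have "(\<Oplus>j\<in>J'. A i j \<otimes> b (?g' j)) = c i" if i: "i \<in> I'" for i
  proof -
    have "(\<Oplus>j\<in>J'. A i j \<otimes> b (?g' j)) = (\<Oplus>j\<in>J. A i (g j) \<otimes> b (?g' (g j)))"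
      by (rule sumJ) (simp add: A b i g')
    also have "\<dots> = (\<Oplus>j\<in>J. A (f (?f' i)) (g j) \<otimes> b j)"
      by (rule finsum_cong') (auto simp: A b f' i gin gJ(2))
    finally show ?thesis using eq[OF f'(1)[OF i]] by (simp add: f' i)
  qed
  then show "\<exists>b. (\<forall>j\<in>J'. b j \<in> carrier R) \<and> (\<forall>i\<in>I'. (\<Oplus>j\<in>J'. A i j \<otimes> b j) = c i)"
    by (intro exI[of _ "\<lambda>j. b (?g' j)"]) (simp add: b g')
qed

text \<open>A homomorphism \<open>d\<close> from \<open>S^I\<close> to \<open>S^J\<close> is the
  matrix whose rows are its values on the basis, and a homomorphism on its image is determined by
  its values \<open>c i\<close> on the rows. Compatibility of \<open>c\<close> means that the
  induced map on \<open>S^I\<close> vanishes on the kernel of \<open>d\<close>, hence factors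
  through the image.\<close>

lemma compatible_systems_solvable_iff:
  assumes S: "ring S" and fin: "finite I" "finite J"
  shows "compatible_systems_solvable S I J \<longleftrightarrow>
    (\<forall>d\<in>left_hom S (free_left_module S I) (free_left_module S J).
      hom_extension S (free_left_module S J) (d ` carrier (free_left_module S I))
        (left_regular_module S))"
proof -
  interpret ring S by fact
  let ?A = "free_left_module S I" and ?B = "free_left_module S J" and ?M = "left_regular_module S"
  have modA: "left_module S ?A" and modB: "left_module S ?B" and modM: "left_module S ?M"
    by (simp_all add: left_module_free left_module_regular S)
  interpret A: left_module S ?A by (rule modA)
  interpret B: left_module S ?B by (rule modB)
  interpret M: left_module S ?M by (rule modM)
  have uI: "unit_fun i \<in> fin_supp_funs S I" if "i \<in> I" for i by (rule unit_fun_closed[OF that])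
  have uJ: "unit_fun j \<in> fin_supp_funs S J" if "j \<in> J" for j by (rule unit_fun_closed[OF that])
  show ?thesis
  proof (intro iffI ballI)
    fix d assume solv: "compatible_systems_solvable S I J" and d: "d \<in> left_hom S ?A ?B"
    note dD = left_homD[OF d, simplified]
    let ?K = "d ` carrier ?A"
    show "hom_extension S ?B ?K ?M"
      unfolding hom_extension_def
    proof
      fix \<phi> assume phi: "\<phi> \<in> left_hom S (?B\<lparr>carrier := ?K\<rparr>) ?M"
      have modK: "left_module S (?B\<lparr>carrier := ?K\<rparr>)" by (rule left_module_image[OF d modA modB])
      have d': "d \<in> left_hom S ?A (?B\<lparr>carrier := ?K\<rparr>)" using d by (auto simp: left_hom_def)
      have pd: "compose (carrier ?A) \<phi> d \<in> left_hom S ?A ?M"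
        by (rule left_hom_compose[OF modA d' phi])
      obtain b where b: "\<And>j. j \<in> J \<Longrightarrow> b j \<in> carrier S"
        and eq: "\<And>i. i \<in> I \<Longrightarrow> (\<Oplus>\<^bsub>S\<^esub>j\<in>J. d (unit_fun i) j \<otimes>\<^bsub>S\<^esub> b j) = \<phi> (d (unit_fun i))"
      proof (rule compatible_systems_solvableD[OF solv,
            of "\<lambda>i j. d (unit_fun i) j" "\<lambda>i. \<phi> (d (unit_fun i))"])
        show "d (unit_fun i) j \<in> carrier S" if "i \<in> I" "j \<in> J" for i j
          using dD(1)[OF uI[OF that(1)]] by (simp add: fin_supp_funs_in_carrier)
        show "\<phi> (d (unit_fun i)) \<in> carrier S" if "i \<in> I" for i
          using left_homD(1)[OF phi, of "d (unit_fun i)"] uI[OF that] by simp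
        fix s assume s: "\<And>i. i \<in> I \<Longrightarrow> s i \<in> carrier S"
          and z: "\<And>j. j \<in> J \<Longrightarrow> (\<Oplus>\<^bsub>S\<^esub>i\<in>I. s i \<otimes>\<^bsub>S\<^esub> d (unit_fun i) j) = \<zero>\<^bsub>S\<^esub>"
        \<comment> \<open>Members of the free module vanish off \<open>I\<close>, whereas
          \<open>s\<close> is arbitrary there.\<close>
        define s' where "s' i = (if i \<in> I then s i else \<zero>\<^bsub>S\<^esub>)" for i
        have s': "s' \<in> fin_supp_funs S I"
          by (rule fin_supp_funsI[OF fin(1) order_refl]) (auto simp: s'_def s)
        have cl: "(\<lambda>x. s' i \<otimes>\<^bsub>S\<^esub> d (unit_fun i) x) \<in> fin_supp_funs S J" if "i \<in> I" for i
          using dD(1)[OF uI[OF that]] s that by (simp add: s'_def fin_supp_funs_smult)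
        have "d s' j = \<zero>\<^bsub>S\<^esub>" for j
        proof -
          have "d s' j = (\<Oplus>\<^bsub>S\<^esub>i\<in>I. s' i \<otimes>\<^bsub>S\<^esub> d (unit_fun i) j)"
            by (subst B.free_hom_eq_sum[OF d fin(1) s'])
               (simp add: finsum_free_left_module cl)
          also have "\<dots> = (\<Oplus>\<^bsub>S\<^esub>i\<in>I. s i \<otimes>\<^bsub>S\<^esub> d (unit_fun i) j)"
            by (rule finsum_cong')
               (auto simp: s'_def s dD(1)[OF uI] fin_supp_funs_in_carrier[OF dD(1)[OF uI]])
          also have "\<dots> = \<zero>\<^bsub>S\<^esub>"
          \<comment> \<open>The relation \<open>z\<close> covers only \<open>j\<close> in
            \<open>J\<close>; at any other \<open>j\<close> all values of \<open>d\<close> are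
            zero.\<close>
          proof (cases "j \<in> J")
            case False
            then show ?thesis
              by (intro add.finprod_one_eqI) (simp add: fin_supp_funsD(2)[OF dD(1)[OF uI]] s)
          qed (rule z)
          finally show ?thesis .
        qed
        then have "d s' = \<zero>\<^bsub>?B\<lparr>carrier := ?K\<rparr>\<^esub>" by (simp add: fun_eq_iff)
        then have "\<phi> (d s') = \<zero>\<^bsub>S\<^esub>" using left_hom_zero[OF phi modK modM] by simp
        moreover have "\<phi> (d s') = (\<Oplus>\<^bsub>S\<^esub>i\<in>I. s' i \<otimes>\<^bsub>S\<^esub> \<phi> (d (unit_fun i)))"
        proof -
          have "\<phi> (d s') = (\<Oplus>\<^bsub>S\<^esub>i\<in>I. s' i \<otimes>\<^bsub>S\<^esub> compose (carrier ?A) \<phi> d (unit_fun i))"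
            using M.free_hom_eq_sum[OF pd fin(1) s'] s' by (simp add: compose_def)
          also have "\<dots> = (\<Oplus>\<^bsub>S\<^esub>i\<in>I. s' i \<otimes>\<^bsub>S\<^esub> \<phi> (d (unit_fun i)))"
            using left_homD(1)[OF phi] uI s'
            by (intro finsum_cong') (auto simp: compose_def fin_supp_funs_in_carrier)
          finally show ?thesis .
        qed
        moreover have "\<dots> = (\<Oplus>\<^bsub>S\<^esub>i\<in>I. s i \<otimes>\<^bsub>S\<^esub> \<phi> (d (unit_fun i)))"
          using left_homD(1)[OF phi] uI by (intro finsum_cong') (auto simp: s'_def s)
        ultimately show "(\<Oplus>\<^bsub>S\<^esub>i\<in>I. s i \<otimes>\<^bsub>S\<^esub> \<phi> (d (unit_fun i))) = \<zero>\<^bsub>S\<^esub>" by simp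
      qed blast
      let ?g = "M.free_lift J b"
      have g: "?g \<in> left_hom S ?B ?M" by (rule M.free_lift_hom) (simp add: b)
      \<comment> \<open>Agreement on the image of \<open>d\<close> is tested on the basis of
        \<open>S^I\<close>, where it is the system solved by \<open>b\<close>.\<close>
      have "compose (carrier ?A) ?g d = compose (carrier ?A) \<phi> d"
      proof (rule M.free_hom_eqI[OF left_hom_compose[OF modA d g] pd])
        fix i assume i: "i \<in> I"
        have "?g (d (unit_fun i)) = (\<Oplus>\<^bsub>S\<^esub>j\<in>J. d (unit_fun i) j \<otimes>\<^bsub>S\<^esub> b j)"
          using M.free_lift_eq[OF dD(1)[OF uI[OF i]] fin(2) fin_supp_funsD(4)[OF dD(1)[OF uI[OF i]]]
              order_refl, of b] b by simp
        then show "compose (carrier ?A) ?g d (unit_fun i) = compose (carrier ?A) \<phi> d (unit_fun i)"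
          using uI[OF i] eq[OF i] by (simp add: compose_def)
      qed
      then have "?g (d u) = \<phi> (d u)" if "u \<in> carrier ?A" for u
        using that by (auto simp: compose_def fun_eq_iff restrict_def split: if_splits)
      with g show "\<exists>g\<in>left_hom S ?B ?M. \<forall>k\<in>?K. g k = \<phi> k" by auto
    qed
  next
    assume ext: "\<forall>d\<in>left_hom S ?A ?B. hom_extension S ?B (d ` carrier ?A) ?M"
    show "compatible_systems_solvable S I J"
    proof (rule compatible_systems_solvableI)
      fix A c
      assume A: "\<And>i j. \<lbrakk>i \<in> I; j \<in> J\<rbrakk> \<Longrightarrow> A i j \<in> carrier S" and c: "\<And>i. i \<in> I \<Longrightarrow> c i \<in> carrier S"
        and comp: "\<And>s. \<lbrakk>\<And>i. i \<in> I \<Longrightarrow> s i \<in> carrier S;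
            \<And>j. j \<in> J \<Longrightarrow> (\<Oplus>\<^bsub>S\<^esub>i\<in>I. s i \<otimes>\<^bsub>S\<^esub> A i j) = \<zero>\<^bsub>S\<^esub>\<rbrakk> \<Longrightarrow> (\<Oplus>\<^bsub>S\<^esub>i\<in>I. s i \<otimes>\<^bsub>S\<^esub> c i) = \<zero>\<^bsub>S\<^esub>"
      define row where "row i = (\<lambda>j. if j \<in> J then A i j else \<zero>\<^bsub>S\<^esub>)" for i
      have row: "row i \<in> fin_supp_funs S J" if "i \<in> I" for i
        by (rule fin_supp_funsI[OF fin(2) order_refl]) (auto simp: row_def A that)
      define d where "d = B.free_lift I row"
      define l where "l = M.free_lift I c"
      have d: "d \<in> left_hom S ?A ?B" unfolding d_def by (rule B.free_lift_hom) (simp add: row)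
      have l: "l \<in> left_hom S ?A ?M" unfolding l_def by (rule M.free_lift_hom) (simp add: c)
      note dD = left_homD[OF d] and lD = left_homD[OF l]
      have du: "d (unit_fun i) = row i" if "i \<in> I" for i
        unfolding d_def by (rule B.free_lift_unit) (simp_all add: row that)
      have lu: "l (unit_fun i) = c i" if "i \<in> I" for i
        unfolding l_def by (rule M.free_lift_unit) (simp_all add: c that)
      \<comment> \<open>The kernel of \<open>d\<close> is contained in the kernel of
        \<open>l\<close>; this is what the compatibility condition \<open>comp\<close>
        expresses.\<close>
      have l_zero: "l u = \<zero>\<^bsub>S\<^esub>" if u: "u \<in> carrier ?A" and z: "d u = \<zero>\<^bsub>?B\<^esub>" for u
      proof -
        have u': "u \<in> fin_supp_funs S I" using u by simp
        have uc: "u i \<in> carrier S" for i by (rule fin_supp_funs_in_carrier[OF u'])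
        have "(\<Oplus>\<^bsub>S\<^esub>i\<in>I. u i \<otimes>\<^bsub>S\<^esub> A i j) = \<zero>\<^bsub>S\<^esub>" if j: "j \<in> J" for j
        proof -
          have "d u = (\<Oplus>\<^bsub>?B\<^esub>i\<in>I. u i \<odot>\<^bsub>?B\<^esub> row i)"
            unfolding d_def
            by (rule B.free_lift_eq[OF u' fin(1) fin_supp_funsD(4)[OF u'] order_refl])
               (simp add: row)
          then have "d u j = (\<Oplus>\<^bsub>S\<^esub>i\<in>I. u i \<otimes>\<^bsub>S\<^esub> row i j)"
            by (simp add: finsum_free_left_module fin_supp_funs_smult row uc)
          with z j show ?thesis by (simp add: row_def)
        qed
        then have "(\<Oplus>\<^bsub>S\<^esub>i\<in>I. u i \<otimes>\<^bsub>S\<^esub> c i) = \<zero>\<^bsub>S\<^esub>" by (intro comp uc)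
        moreover have "l u = (\<Oplus>\<^bsub>S\<^esub>i\<in>I. u i \<otimes>\<^bsub>S\<^esub> c i)"
          unfolding l_def
          using M.free_lift_eq[OF u' fin(1) fin_supp_funsD(4)[OF u'] order_refl, of c] c by simp
        ultimately show ?thesis by simp
      qed
      let ?m = "\<ominus>\<^bsub>S\<^esub> \<one>\<^bsub>S\<^esub>"
      have l_eq: "l u = l v" if uv: "u \<in> carrier ?A" "v \<in> carrier ?A" "d u = d v" for u v
      proof -
        have mv: "?m \<odot>\<^bsub>?A\<^esub> v \<in> carrier ?A" using uv(2) by (intro A.smult_closed) auto
        have "d (u \<oplus>\<^bsub>?A\<^esub> ?m \<odot>\<^bsub>?A\<^esub> v) = d v \<oplus>\<^bsub>?B\<^esub> ?m \<odot>\<^bsub>?B\<^esub> d v"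
          using uv mv by (simp only: dD(2,3) a_inv_closed one_closed)
        also have "\<dots> = \<zero>\<^bsub>?B\<^esub>" by (rule B.add_smult_minus_one[OF dD(1)[OF uv(2)]])
        finally have "l (u \<oplus>\<^bsub>?A\<^esub> ?m \<odot>\<^bsub>?A\<^esub> v) = \<zero>\<^bsub>S\<^esub>"
          using uv mv by (intro l_zero A.M.a_closed)
        moreover have "l (u \<oplus>\<^bsub>?A\<^esub> ?m \<odot>\<^bsub>?A\<^esub> v) = l u \<oplus>\<^bsub>?M\<^esub> ?m \<odot>\<^bsub>?M\<^esub> l v"
          using uv mv by (simp only: lD(2,3) a_inv_closed one_closed)
        ultimately have "l u \<oplus>\<^bsub>S\<^esub> ?m \<otimes>\<^bsub>S\<^esub> l v = l v \<oplus>\<^bsub>S\<^esub> ?m \<otimes>\<^bsub>S\<^esub> l v"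
          using M.add_smult_minus_one[OF lD(1)[OF uv(2)]] by simp
        then show ?thesis using lD(1)[OF uv(1)] lD(1)[OF uv(2)] by (simp add: add.right_cancel)
      qed
      \<comment> \<open>Any preimage under \<open>d\<close> will do, because by \<open>l_eq\<close>
        the value of \<open>l\<close> does not depend on it.\<close>
      let ?K = "d ` carrier ?A" and ?i = "inv_into (carrier ?A) d"
      have i: "?i k \<in> carrier ?A" "d (?i k) = k" if "k \<in> ?K" for k
        using that by (simp_all only: inv_into_into f_inv_into_f)
      have li: "l (?i (d u)) = l u" if "u \<in> carrier ?A" for u
        using that i[of "d u"] by (intro l_eq) blast+
      have modK: "left_module S (?B\<lparr>carrier := ?K\<rparr>)" by (rule left_module_image[OF d modA modB])
      have "(\<lambda>k\<in>carrier (?B\<lparr>carrier := ?K\<rparr>). l (?i k)) \<in> left_hom S (?B\<lparr>carrier := ?K\<rparr>) ?M"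
      proof (rule left_homI[OF modK])
        fix k assume "k \<in> carrier (?B\<lparr>carrier := ?K\<rparr>)"
        then obtain u where u: "u \<in> carrier ?A" "k = d u" by auto
        then show "l (?i k) \<in> carrier ?M" using lD(1)[of u] by (simp only: li)
        show "l (?i (s \<odot>\<^bsub>?B\<lparr>carrier := ?K\<rparr>\<^esub> k)) = s \<odot>\<^bsub>?M\<^esub> l (?i k)" if "s \<in> carrier S" for s
        proof -
          have "s \<odot>\<^bsub>?B\<lparr>carrier := ?K\<rparr>\<^esub> k = d (s \<odot>\<^bsub>?A\<^esub> u)" using u that dD(3)[of s u] by simp
          then show ?thesis
            using u that by (simp only: li lD(3) A.smult_closed)
        qed
        fix k' assume "k' \<in> carrier (?B\<lparr>carrier := ?K\<rparr>)"
        then obtain v where v: "v \<in> carrier ?A" "k' = d v" by auto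
        have "k \<oplus>\<^bsub>?B\<lparr>carrier := ?K\<rparr>\<^esub> k' = d (u \<oplus>\<^bsub>?A\<^esub> v)" using u v dD(2)[of u v] by simp
        then show "l (?i (k \<oplus>\<^bsub>?B\<lparr>carrier := ?K\<rparr>\<^esub> k')) = l (?i k) \<oplus>\<^bsub>?M\<^esub> l (?i k')"
          using u v by (simp only: li lD(2) A.M.a_closed)
      qed
      moreover have "hom_extension S ?B ?K ?M" using ext d by blast
      ultimately obtain g where g: "g \<in> left_hom S ?B ?M" and gk: "\<And>k. k \<in> ?K \<Longrightarrow> g k = l (?i k)"
        unfolding hom_extension_def by force
      have gd: "g (d u) = l u" if "u \<in> carrier ?A" for u
        using gk[of "d u"] that by (simp only: li image_eqI[OF refl])
      have "(\<Oplus>\<^bsub>S\<^esub>j\<in>J. A i j \<otimes>\<^bsub>S\<^esub> g (unit_fun j)) = c i" if i: "i \<in> I" for i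
      proof -
        have "g (row i) = (\<Oplus>\<^bsub>S\<^esub>j\<in>J. row i j \<otimes>\<^bsub>S\<^esub> g (unit_fun j))"
          using M.free_hom_eq_sum[OF g fin(2) row[OF i]] by simp
        also have "\<dots> = (\<Oplus>\<^bsub>S\<^esub>j\<in>J. A i j \<otimes>\<^bsub>S\<^esub> g (unit_fun j))"
          using left_homD(1)[OF g] uJ i by (intro finsum_cong') (auto simp: row_def A)
        finally show ?thesis using gd[of "unit_fun i"] uI i by (simp add: du lu)
      qed
      then show "\<exists>b. (\<forall>j\<in>J. b j \<in> carrier S) \<and> (\<forall>i\<in>I. (\<Oplus>\<^bsub>S\<^esub>j\<in>J. A i j \<otimes>\<^bsub>S\<^esub> b j) = c i)"
        using left_homD(1)[OF g] uJ by (intro exI[of _ "\<lambda>j. g (unit_fun j)"]) auto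
    qed
  qed
qed

text \<open>The images of homomorphisms \<open>d\<close> from \<open>S^m\<close> to
  \<open>S^n\<close> are the same submodules as the kernels in finite presentations: a presentation
  provides \<open>d\<close>, and conversely the cokernel of \<open>d\<close> is a finitely presented
  module of the required type.\<close>

lemma left_FP_injective_ring_iff:
  fixes S :: "('s, 'm) ring_scheme"
  shows "left_FP_injective_ring S \<longleftrightarrow>
    ring S \<and> (\<forall>(m::nat) (n::nat). compatible_systems_solvable S {..<m} {..<n})"
proof (cases "ring S")
  case False
  then show ?thesis
    by (auto simp: left_FP_injective_ring_def FP_injective_def left_module_def)
next
  case True
  interpret ring S by fact
  let ?N = "\<lambda>n::nat. free_left_module S {..<n}" and ?M = "left_regular_module S"
  have modM: "left_module S ?M" by (rule left_module_regular[OF True])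
  have "left_FP_injective_ring S \<longleftrightarrow> (\<forall>F :: ('s, (nat \<Rightarrow> 's) set) module.
      finitely_presented S F \<longrightarrow> hom_extension S (res0 S F) (res_ker0 S F) ?M)"
    unfolding left_FP_injective_ring_def FP_injective_def
    using modM trivial_Ext1_iff[OF _ modM] finitely_presented_def by metis
  also have "\<dots> \<longleftrightarrow> (\<forall>m n. \<forall>d\<in>left_hom S (?N m) (?N n).
      hom_extension S (?N n) (d ` carrier (?N m)) ?M)"
  proof (intro iffI allI ballI impI)
    fix m n d
    assume hyp: "\<forall>F :: ('s, (nat \<Rightarrow> 's) set) module.
      finitely_presented S F \<longrightarrow> hom_extension S (res0 S F) (res_ker0 S F) ?M"
      and d: "d \<in> left_hom S (?N m) (?N n)"
    note modK = left_module_image[OF d left_module_free left_module_free]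
    have "d ` carrier (?N m) \<subseteq> carrier (?N n)" using left_homD(1)[OF d] by blast
    then obtain F :: "('s, (nat \<Rightarrow> 's) set) module" and p where F: "left_module S F"
      and p: "p \<in> left_hom S (?N n) F" "p ` carrier (?N n) = carrier F"
      and ker: "a_kernel (?N n) F p = d ` carrier (?N m)"
      by (rule quotient_module[OF left_module_free modK])
    then have "finitely_presented S F" unfolding finitely_presented_def using d by metis
    with hyp have "hom_extension S (res0 S F) (res_ker0 S F) ?M" by blast
    then show "hom_extension S (?N n) (d ` carrier (?N m)) ?M"
      by (simp only: hom_extension_presentation_iff[OF F modM p] ker)
  next
    fix F :: "('s, (nat \<Rightarrow> 's) set) module"
    assume hyp: "\<forall>m n. \<forall>d\<in>left_hom S (?N m) (?N n). hom_extension S (?N n) (d ` carrier (?N m)) ?M"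
      and "finitely_presented S F"
    then obtain m n d p where F: "left_module S F" and d: "d \<in> left_hom S (?N m) (?N n)"
      and p: "p \<in> left_hom S (?N n) F" "p ` carrier (?N n) = carrier F"
      and ker: "d ` carrier (?N m) = a_kernel (?N n) F p"
      unfolding finitely_presented_def by metis
    then show "hom_extension S (res0 S F) (res_ker0 S F) ?M"
      using hyp d by (simp only: hom_extension_presentation_iff[OF F modM p] flip: ker)
  qed
  also have "\<dots> \<longleftrightarrow> (\<forall>(m::nat) (n::nat). compatible_systems_solvable S {..<m} {..<n})"
    by (simp only: compatible_systems_solvable_iff[OF True finite_lessThan finite_lessThan])
  finally show ?thesis using True by simp
qed

lemma left_FP_injective_ringD:
  assumes "left_FP_injective_ring S" "finite I" "finite J"
  shows "compatible_systems_solvable S I J"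
proof -
  interpret ring S using assms(1) by (simp add: left_FP_injective_ring_iff)
  obtain f g where "bij_betw f {..<card I} I" "bij_betw g {..<card J} J"
    using ex_bij_betw_nat_finite[OF assms(2)] ex_bij_betw_nat_finite[OF assms(3)]
    by (auto simp: atLeast0LessThan)
  moreover have "compatible_systems_solvable S {..<card I} {..<card J}"
    using assms(1) by (simp add: left_FP_injective_ring_iff)
  ultimately show ?thesis using compatible_systems_solvable_reindex by blast
qed

section \<open>Sums over products and along bijections\<close>

lemma (in abelian_monoid) finsum_Times:
  assumes "finite A" "finite B" and "\<And>a b. \<lbrakk>a \<in> A; b \<in> B\<rbrakk> \<Longrightarrow> f (a, b) \<in> carrier G"
  shows "(\<Oplus>p\<in>A \<times> B. f p) = (\<Oplus>a\<in>A. \<Oplus>b\<in>B. f (a, b))"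
  using assms(1,3)
proof (induction A rule: finite_induct)
  case empty
  then show ?case by simp
next
  case (insert x F)
  have "(\<Oplus>p\<in>insert x F \<times> B. f p) = (\<Oplus>p\<in>Pair x ` B \<union> F \<times> B. f p)"
    by (intro finsum_cong') (use insert.prems in auto)
  also have "\<dots> = (\<Oplus>p\<in>Pair x ` B. f p) \<oplus> (\<Oplus>p\<in>F \<times> B. f p)"
    using insert.prems insert.hyps assms(2) by (intro finsum_Un_disjoint) auto
  also have "(\<Oplus>p\<in>Pair x ` B. f p) = (\<Oplus>b\<in>B. f (x, b))"
    using insert.prems by (intro finsum_reindex) (auto simp: inj_on_def)
  also have "(\<Oplus>p\<in>F \<times> B. f p) = (\<Oplus>a\<in>F. \<Oplus>b\<in>B. f (a, b))"
    using insert.IH insert.prems by blast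
  finally show ?case
    using insert by (subst finsum_insert) (auto intro!: finsum_closed)
qed

lemma (in abelian_monoid) finsum_bij:
  assumes "bij_betw h A B" "\<And>x. x \<in> B \<Longrightarrow> f x \<in> carrier G"
  shows "(\<Oplus>x\<in>B. f x) = (\<Oplus>x\<in>A. f (h x))"
  using finsum_reindex[of f h A] assms by (auto simp: bij_betw_def)

section \<open>Group rings\<close>

locale ring_and_group = R?: ring R + G?: group G
  for R :: "('r, 'm) ring_scheme" and G :: "('g, 'n) monoid_scheme"
begin

abbreviation RG :: "('g \<Rightarrow> 'r) ring" where "RG \<equiv> group_ring R G"

lemma group_ring_simps [simp]:
  "carrier RG = fin_supp_funs R (carrier G)"
  "\<zero>\<^bsub>RG\<^esub> = (\<lambda>x. \<zero>\<^bsub>R\<^esub>)"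
  "add RG = (\<lambda>a b x. a x \<oplus>\<^bsub>R\<^esub> b x)"
  by (simp_all add: group_ring_def)

text \<open>Sums depend only on carrier, zero and addition, and in these the group ring agrees with
  the free module on the group.\<close>

lemma finsum_group_ring:
  assumes "\<And>i. i \<in> I \<Longrightarrow> f i \<in> fin_supp_funs R (carrier G)"
  shows "finsum RG f I x = (\<Oplus>\<^bsub>R\<^esub>i\<in>I. f i x)"
proof -
  have "finsum RG f I = finsum (free_left_module R (carrier G)) f I"
    by (simp add: finsum_def finprod_def)
  then show ?thesis using R.finsum_free_left_module[OF assms] by simp
qed

lemma mult_eq_zero_outside: "x \<notin> carrier G \<Longrightarrow> (a \<otimes>\<^bsub>RG\<^esub> b) x = \<zero>\<^bsub>R\<^esub>"
  by (simp add: group_ring_def)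

section \<open>Convolution products\<close>

lemma mult_eq:
  assumes a: "a \<in> fin_supp_funs R (carrier G)" and b: "b \<in> fin_supp_funs R (carrier G)"
    and Y: "finite Y" "{y. a y \<noteq> \<zero>\<^bsub>R\<^esub>} \<subseteq> Y" and x: "x \<in> carrier G"
  shows "(a \<otimes>\<^bsub>RG\<^esub> b) x = (\<Oplus>\<^bsub>R\<^esub>y\<in>Y. a y \<otimes>\<^bsub>R\<^esub> b (inv\<^bsub>G\<^esub> y \<otimes>\<^bsub>G\<^esub> x))"
proof -
  have "(a \<otimes>\<^bsub>RG\<^esub> b) x = (\<Oplus>\<^bsub>R\<^esub>y\<in>{y. a y \<noteq> \<zero>\<^bsub>R\<^esub>}. a y \<otimes>\<^bsub>R\<^esub> b (inv\<^bsub>G\<^esub> y \<otimes>\<^bsub>G\<^esub> x))"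
    using x by (simp add: group_ring_def)
  also have "\<dots> = (\<Oplus>\<^bsub>R\<^esub>y\<in>Y. a y \<otimes>\<^bsub>R\<^esub> b (inv\<^bsub>G\<^esub> y \<otimes>\<^bsub>G\<^esub> x))"
    using Y R.fin_supp_funs_in_carrier[OF a] R.fin_supp_funs_in_carrier[OF b]
    by (intro R.add.finprod_mono_neutral_cong_left) auto
  finally show ?thesis .
qed

text \<open>A finite set outside which the product vanishes; cancellation may make the true support
  smaller. Its purpose is to give the outer sum in the associativity proof a finite range.\<close>

definition support_prod :: "('g \<Rightarrow> 'r) \<Rightarrow> ('g \<Rightarrow> 'r) \<Rightarrow> 'g set" where
  "support_prod a b = (\<lambda>(y, z). y \<otimes>\<^bsub>G\<^esub> z) ` ({y. a y \<noteq> \<zero>\<^bsub>R\<^esub>} \<times> {z. b z \<noteq> \<zero>\<^bsub>R\<^esub>})"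

lemma support_prod:
  assumes "a \<in> fin_supp_funs R (carrier G)" "b \<in> fin_supp_funs R (carrier G)"
  shows "finite (support_prod a b)" "support_prod a b \<subseteq> carrier G"
  using fin_supp_funsD(3,4)[OF assms(1)] fin_supp_funsD(3,4)[OF assms(2)]
  by (auto simp: support_prod_def)

lemma mem_support_prod:
  assumes "a \<in> fin_supp_funs R (carrier G)" "x \<in> carrier G"
    "a y \<noteq> \<zero>\<^bsub>R\<^esub>" "b (inv\<^bsub>G\<^esub> y \<otimes>\<^bsub>G\<^esub> x) \<noteq> \<zero>\<^bsub>R\<^esub>"
  shows "x \<in> support_prod a b"
proof -
  have "y \<in> carrier G" using assms(1,3) fin_supp_funsD(2) by fastforce
  then have "x = y \<otimes>\<^bsub>G\<^esub> (inv\<^bsub>G\<^esub> y \<otimes>\<^bsub>G\<^esub> x)" using assms(2) by (simp flip: G.m_assoc)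
  then show ?thesis using assms(3,4) by (force simp: support_prod_def)
qed

lemma mult_outside_support_prod:
  assumes a: "a \<in> fin_supp_funs R (carrier G)" and b: "b \<in> fin_supp_funs R (carrier G)"
    and x: "x \<notin> support_prod a b"
  shows "(a \<otimes>\<^bsub>RG\<^esub> b) x = \<zero>\<^bsub>R\<^esub>"
proof (cases "x \<in> carrier G")
  case True
  have "(a \<otimes>\<^bsub>RG\<^esub> b) x = (\<Oplus>\<^bsub>R\<^esub>y\<in>{y. a y \<noteq> \<zero>\<^bsub>R\<^esub>}. a y \<otimes>\<^bsub>R\<^esub> b (inv\<^bsub>G\<^esub> y \<otimes>\<^bsub>G\<^esub> x))"
    using True by (simp add: group_ring_def)
  also have "\<dots> = \<zero>\<^bsub>R\<^esub>"
  proof (rule R.add.finprod_one_eqI)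
    fix y assume "y \<in> {y. a y \<noteq> \<zero>\<^bsub>R\<^esub>}"
    then have "b (inv\<^bsub>G\<^esub> y \<otimes>\<^bsub>G\<^esub> x) = \<zero>\<^bsub>R\<^esub>" using mem_support_prod[OF a True] x by blast
    then show "a y \<otimes>\<^bsub>R\<^esub> b (inv\<^bsub>G\<^esub> y \<otimes>\<^bsub>G\<^esub> x) = \<zero>\<^bsub>R\<^esub>"
      using R.fin_supp_funs_in_carrier[OF a] by simp
  qed
  finally show ?thesis .
qed (rule mult_eq_zero_outside)

lemma mult_closed:
  assumes a: "a \<in> fin_supp_funs R (carrier G)" and b: "b \<in> fin_supp_funs R (carrier G)"
  shows "a \<otimes>\<^bsub>RG\<^esub> b \<in> fin_supp_funs R (carrier G)"
proof (rule R.fin_supp_funsI[OF support_prod[OF a b]])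
  fix x assume "x \<in> support_prod a b"
  then have x: "x \<in> carrier G" using support_prod(2)[OF a b] by blast
  show "(a \<otimes>\<^bsub>RG\<^esub> b) x \<in> carrier R"
    using R.fin_supp_funs_in_carrier[OF a] R.fin_supp_funs_in_carrier[OF b]
    by (subst mult_eq[OF a b fin_supp_funsD(3)[OF a] order_refl x]) (auto intro!: R.finsum_closed)
qed (rule mult_outside_support_prod[OF a b])

text \<open>The element usually written \<open>r g\<close>.\<close>

definition monomial :: "'g \<Rightarrow> 'r \<Rightarrow> 'g \<Rightarrow> 'r" where
  "monomial g r = (\<lambda>x. if x = g then r else \<zero>\<^bsub>R\<^esub>)"

lemma monomial_closed:
  "\<lbrakk>g \<in> carrier G; r \<in> carrier R\<rbrakk> \<Longrightarrow> monomial g r \<in> fin_supp_funs R (carrier G)"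
  by (rule R.fin_supp_funsI[of "{g}"]) (auto simp: monomial_def)

lemma one_group_ring: "\<one>\<^bsub>RG\<^esub> = monomial \<one>\<^bsub>G\<^esub> \<one>\<^bsub>R\<^esub>"
  by (simp add: group_ring_def monomial_def)

lemma monomial_mult:
  assumes "g \<in> carrier G" "r \<in> carrier R" and b: "b \<in> fin_supp_funs R (carrier G)"
    and "x \<in> carrier G"
  shows "(monomial g r \<otimes>\<^bsub>RG\<^esub> b) x = r \<otimes>\<^bsub>R\<^esub> b (inv\<^bsub>G\<^esub> g \<otimes>\<^bsub>G\<^esub> x)"
proof -
  have "(monomial g r \<otimes>\<^bsub>RG\<^esub> b) x = (\<Oplus>\<^bsub>R\<^esub>y\<in>{g}. monomial g r y \<otimes>\<^bsub>R\<^esub> b (inv\<^bsub>G\<^esub> y \<otimes>\<^bsub>G\<^esub> x))"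
    by (rule mult_eq) (use assms in \<open>auto simp: monomial_closed\<close>, auto simp: monomial_def split: if_splits)
  also have "\<dots> = r \<otimes>\<^bsub>R\<^esub> b (inv\<^bsub>G\<^esub> g \<otimes>\<^bsub>G\<^esub> x)"
    using assms R.fin_supp_funs_in_carrier[OF b] by (simp add: monomial_def)
  finally show ?thesis .
qed

lemma mult_monomial:
  assumes g: "g \<in> carrier G" and r: "r \<in> carrier R" and a: "a \<in> fin_supp_funs R (carrier G)"
    and x: "x \<in> carrier G"
  shows "(a \<otimes>\<^bsub>RG\<^esub> monomial g r) x = a (x \<otimes>\<^bsub>G\<^esub> inv\<^bsub>G\<^esub> g) \<otimes>\<^bsub>R\<^esub> r"
proof -
  let ?S = "{y. a y \<noteq> \<zero>\<^bsub>R\<^esub>}" and ?z = "x \<otimes>\<^bsub>G\<^esub> inv\<^bsub>G\<^esub> g"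
  have z: "inv\<^bsub>G\<^esub> y \<otimes>\<^bsub>G\<^esub> x = g \<longleftrightarrow> y = ?z" if y: "y \<in> carrier G" for y
    using g x y by (metis G.inv_closed G.inv_solve_left G.inv_solve_right G.m_closed)
  \<comment> \<open>\<open>?z\<close> is added to the range of summation since \<open>a\<close> may
    vanish there; every other term of the sum is zero.\<close>
  have S: "finite (insert ?z ?S)" "insert ?z ?S \<subseteq> carrier G"
    using fin_supp_funsD(3,4)[OF a] g x by auto
  have "(a \<otimes>\<^bsub>RG\<^esub> monomial g r) x =
      (\<Oplus>\<^bsub>R\<^esub>y\<in>insert ?z ?S. a y \<otimes>\<^bsub>R\<^esub> monomial g r (inv\<^bsub>G\<^esub> y \<otimes>\<^bsub>G\<^esub> x))"
    by (rule mult_eq[OF a monomial_closed[OF g r] S(1) _ x]) blast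
  also have "\<dots> = (\<Oplus>\<^bsub>R\<^esub>y\<in>{?z}. a y \<otimes>\<^bsub>R\<^esub> r)"
    using S z r R.fin_supp_funs_in_carrier[OF a]
    by (intro R.add.finprod_mono_neutral_cong_right)
       (auto simp: monomial_def subset_iff split: if_splits)
  also have "\<dots> = a ?z \<otimes>\<^bsub>R\<^esub> r" using R.fin_supp_funs_in_carrier[OF a] r by simp
  finally show ?thesis .
qed

text \<open>Both sides are the sum of \<open>a(z) b(w) c(w\<inverse> z\<inverse> x)\<close> over the
  supports of \<open>a\<close> and \<open>b\<close>. The left side arises as a sum over products
  \<open>y\<close>, which for fixed \<open>z\<close> the substitution \<open>y = z w\<close> turns
  into a sum over \<open>w\<close>.\<close>

lemma mult_assoc:
  assumes a: "a \<in> fin_supp_funs R (carrier G)" and b: "b \<in> fin_supp_funs R (carrier G)"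
    and c: "c \<in> fin_supp_funs R (carrier G)"
  shows "a \<otimes>\<^bsub>RG\<^esub> b \<otimes>\<^bsub>RG\<^esub> c = a \<otimes>\<^bsub>RG\<^esub> (b \<otimes>\<^bsub>RG\<^esub> c)"
proof
  note ab = mult_closed[OF a b] and bc = mult_closed[OF b c]
  note ac = R.fin_supp_funs_in_carrier[OF a] R.fin_supp_funs_in_carrier[OF b]
    R.fin_supp_funs_in_carrier[OF c]
  let ?A = "{y. a y \<noteq> \<zero>\<^bsub>R\<^esub>}" and ?B = "{y. b y \<noteq> \<zero>\<^bsub>R\<^esub>}" and ?Z = "support_prod a b"
  note A = fin_supp_funsD(3,4)[OF a] and B = fin_supp_funsD(3,4)[OF b] and Z = support_prod[OF a b]
  fix x
  show "(a \<otimes>\<^bsub>RG\<^esub> b \<otimes>\<^bsub>RG\<^esub> c) x = (a \<otimes>\<^bsub>RG\<^esub> (b \<otimes>\<^bsub>RG\<^esub> c)) x"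
  proof (cases "x \<in> carrier G")
    case True
    note x = this
    have "(a \<otimes>\<^bsub>RG\<^esub> b \<otimes>\<^bsub>RG\<^esub> c) x = (\<Oplus>\<^bsub>R\<^esub>y\<in>?Z. (a \<otimes>\<^bsub>RG\<^esub> b) y \<otimes>\<^bsub>R\<^esub> c (inv\<^bsub>G\<^esub> y \<otimes>\<^bsub>G\<^esub> x))"
      by (rule mult_eq[OF ab c Z(1) _ x]) (use mult_outside_support_prod[OF a b] in blast)
    also have "\<dots> = (\<Oplus>\<^bsub>R\<^esub>y\<in>?Z. \<Oplus>\<^bsub>R\<^esub>z\<in>?A.
        a z \<otimes>\<^bsub>R\<^esub> b (inv\<^bsub>G\<^esub> z \<otimes>\<^bsub>G\<^esub> y) \<otimes>\<^bsub>R\<^esub> c (inv\<^bsub>G\<^esub> y \<otimes>\<^bsub>G\<^esub> x))"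
    proof (rule R.finsum_cong'[OF refl])
      fix y assume "y \<in> ?Z"
      then have "(a \<otimes>\<^bsub>RG\<^esub> b) y = (\<Oplus>\<^bsub>R\<^esub>z\<in>?A. a z \<otimes>\<^bsub>R\<^esub> b (inv\<^bsub>G\<^esub> z \<otimes>\<^bsub>G\<^esub> y))"
        using Z(2) by (intro mult_eq[OF a b A(1) order_refl]) blast
      then show "(a \<otimes>\<^bsub>RG\<^esub> b) y \<otimes>\<^bsub>R\<^esub> c (inv\<^bsub>G\<^esub> y \<otimes>\<^bsub>G\<^esub> x) =
          (\<Oplus>\<^bsub>R\<^esub>z\<in>?A. a z \<otimes>\<^bsub>R\<^esub> b (inv\<^bsub>G\<^esub> z \<otimes>\<^bsub>G\<^esub> y) \<otimes>\<^bsub>R\<^esub> c (inv\<^bsub>G\<^esub> y \<otimes>\<^bsub>G\<^esub> x))"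
        by (simp add: R.finsum_ldistr A(1) ac)
    qed (auto intro!: R.finsum_closed simp: ac)
    also have "\<dots> = (\<Oplus>\<^bsub>R\<^esub>z\<in>?A. \<Oplus>\<^bsub>R\<^esub>y\<in>?Z.
        a z \<otimes>\<^bsub>R\<^esub> b (inv\<^bsub>G\<^esub> z \<otimes>\<^bsub>G\<^esub> y) \<otimes>\<^bsub>R\<^esub> c (inv\<^bsub>G\<^esub> y \<otimes>\<^bsub>G\<^esub> x))"
      by (rule R.finsum_swap) (simp_all add: Z A ac)
    also have "\<dots> = (\<Oplus>\<^bsub>R\<^esub>z\<in>?A. a z \<otimes>\<^bsub>R\<^esub> (b \<otimes>\<^bsub>RG\<^esub> c) (inv\<^bsub>G\<^esub> z \<otimes>\<^bsub>G\<^esub> x))"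
    proof (rule R.finsum_cong')
      fix z assume z: "z \<in> ?A"
      then have zG: "z \<in> carrier G" using A(2) by blast
      \<comment> \<open>The range \<open>?Z\<close> is independent of \<open>z\<close>, as
        exchanging the sums required; for fixed \<open>z\<close> only the translate of
        \<open>?B\<close> by \<open>z\<close> contributes.\<close>
      have sub: "(\<lambda>w. z \<otimes>\<^bsub>G\<^esub> w) ` ?B \<subseteq> ?Z" using z by (auto simp: support_prod_def)
      have inj: "inj_on (\<lambda>w. z \<otimes>\<^bsub>G\<^esub> w) ?B"
        using B(2) zG by (meson G.inj_on_multc G.inj_on_cmult inj_on_subset)
      have "(\<Oplus>\<^bsub>R\<^esub>y\<in>?Z. a z \<otimes>\<^bsub>R\<^esub> b (inv\<^bsub>G\<^esub> z \<otimes>\<^bsub>G\<^esub> y) \<otimes>\<^bsub>R\<^esub> c (inv\<^bsub>G\<^esub> y \<otimes>\<^bsub>G\<^esub> x)) =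
          (\<Oplus>\<^bsub>R\<^esub>y\<in>(\<lambda>w. z \<otimes>\<^bsub>G\<^esub> w) ` ?B. a z \<otimes>\<^bsub>R\<^esub> b (inv\<^bsub>G\<^esub> z \<otimes>\<^bsub>G\<^esub> y) \<otimes>\<^bsub>R\<^esub> c (inv\<^bsub>G\<^esub> y \<otimes>\<^bsub>G\<^esub> x))"
      proof (rule R.add.finprod_mono_neutral_cong_right[OF Z(1) sub])
        fix y assume y: "y \<in> ?Z - (\<lambda>w. z \<otimes>\<^bsub>G\<^esub> w) ` ?B"
        then have yG: "y \<in> carrier G" using Z(2) by blast
        then have "y = z \<otimes>\<^bsub>G\<^esub> (inv\<^bsub>G\<^esub> z \<otimes>\<^bsub>G\<^esub> y)" using zG by (simp flip: G.m_assoc)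
        then have "b (inv\<^bsub>G\<^esub> z \<otimes>\<^bsub>G\<^esub> y) = \<zero>\<^bsub>R\<^esub>" using y by blast
        then show "a z \<otimes>\<^bsub>R\<^esub> b (inv\<^bsub>G\<^esub> z \<otimes>\<^bsub>G\<^esub> y) \<otimes>\<^bsub>R\<^esub> c (inv\<^bsub>G\<^esub> y \<otimes>\<^bsub>G\<^esub> x) = \<zero>\<^bsub>R\<^esub>"
          by (simp add: ac)
      qed (simp_all add: ac)
      also have "\<dots> = (\<Oplus>\<^bsub>R\<^esub>w\<in>?B. a z \<otimes>\<^bsub>R\<^esub> b (inv\<^bsub>G\<^esub> z \<otimes>\<^bsub>G\<^esub> (z \<otimes>\<^bsub>G\<^esub> w)) \<otimes>\<^bsub>R\<^esub>
          c (inv\<^bsub>G\<^esub> (z \<otimes>\<^bsub>G\<^esub> w) \<otimes>\<^bsub>G\<^esub> x))"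
        by (rule R.finsum_reindex[OF _ inj]) (simp add: ac)
      also have "\<dots> = (\<Oplus>\<^bsub>R\<^esub>w\<in>?B. a z \<otimes>\<^bsub>R\<^esub> (b w \<otimes>\<^bsub>R\<^esub> c (inv\<^bsub>G\<^esub> w \<otimes>\<^bsub>G\<^esub> (inv\<^bsub>G\<^esub> z \<otimes>\<^bsub>G\<^esub> x))))"
      proof (rule R.finsum_cong')
        fix w assume "w \<in> ?B"
        then have w: "w \<in> carrier G" using B(2) by blast
        have "inv\<^bsub>G\<^esub> z \<otimes>\<^bsub>G\<^esub> (z \<otimes>\<^bsub>G\<^esub> w) = w" using w zG by (simp flip: G.m_assoc)
        then show "a z \<otimes>\<^bsub>R\<^esub> b (inv\<^bsub>G\<^esub> z \<otimes>\<^bsub>G\<^esub> (z \<otimes>\<^bsub>G\<^esub> w)) \<otimes>\<^bsub>R\<^esub> c (inv\<^bsub>G\<^esub> (z \<otimes>\<^bsub>G\<^esub> w) \<otimes>\<^bsub>G\<^esub> x) =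
            a z \<otimes>\<^bsub>R\<^esub> (b w \<otimes>\<^bsub>R\<^esub> c (inv\<^bsub>G\<^esub> w \<otimes>\<^bsub>G\<^esub> (inv\<^bsub>G\<^esub> z \<otimes>\<^bsub>G\<^esub> x)))"
          using w zG x by (simp add: ac R.m_assoc G.m_assoc G.inv_mult_group)
      qed (auto simp: ac)
      also have "\<dots> = a z \<otimes>\<^bsub>R\<^esub> (\<Oplus>\<^bsub>R\<^esub>w\<in>?B. b w \<otimes>\<^bsub>R\<^esub> c (inv\<^bsub>G\<^esub> w \<otimes>\<^bsub>G\<^esub> (inv\<^bsub>G\<^esub> z \<otimes>\<^bsub>G\<^esub> x)))"
        by (rule R.finsum_rdistr[symmetric]) (auto simp: ac B)
      also have "\<dots> = a z \<otimes>\<^bsub>R\<^esub> (b \<otimes>\<^bsub>RG\<^esub> c) (inv\<^bsub>G\<^esub> z \<otimes>\<^bsub>G\<^esub> x)"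
        using zG x by (subst mult_eq[OF b c B(1) order_refl]) simp_all
      finally show "(\<Oplus>\<^bsub>R\<^esub>y\<in>?Z. a z \<otimes>\<^bsub>R\<^esub> b (inv\<^bsub>G\<^esub> z \<otimes>\<^bsub>G\<^esub> y) \<otimes>\<^bsub>R\<^esub> c (inv\<^bsub>G\<^esub> y \<otimes>\<^bsub>G\<^esub> x)) =
          a z \<otimes>\<^bsub>R\<^esub> (b \<otimes>\<^bsub>RG\<^esub> c) (inv\<^bsub>G\<^esub> z \<otimes>\<^bsub>G\<^esub> x)" .
    qed (auto simp: ac R.fin_supp_funs_in_carrier[OF bc])
    also have "\<dots> = (a \<otimes>\<^bsub>RG\<^esub> (b \<otimes>\<^bsub>RG\<^esub> c)) x"
      by (rule mult_eq[OF a bc A(1) order_refl x, symmetric])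
    finally show ?thesis .
  qed (simp add: mult_eq_zero_outside)
qed

section \<open>The ring axioms\<close>

lemma ring_group_ring: "ring RG"
proof (rule ringI)
  interpret P: left_module R "free_left_module R (carrier G)" by (rule R.left_module_free)
  show "abelian_group RG"
  proof (rule abelian_groupI)
    show "\<exists>y\<in>carrier RG. y \<oplus>\<^bsub>RG\<^esub> x = \<zero>\<^bsub>RG\<^esub>" if "x \<in> carrier RG" for x
      using that P.M.l_neg[of x] P.M.a_inv_closed[of x] by auto
  qed (auto simp: R.fin_supp_funs_add R.fin_supp_funs_zero R.fin_supp_funs_in_carrier R.a_ac)
  show "monoid RG"
  proof (rule monoidI)
    show "\<one>\<^bsub>RG\<^esub> \<in> carrier RG" by (simp add: one_group_ring monomial_closed)
    fix x assume "x \<in> carrier RG"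
    then have x: "x \<in> fin_supp_funs R (carrier G)" by simp
    show "\<one>\<^bsub>RG\<^esub> \<otimes>\<^bsub>RG\<^esub> x = x"
    proof
      show "(\<one>\<^bsub>RG\<^esub> \<otimes>\<^bsub>RG\<^esub> x) y = x y" for y
        by (cases "y \<in> carrier G")
           (simp_all add: one_group_ring monomial_mult x mult_eq_zero_outside fin_supp_funsD(2)[OF x]
             R.fin_supp_funs_in_carrier[OF x])
    qed
    show "x \<otimes>\<^bsub>RG\<^esub> \<one>\<^bsub>RG\<^esub> = x"
    proof
      show "(x \<otimes>\<^bsub>RG\<^esub> \<one>\<^bsub>RG\<^esub>) y = x y" for y
        by (cases "y \<in> carrier G")
           (simp_all add: one_group_ring mult_monomial x mult_eq_zero_outside fin_supp_funsD(2)[OF x]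
             R.fin_supp_funs_in_carrier[OF x])
    qed
  qed (simp_all add: mult_closed mult_assoc)
  fix a b c assume "a \<in> carrier RG" "b \<in> carrier RG" "c \<in> carrier RG"
  then have a: "a \<in> fin_supp_funs R (carrier G)" and b: "b \<in> fin_supp_funs R (carrier G)"
    and c: "c \<in> fin_supp_funs R (carrier G)" by simp_all
  note ac = R.fin_supp_funs_in_carrier[OF a] R.fin_supp_funs_in_carrier[OF b]
    R.fin_supp_funs_in_carrier[OF c]
  note ab = R.fin_supp_funs_add[OF a b]
  let ?A = "{y. a y \<noteq> \<zero>\<^bsub>R\<^esub>}" and ?B = "{y. b y \<noteq> \<zero>\<^bsub>R\<^esub>}" and ?C = "{y. c y \<noteq> \<zero>\<^bsub>R\<^esub>}"
  \<comment> \<open>A common range for \<open>a\<close>, \<open>b\<close> and \<open>a + b\<close>,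
    whose supports may all differ.\<close>
  have fin: "finite (?A \<union> ?B)" using fin_supp_funsD(3)[OF a] fin_supp_funsD(3)[OF b] by simp
  show "(a \<oplus>\<^bsub>RG\<^esub> b) \<otimes>\<^bsub>RG\<^esub> c = a \<otimes>\<^bsub>RG\<^esub> c \<oplus>\<^bsub>RG\<^esub> b \<otimes>\<^bsub>RG\<^esub> c"
  proof
    fix x
    show "((a \<oplus>\<^bsub>RG\<^esub> b) \<otimes>\<^bsub>RG\<^esub> c) x = (a \<otimes>\<^bsub>RG\<^esub> c \<oplus>\<^bsub>RG\<^esub> b \<otimes>\<^bsub>RG\<^esub> c) x"
    proof (cases "x \<in> carrier G")
      case True
      have "((a \<oplus>\<^bsub>RG\<^esub> b) \<otimes>\<^bsub>RG\<^esub> c) x =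
          (\<Oplus>\<^bsub>R\<^esub>y\<in>?A \<union> ?B. (a y \<oplus>\<^bsub>R\<^esub> b y) \<otimes>\<^bsub>R\<^esub> c (inv\<^bsub>G\<^esub> y \<otimes>\<^bsub>G\<^esub> x))"
        by (simp, subst mult_eq[OF ab c fin _ True]) auto
      also have "\<dots> = (\<Oplus>\<^bsub>R\<^esub>y\<in>?A \<union> ?B. a y \<otimes>\<^bsub>R\<^esub> c (inv\<^bsub>G\<^esub> y \<otimes>\<^bsub>G\<^esub> x)) \<oplus>\<^bsub>R\<^esub>
          (\<Oplus>\<^bsub>R\<^esub>y\<in>?A \<union> ?B. b y \<otimes>\<^bsub>R\<^esub> c (inv\<^bsub>G\<^esub> y \<otimes>\<^bsub>G\<^esub> x))"
        by (subst R.finsum_addf[symmetric]) (auto simp: ac R.l_distr intro!: R.finsum_cong')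
      also have "\<dots> = (a \<otimes>\<^bsub>RG\<^esub> c \<oplus>\<^bsub>RG\<^esub> b \<otimes>\<^bsub>RG\<^esub> c) x"
        by (simp add: mult_eq[OF a c fin _ True] mult_eq[OF b c fin _ True])
      finally show ?thesis .
    qed (simp add: mult_eq_zero_outside)
  qed
  show "c \<otimes>\<^bsub>RG\<^esub> (a \<oplus>\<^bsub>RG\<^esub> b) = c \<otimes>\<^bsub>RG\<^esub> a \<oplus>\<^bsub>RG\<^esub> c \<otimes>\<^bsub>RG\<^esub> b"
  proof
    fix x
    show "(c \<otimes>\<^bsub>RG\<^esub> (a \<oplus>\<^bsub>RG\<^esub> b)) x = (c \<otimes>\<^bsub>RG\<^esub> a \<oplus>\<^bsub>RG\<^esub> c \<otimes>\<^bsub>RG\<^esub> b) x"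
    proof (cases "x \<in> carrier G")
      case True
      note me = mult_eq[OF c _ fin_supp_funsD(3)[OF c] order_refl True]
      have "(c \<otimes>\<^bsub>RG\<^esub> (a \<oplus>\<^bsub>RG\<^esub> b)) x =
          (\<Oplus>\<^bsub>R\<^esub>y\<in>?C. c y \<otimes>\<^bsub>R\<^esub> (a (inv\<^bsub>G\<^esub> y \<otimes>\<^bsub>G\<^esub> x) \<oplus>\<^bsub>R\<^esub> b (inv\<^bsub>G\<^esub> y \<otimes>\<^bsub>G\<^esub> x)))"
        by (simp add: me[OF ab])
      also have "\<dots> = (\<Oplus>\<^bsub>R\<^esub>y\<in>?C. c y \<otimes>\<^bsub>R\<^esub> a (inv\<^bsub>G\<^esub> y \<otimes>\<^bsub>G\<^esub> x)) \<oplus>\<^bsub>R\<^esub>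
          (\<Oplus>\<^bsub>R\<^esub>y\<in>?C. c y \<otimes>\<^bsub>R\<^esub> b (inv\<^bsub>G\<^esub> y \<otimes>\<^bsub>G\<^esub> x))"
        by (subst R.finsum_addf[symmetric]) (auto simp: ac R.r_distr intro!: R.finsum_cong')
      also have "\<dots> = (c \<otimes>\<^bsub>RG\<^esub> a \<oplus>\<^bsub>RG\<^esub> c \<otimes>\<^bsub>RG\<^esub> b) x" by (simp add: me[OF a] me[OF b])
      finally show ?thesis .
    qed (simp add: mult_eq_zero_outside)
  qed
qed

text \<open>Elements of \<open>R\<close> are embedded as multiples of the identity of
  \<open>G\<close>. Multiplying by these acts on each coefficient separately, so a relation over
  \<open>R(G)\<close> is a family of relations over \<open>R\<close>, one for each group element,
  and compatibility carries over from \<open>R\<close> to \<open>R(G)\<close>.\<close>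

lemma solvable_coefficients:
  assumes fin: "finite I" "finite J" and solv: "compatible_systems_solvable RG I J"
  shows "compatible_systems_solvable R I J"
proof (rule compatible_systems_solvableI)
  fix A c
  assume A: "\<And>i j. \<lbrakk>i \<in> I; j \<in> J\<rbrakk> \<Longrightarrow> A i j \<in> carrier R" and c: "\<And>i. i \<in> I \<Longrightarrow> c i \<in> carrier R"
    and comp: "\<And>s. \<lbrakk>\<And>i. i \<in> I \<Longrightarrow> s i \<in> carrier R;
        \<And>j. j \<in> J \<Longrightarrow> (\<Oplus>\<^bsub>R\<^esub>i\<in>I. s i \<otimes>\<^bsub>R\<^esub> A i j) = \<zero>\<^bsub>R\<^esub>\<rbrakk> \<Longrightarrow> (\<Oplus>\<^bsub>R\<^esub>i\<in>I. s i \<otimes>\<^bsub>R\<^esub> c i) = \<zero>\<^bsub>R\<^esub>"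
  let ?\<iota> = "monomial \<one>\<^bsub>G\<^esub>"
  have sum_\<iota>: "(\<Oplus>\<^bsub>RG\<^esub>i\<in>I. s i \<otimes>\<^bsub>RG\<^esub> ?\<iota> (f i)) x = (\<Oplus>\<^bsub>R\<^esub>i\<in>I. s i x \<otimes>\<^bsub>R\<^esub> f i)"
    if s: "\<And>i. i \<in> I \<Longrightarrow> s i \<in> carrier RG" and f: "\<And>i. i \<in> I \<Longrightarrow> f i \<in> carrier R"
      and x: "x \<in> carrier G" for s f x
  proof -
    have "(\<Oplus>\<^bsub>RG\<^esub>i\<in>I. s i \<otimes>\<^bsub>RG\<^esub> ?\<iota> (f i)) x = (\<Oplus>\<^bsub>R\<^esub>i\<in>I. (s i \<otimes>\<^bsub>RG\<^esub> ?\<iota> (f i)) x)"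
      using s f by (intro finsum_group_ring mult_closed) (simp_all add: monomial_closed)
    also have "\<dots> = (\<Oplus>\<^bsub>R\<^esub>i\<in>I. s i x \<otimes>\<^bsub>R\<^esub> f i)"
      using s f x R.fin_supp_funs_in_carrier[of _ "carrier G"]
      by (intro R.finsum_cong' refl) (auto simp: mult_monomial)
    finally show ?thesis .
  qed
  obtain b where b: "\<And>j. j \<in> J \<Longrightarrow> b j \<in> carrier RG"
    and eq: "\<And>i. i \<in> I \<Longrightarrow> (\<Oplus>\<^bsub>RG\<^esub>j\<in>J. ?\<iota> (A i j) \<otimes>\<^bsub>RG\<^esub> b j) = ?\<iota> (c i)"
  proof (rule compatible_systems_solvableD[OF solv, of "\<lambda>i j. ?\<iota> (A i j)" "\<lambda>i. ?\<iota> (c i)"])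
    fix s assume s: "\<And>i. i \<in> I \<Longrightarrow> s i \<in> carrier RG"
      and z: "\<And>j. j \<in> J \<Longrightarrow> (\<Oplus>\<^bsub>RG\<^esub>i\<in>I. s i \<otimes>\<^bsub>RG\<^esub> ?\<iota> (A i j)) = \<zero>\<^bsub>RG\<^esub>"
    show "(\<Oplus>\<^bsub>RG\<^esub>i\<in>I. s i \<otimes>\<^bsub>RG\<^esub> ?\<iota> (c i)) = \<zero>\<^bsub>RG\<^esub>"
    proof
      fix x
      show "(\<Oplus>\<^bsub>RG\<^esub>i\<in>I. s i \<otimes>\<^bsub>RG\<^esub> ?\<iota> (c i)) x = \<zero>\<^bsub>RG\<^esub> x"
      proof (cases "x \<in> carrier G")
        case True
        have "(\<Oplus>\<^bsub>R\<^esub>i\<in>I. s i x \<otimes>\<^bsub>R\<^esub> A i j) = \<zero>\<^bsub>R\<^esub>" if j: "j \<in> J" for j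
          using z[OF j] by (subst sum_\<iota>[symmetric]) (simp_all add: s[simplified] A j True)
        then have "(\<Oplus>\<^bsub>R\<^esub>i\<in>I. s i x \<otimes>\<^bsub>R\<^esub> c i) = \<zero>\<^bsub>R\<^esub>"
          using s by (intro comp) (auto simp: R.fin_supp_funs_in_carrier[of _ "carrier G"])
        then show ?thesis by (simp add: sum_\<iota> s[simplified] c True)
      next
        \<comment> \<open>Elements of the group ring are functions on the whole type that vanish off
          \<open>G\<close>.\<close>
        case False
        have "(\<Oplus>\<^bsub>RG\<^esub>i\<in>I. s i \<otimes>\<^bsub>RG\<^esub> ?\<iota> (c i)) \<in> carrier RG"
          using s c ring_group_ring
          by (intro abelian_monoid.finsum_closed)
             (auto intro: mult_closed monomial_closed ring.axioms abelian_group.axioms)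
        then show ?thesis using False fin_supp_funsD(2) by fastforce
      qed
    qed
  qed (auto simp: A c monomial_closed)
  have "(\<Oplus>\<^bsub>R\<^esub>j\<in>J. A i j \<otimes>\<^bsub>R\<^esub> b j \<one>\<^bsub>G\<^esub>) = c i" if i: "i \<in> I" for i
  proof -
    have "c i = (\<Oplus>\<^bsub>RG\<^esub>j\<in>J. ?\<iota> (A i j) \<otimes>\<^bsub>RG\<^esub> b j) \<one>\<^bsub>G\<^esub>" by (simp only: eq[OF i]) (simp add: monomial_def)
    also have "\<dots> = (\<Oplus>\<^bsub>R\<^esub>j\<in>J. (?\<iota> (A i j) \<otimes>\<^bsub>RG\<^esub> b j) \<one>\<^bsub>G\<^esub>)"
      using b A i by (intro finsum_group_ring mult_closed) (simp_all add: monomial_closed)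
    also have "\<dots> = (\<Oplus>\<^bsub>R\<^esub>j\<in>J. A i j \<otimes>\<^bsub>R\<^esub> b j \<one>\<^bsub>G\<^esub>)"
      using b A i R.fin_supp_funs_in_carrier[of _ "carrier G"]
      by (intro R.finsum_cong' refl) (auto simp: monomial_mult)
    finally show ?thesis ..
  qed
  then show "\<exists>b. (\<forall>j\<in>J. b j \<in> carrier R) \<and> (\<forall>i\<in>I. (\<Oplus>\<^bsub>R\<^esub>j\<in>J. A i j \<otimes>\<^bsub>R\<^esub> b j) = c i)"
    using b by (intro exI[of _ "\<lambda>j. b j \<one>\<^bsub>G\<^esub>"]) (auto simp: R.fin_supp_funs_in_carrier[of _ "carrier G"])
qed

section \<open>The augmentation and the elements 1 - g\<close>

definition augmentation :: "('g \<Rightarrow> 'r) \<Rightarrow> 'r" where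
  "augmentation = left_module.free_lift R (left_regular_module R) (carrier G) (\<lambda>_. \<one>\<^bsub>R\<^esub>)"

lemma augmentation_hom:
    "augmentation \<in> left_hom R (free_left_module R (carrier G)) (left_regular_module R)"
  and augmentation_monomial_one: "g \<in> carrier G \<Longrightarrow> augmentation (monomial g \<one>\<^bsub>R\<^esub>) = \<one>\<^bsub>R\<^esub>"
proof -
  interpret M: left_module R "left_regular_module R" by (rule left_module_regular[OF R.ring_axioms])
  show "augmentation \<in> left_hom R (free_left_module R (carrier G)) (left_regular_module R)"
    unfolding augmentation_def by (rule M.free_lift_hom) simp
  show "g \<in> carrier G \<Longrightarrow> augmentation (monomial g \<one>\<^bsub>R\<^esub>) = \<one>\<^bsub>R\<^esub>"
    using M.free_lift_unit[of "carrier G" "\<lambda>_. \<one>\<^bsub>R\<^esub>" g]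
    by (simp add: augmentation_def R.unit_fun_def monomial_def)
qed

definition one_minus :: "'g \<Rightarrow> 'g \<Rightarrow> 'r" where
  "one_minus g = \<one>\<^bsub>RG\<^esub> \<oplus>\<^bsub>RG\<^esub> monomial g (\<ominus>\<^bsub>R\<^esub> \<one>\<^bsub>R\<^esub>)"

lemma one_minus_closed: "g \<in> carrier G \<Longrightarrow> one_minus g \<in> fin_supp_funs R (carrier G)"
  by (simp add: one_minus_def one_group_ring R.fin_supp_funs_add monomial_closed)

lemma one_minus_mult:
  assumes g: "g \<in> carrier G" and b: "b \<in> fin_supp_funs R (carrier G)" and x: "x \<in> carrier G"
  shows "(one_minus g \<otimes>\<^bsub>RG\<^esub> b) x = b x \<ominus>\<^bsub>R\<^esub> b (inv\<^bsub>G\<^esub> g \<otimes>\<^bsub>G\<^esub> x)"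
proof -
  interpret RG: ring RG by (rule ring_group_ring)
  have "one_minus g \<otimes>\<^bsub>RG\<^esub> b = b \<oplus>\<^bsub>RG\<^esub> monomial g (\<ominus>\<^bsub>R\<^esub> \<one>\<^bsub>R\<^esub>) \<otimes>\<^bsub>RG\<^esub> b"
    unfolding one_minus_def using b RG.one_closed
    by (subst RG.l_distr) (auto simp: monomial_closed g simp del: group_ring_simps(3))
  then show ?thesis
    using R.fin_supp_funs_in_carrier[OF b]
    by (simp add: monomial_mult g b x R.l_minus R.minus_eq)
qed

lemma mult_one_minus:
  assumes g: "g \<in> carrier G" and a: "a \<in> fin_supp_funs R (carrier G)" and x: "x \<in> carrier G"
  shows "(a \<otimes>\<^bsub>RG\<^esub> one_minus g) x = a x \<ominus>\<^bsub>R\<^esub> a (x \<otimes>\<^bsub>G\<^esub> inv\<^bsub>G\<^esub> g)"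
proof -
  interpret RG: ring RG by (rule ring_group_ring)
  have "a \<otimes>\<^bsub>RG\<^esub> one_minus g = a \<oplus>\<^bsub>RG\<^esub> a \<otimes>\<^bsub>RG\<^esub> monomial g (\<ominus>\<^bsub>R\<^esub> \<one>\<^bsub>R\<^esub>)"
    unfolding one_minus_def using a RG.one_closed
    by (subst RG.r_distr) (auto simp: monomial_closed g simp del: group_ring_simps(3))
  then show ?thesis
    using R.fin_supp_funs_in_carrier[OF a]
    by (simp add: mult_monomial g a x R.r_minus R.minus_eq)
qed

text \<open>The augmentation, i.e. the sum of the coefficients, is at hand as a left
  \<open>R\<close>-linear map. Left multiplication by \<open>1 - g\<close> is left
  \<open>R\<close>-linear too, since 1 and -1 are central in \<open>R\<close>. Hence it suffices to
  evaluate at basis vectors, where \<open>(1 - g) x = x - g x\<close> has coefficient sum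
  \<open>1 - 1\<close>.\<close>

lemma augmentation_one_minus_mult:
  assumes g: "g \<in> carrier G" and b: "b \<in> fin_supp_funs R (carrier G)"
  shows "augmentation (one_minus g \<otimes>\<^bsub>RG\<^esub> b) = \<zero>\<^bsub>R\<^esub>"
proof -
  let ?F = "free_left_module R (carrier G)" and ?M = "left_regular_module R"
  interpret RG: ring RG by (rule ring_group_ring)
  interpret M: left_module R ?M by (rule left_module_regular[OF R.ring_axioms])
  note aug = left_homD[OF augmentation_hom, simplified]
  define L where "L b = one_minus g \<otimes>\<^bsub>RG\<^esub> b" for b
  have cl: "L b \<in> fin_supp_funs R (carrier G)" if "b \<in> fin_supp_funs R (carrier G)" for b
    unfolding L_def by (rule mult_closed[OF one_minus_closed[OF g] that])
  have L: "restrict L (carrier ?F) \<in> left_hom R ?F ?F"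
  proof (rule left_homI[OF R.left_module_free])
    show "L b \<in> carrier ?F" if "b \<in> carrier ?F" for b using cl that by simp
    show "L (b \<oplus>\<^bsub>?F\<^esub> c) = L b \<oplus>\<^bsub>?F\<^esub> L c" if "b \<in> carrier ?F" "c \<in> carrier ?F" for b c
      using that RG.r_distr[of b c "one_minus g"] one_minus_closed[OF g] by (simp add: L_def)
    show "L (s \<odot>\<^bsub>?F\<^esub> b) = s \<odot>\<^bsub>?F\<^esub> L b" if s: "s \<in> carrier R" and b: "b \<in> carrier ?F" for s b
    proof
      fix x
      from b have b': "b \<in> fin_supp_funs R (carrier G)" by simp
      show "L (s \<odot>\<^bsub>?F\<^esub> b) x = (s \<odot>\<^bsub>?F\<^esub> L b) x"
        by (cases "x \<in> carrier G")
           (simp_all add: L_def s b' R.fin_supp_funs_smult one_minus_mult g mult_eq_zero_outside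
             R.fin_supp_funs_in_carrier[OF b'] R.minus_eq R.r_distr R.r_minus)
    qed
  qed
  have "compose (carrier ?F) augmentation (restrict L (carrier ?F)) = (\<lambda>u\<in>carrier ?F. \<zero>\<^bsub>?M\<^esub>)"
  proof (rule M.free_hom_eqI)
    show "compose (carrier ?F) augmentation (restrict L (carrier ?F)) \<in> left_hom R ?F ?M"
      by (rule left_hom_compose[OF R.left_module_free L augmentation_hom])
    show "(\<lambda>u\<in>carrier ?F. \<zero>\<^bsub>?M\<^esub>) \<in> left_hom R ?F ?M"
      by (rule left_homI[OF R.left_module_free]) simp_all
    fix x assume x: "x \<in> carrier G"
    have u: "R.unit_fun x \<in> fin_supp_funs R (carrier G)" by (rule R.unit_fun_closed[OF x])
    have *: "(\<lambda>y. (\<ominus>\<^bsub>R\<^esub> \<one>\<^bsub>R\<^esub>) \<otimes>\<^bsub>R\<^esub> monomial (g \<otimes>\<^bsub>G\<^esub> x) \<one>\<^bsub>R\<^esub> y) \<in> fin_supp_funs R (carrier G)"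
      using g x by (intro R.fin_supp_funs_smult monomial_closed) auto
    have "L (R.unit_fun x) =
      (\<lambda>y. monomial x \<one>\<^bsub>R\<^esub> y \<oplus>\<^bsub>R\<^esub> (\<ominus>\<^bsub>R\<^esub> \<one>\<^bsub>R\<^esub>) \<otimes>\<^bsub>R\<^esub> monomial (g \<otimes>\<^bsub>G\<^esub> x) \<one>\<^bsub>R\<^esub> y)"
    proof
      fix y
      have "inv\<^bsub>G\<^esub> g \<otimes>\<^bsub>G\<^esub> y = x \<longleftrightarrow> y = g \<otimes>\<^bsub>G\<^esub> x" if "y \<in> carrier G"
        using that g x by (metis G.inv_closed G.inv_solve_left G.m_closed)
      moreover have "L (R.unit_fun x) y = R.unit_fun x y \<ominus>\<^bsub>R\<^esub> R.unit_fun x (inv\<^bsub>G\<^esub> g \<otimes>\<^bsub>G\<^esub> y)"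
        if "y \<in> carrier G"
        using that by (simp add: L_def one_minus_mult g u)
      moreover have "L (R.unit_fun x) y = \<zero>\<^bsub>R\<^esub>" if "y \<notin> carrier G"
        using that by (simp add: L_def mult_eq_zero_outside)
      ultimately show "L (R.unit_fun x) y =
          monomial x \<one>\<^bsub>R\<^esub> y \<oplus>\<^bsub>R\<^esub> (\<ominus>\<^bsub>R\<^esub> \<one>\<^bsub>R\<^esub>) \<otimes>\<^bsub>R\<^esub> monomial (g \<otimes>\<^bsub>G\<^esub> x) \<one>\<^bsub>R\<^esub> y"
        using g x by (cases "y \<in> carrier G") (auto simp: R.unit_fun_def monomial_def R.minus_eq)
    qed
    then have "augmentation (L (R.unit_fun x)) = \<one>\<^bsub>R\<^esub> \<oplus>\<^bsub>R\<^esub> (\<ominus>\<^bsub>R\<^esub> \<one>\<^bsub>R\<^esub>) \<otimes>\<^bsub>R\<^esub> \<one>\<^bsub>R\<^esub>"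
      using g x by (simp add: aug * monomial_closed augmentation_monomial_one)
    then show "compose (carrier ?F) augmentation (restrict L (carrier ?F)) (R.unit_fun x) =
        (\<lambda>u\<in>carrier ?F. \<zero>\<^bsub>?M\<^esub>) (R.unit_fun x)"
      using u by (simp add: compose_def R.r_neg)
  qed
  from fun_cong[OF this, of b] show ?thesis using b by (simp add: compose_def L_def)
qed

text \<open>The system has a single equation, one unknown for each generator, and right side 1. Its
  compatibility means that an \<open>a\<close> with \<open>a (1 - g) = 0\<close> for all generators
  \<open>g\<close> also satisfies \<open>a 1 = 0\<close>, which is what \<open>annihilator\<close>
  provides.\<close>

lemma locally_finite:
  assumes one: "\<one>\<^bsub>R\<^esub> \<noteq> \<zero>\<^bsub>R\<^esub>"
    and solv: "\<And>T. \<lbrakk>finite T; T \<subseteq> carrier G\<rbrakk> \<Longrightarrow> compatible_systems_solvable RG {0::nat} T"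
  shows "locally_finite_group G"
  unfolding locally_finite_group_def
proof (intro allI impI, elim conjE exE, rule ccontr)
  fix H T assume T: "finite T" "T \<subseteq> carrier G" and H: "H = generate G T" and inf: "infinite H"
  interpret RG: ring RG by (rule ring_group_ring)
  have annihilator: "a = \<zero>\<^bsub>RG\<^esub>" if a: "a \<in> carrier RG" and z: "\<And>g. g \<in> T \<Longrightarrow> a \<otimes>\<^bsub>RG\<^esub> one_minus g = \<zero>\<^bsub>RG\<^esub>" for a
  proof (rule ccontr)
    assume nz: "a \<noteq> \<zero>\<^bsub>RG\<^esub>"
    from a have a': "a \<in> fin_supp_funs R (carrier G)" by simp
    note ac = R.fin_supp_funs_in_carrier[OF a']
    have inv_T: "a (x \<otimes>\<^bsub>G\<^esub> inv\<^bsub>G\<^esub> g) = a x" if "g \<in> T" "x \<in> carrier G" for g x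
    proof -
      have g: "g \<in> carrier G" using that T by blast
      have "a x \<ominus>\<^bsub>R\<^esub> a (x \<otimes>\<^bsub>G\<^esub> inv\<^bsub>G\<^esub> g) = \<zero>\<^bsub>R\<^esub>"
        using z[OF that(1)] mult_one_minus[OF g a' that(2)] by simp
      then show ?thesis using ac R.minus_equality[of "a x" "\<ominus>\<^bsub>R\<^esub> a (x \<otimes>\<^bsub>G\<^esub> inv\<^bsub>G\<^esub> g)"]
        by (simp add: R.minus_eq)
    qed
    have inv_H: "\<forall>x\<in>carrier G. a (x \<otimes>\<^bsub>G\<^esub> h) = a x" if "h \<in> generate G T" for h
      using that
    proof induction
      case (incl h)
      show ?case
      proof
        fix x assume x: "x \<in> carrier G"
        have h: "h \<in> carrier G" using incl T by blast
        \<comment> \<open>\<open>inv_T\<close> concerns inverses of generators, so for the generator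
          \<open>h\<close> itself it is applied at the point \<open>x h\<close>.\<close>
        have "a (x \<otimes>\<^bsub>G\<^esub> h \<otimes>\<^bsub>G\<^esub> inv\<^bsub>G\<^esub> h) = a (x \<otimes>\<^bsub>G\<^esub> h)" using x h incl by (intro inv_T) auto
        then show "a (x \<otimes>\<^bsub>G\<^esub> h) = a x" using x h by (simp add: G.m_assoc)
      qed
    next
      case (eng h1 h2)
      then have "h1 \<in> carrier G" "h2 \<in> carrier G" using G.generate_in_carrier[OF T(2)] by auto
      then show ?case using eng.IH by (simp flip: G.m_assoc)
    qed (simp_all add: inv_T)
    obtain x where x: "a x \<noteq> \<zero>\<^bsub>R\<^esub>" using nz by auto
    then have xG: "x \<in> carrier G" using fin_supp_funsD(2)[OF a'] by blast
    have HG: "H \<subseteq> carrier G" using G.generate_in_carrier[OF T(2)] H by blast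
    \<comment> \<open>The finite support of \<open>a\<close> contains the whole coset
      \<open>x H\<close> as soon as it contains \<open>x\<close>.\<close>
    have "(\<lambda>h. x \<otimes>\<^bsub>G\<^esub> h) ` H \<subseteq> {x. a x \<noteq> \<zero>\<^bsub>R\<^esub>}" using inv_H H x xG by auto
    then have "finite ((\<lambda>h. x \<otimes>\<^bsub>G\<^esub> h) ` H)" using fin_supp_funsD(3)[OF a'] finite_subset by blast
    moreover have "inj_on (\<lambda>h. x \<otimes>\<^bsub>G\<^esub> h) H" using HG xG G.inj_on_cmult inj_on_subset by blast
    ultimately show False using inf finite_imageD by blast
  qed
  have cl: "one_minus g \<in> carrier RG" if "g \<in> T" for g
    using that T one_minus_closed by auto
  obtain b where b: "\<And>g. g \<in> T \<Longrightarrow> b g \<in> carrier RG"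
    and eq: "\<And>i. i \<in> {0::nat} \<Longrightarrow> (\<Oplus>\<^bsub>RG\<^esub>g\<in>T. one_minus g \<otimes>\<^bsub>RG\<^esub> b g) = \<one>\<^bsub>RG\<^esub>"
  proof (rule compatible_systems_solvableD[OF solv[OF T], of "\<lambda>_. one_minus" "\<lambda>_. \<one>\<^bsub>RG\<^esub>"])
    fix s assume s: "\<And>i. i \<in> {0::nat} \<Longrightarrow> s i \<in> carrier RG"
      and z: "\<And>g. g \<in> T \<Longrightarrow> (\<Oplus>\<^bsub>RG\<^esub>i\<in>{0}. s i \<otimes>\<^bsub>RG\<^esub> one_minus g) = \<zero>\<^bsub>RG\<^esub>"
    have s0: "s 0 \<in> carrier RG" using s by simp
    have "s 0 \<otimes>\<^bsub>RG\<^esub> one_minus g = \<zero>\<^bsub>RG\<^esub>" if "g \<in> T" for g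
      using z[OF that] RG.m_closed[OF s0 cl[OF that]] by (simp del: group_ring_simps)
    then have "s 0 = \<zero>\<^bsub>RG\<^esub>" by (rule annihilator[OF s0])
    then show "(\<Oplus>\<^bsub>RG\<^esub>i\<in>{0}. s i \<otimes>\<^bsub>RG\<^esub> \<one>\<^bsub>RG\<^esub>) = \<zero>\<^bsub>RG\<^esub>" by (simp del: group_ring_simps)
  qed (use cl in \<open>auto simp del: group_ring_simps\<close>)
  let ?F = "free_left_module R (carrier G)" and ?M = "left_regular_module R"
  have prod: "one_minus g \<otimes>\<^bsub>RG\<^esub> b g \<in> fin_supp_funs R (carrier G)" if "g \<in> T" for g
    using mult_closed cl b that by simp
  have "\<one>\<^bsub>RG\<^esub> = (\<Oplus>\<^bsub>RG\<^esub>g\<in>T. one_minus g \<otimes>\<^bsub>RG\<^esub> b g)" by (simp add: eq)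
  \<comment> \<open>The sum is moved to the free module, on which the augmentation is a
    homomorphism.\<close>
  also have "\<dots> = (\<Oplus>\<^bsub>?F\<^esub>g\<in>T. one_minus g \<otimes>\<^bsub>RG\<^esub> b g)" by (simp add: finsum_def finprod_def)
  finally have "augmentation \<one>\<^bsub>RG\<^esub> = (\<Oplus>\<^bsub>?M\<^esub>g\<in>T. augmentation (one_minus g \<otimes>\<^bsub>RG\<^esub> b g))"
    using left_hom_finsum[OF augmentation_hom R.left_module_free
        left_module_regular[OF R.ring_axioms], of T "\<lambda>g. one_minus g \<otimes>\<^bsub>RG\<^esub> b g"] prod
    by simp
  also have "\<dots> = \<zero>\<^bsub>R\<^esub>"
    using b T by (simp, intro R.add.finprod_one_eqI augmentation_one_minus_mult) auto
  finally show False using one by (simp add: one_group_ring augmentation_monomial_one)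
qed

text \<open>A left \<open>RH\<close>-linear system over the group ring of a finite subgroup \<open>H\<close> is a linear system
  over \<open>R\<close> in the \<open>H\<close>-coefficients of the unknowns: the entry \<open>a\<close> becomes the matrix
  \<open>(x, y) \<mapsto> a(x y\<inverse>)\<close>.\<close>

lemma solvable_group_ring:
  assumes lf: "locally_finite_group G" and fin: "finite I" "finite J"
    and solv: "\<And>H :: 'g set. finite H \<Longrightarrow> compatible_systems_solvable R (I \<times> H) (J \<times> H)"
  shows "compatible_systems_solvable RG I J"
proof (rule compatible_systems_solvableI)
  fix A c
  assume A: "\<And>i j. \<lbrakk>i \<in> I; j \<in> J\<rbrakk> \<Longrightarrow> A i j \<in> carrier RG" and c: "\<And>i. i \<in> I \<Longrightarrow> c i \<in> carrier RG"
    and comp: "\<And>s. \<lbrakk>\<And>i. i \<in> I \<Longrightarrow> s i \<in> carrier RG;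
        \<And>j. j \<in> J \<Longrightarrow> (\<Oplus>\<^bsub>RG\<^esub>i\<in>I. s i \<otimes>\<^bsub>RG\<^esub> A i j) = \<zero>\<^bsub>RG\<^esub>\<rbrakk> \<Longrightarrow> (\<Oplus>\<^bsub>RG\<^esub>i\<in>I. s i \<otimes>\<^bsub>RG\<^esub> c i) = \<zero>\<^bsub>RG\<^esub>"
  note A' = A[simplified] and c' = c[simplified]
  note Ac = R.fin_supp_funs_in_carrier[OF A'] and cc = R.fin_supp_funs_in_carrier[OF c']
  define T where "T = (\<Union>i\<in>I. \<Union>j\<in>J. {x. A i j x \<noteq> \<zero>\<^bsub>R\<^esub>}) \<union> (\<Union>i\<in>I. {x. c i x \<noteq> \<zero>\<^bsub>R\<^esub>})"
  define H where "H = generate G T"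
  have T: "finite T" "T \<subseteq> carrier G"
    using fin fin_supp_funsD(3,4)[OF A'] fin_supp_funsD(3,4)[OF c'] unfolding T_def by blast+
  have sub: "subgroup H G" unfolding H_def by (rule G.generate_is_subgroup[OF T(2)])
  then have finH: "finite H" using lf T unfolding locally_finite_group_def H_def by blast
  interpret H: subgroup H G by (rule sub)
  have TH: "T \<subseteq> H" unfolding H_def by (auto intro: generate.incl)
  have A0: "A i j x = \<zero>\<^bsub>R\<^esub>" if "i \<in> I" "j \<in> J" "x \<notin> H" for i j x using that TH by (auto simp: T_def)
  have c0: "c i x = \<zero>\<^bsub>R\<^esub>" if "i \<in> I" "x \<notin> H" for i x using that TH by (auto simp: T_def)
  \<comment> \<open>Left translation by elements of \<open>H\<close> preserves the complement of
    \<open>H\<close>; this disposes of all coefficients outside \<open>H\<close>.\<close>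
  have outside: "inv\<^bsub>G\<^esub> w \<otimes>\<^bsub>G\<^esub> x \<notin> H" if "w \<in> H" "x \<in> carrier G" "x \<notin> H" for w x
  proof
    assume "inv\<^bsub>G\<^esub> w \<otimes>\<^bsub>G\<^esub> x \<in> H"
    then have "w \<otimes>\<^bsub>G\<^esub> (inv\<^bsub>G\<^esub> w \<otimes>\<^bsub>G\<^esub> x) \<in> H" using that(1) by (rule H.m_closed[rotated])
    then show False using that by (simp flip: G.m_assoc)
  qed
  have bij_inv: "bij_betw (\<lambda>x. inv\<^bsub>G\<^esub> x) H H"
    by (rule bij_betwI[where g = "\<lambda>x. inv\<^bsub>G\<^esub> x"]) auto
  have bij_div: "bij_betw (\<lambda>y. z \<otimes>\<^bsub>G\<^esub> inv\<^bsub>G\<^esub> y) H H" if "z \<in> H" for z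
    by (rule bij_betwI[where g = "\<lambda>w. inv\<^bsub>G\<^esub> w \<otimes>\<^bsub>G\<^esub> z"])
       (use that in \<open>auto simp: G.inv_mult_group G.m_assoc simp flip: G.m_assoc[of _ "inv\<^bsub>G\<^esub> _"]\<close>)
  \<comment> \<open>A row \<open>s\<close> over \<open>R\<close> indexed by
    \<open>I \<times> H\<close> becomes a row over \<open>R(G)\<close> whose coefficient at
    \<open>z\<close> is \<open>s\<close> at the inverse of \<open>z\<close>. The inversion
    compensates for the one in the convolution formula, so that \<open>s (i, x)\<close> is
    multiplied by the value of \<open>f i\<close> at \<open>x z\<close>.\<close>
  have sum_left: "(\<Oplus>\<^bsub>RG\<^esub>i\<in>I. (\<lambda>z. if z \<in> H then s (i, inv\<^bsub>G\<^esub> z) else \<zero>\<^bsub>R\<^esub>) \<otimes>\<^bsub>RG\<^esub> f i) z =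
      (\<Oplus>\<^bsub>R\<^esub>p\<in>I \<times> H. s p \<otimes>\<^bsub>R\<^esub> f (fst p) (snd p \<otimes>\<^bsub>G\<^esub> z))"
    if s: "\<And>p. p \<in> I \<times> H \<Longrightarrow> s p \<in> carrier R" and f: "\<And>i. i \<in> I \<Longrightarrow> f i \<in> fin_supp_funs R (carrier G)"
      and z: "z \<in> carrier G" for s f z
  proof -
    let ?s = "\<lambda>i z. if z \<in> H then s (i, inv\<^bsub>G\<^esub> z) else \<zero>\<^bsub>R\<^esub>"
    have s': "?s i \<in> fin_supp_funs R (carrier G)" if "i \<in> I" for i
      by (rule R.fin_supp_funsI[OF finH H.subset]) (auto simp: s that)
    have "(\<Oplus>\<^bsub>RG\<^esub>i\<in>I. ?s i \<otimes>\<^bsub>RG\<^esub> f i) z = (\<Oplus>\<^bsub>R\<^esub>i\<in>I. (?s i \<otimes>\<^bsub>RG\<^esub> f i) z)"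
      by (intro finsum_group_ring mult_closed s' f)
    also have "\<dots> = (\<Oplus>\<^bsub>R\<^esub>i\<in>I. \<Oplus>\<^bsub>R\<^esub>x\<in>H. s (i, x) \<otimes>\<^bsub>R\<^esub> f i (x \<otimes>\<^bsub>G\<^esub> z))"
    proof (rule R.finsum_cong'[OF refl])
      fix i assume i: "i \<in> I"
      note fc = R.fin_supp_funs_in_carrier[OF f[OF i]]
      have "(?s i \<otimes>\<^bsub>RG\<^esub> f i) z = (\<Oplus>\<^bsub>R\<^esub>x\<in>H. ?s i x \<otimes>\<^bsub>R\<^esub> f i (inv\<^bsub>G\<^esub> x \<otimes>\<^bsub>G\<^esub> z))"
        by (rule mult_eq[OF s'[OF i] f[OF i] finH _ z]) auto
      also have "\<dots> = (\<Oplus>\<^bsub>R\<^esub>x\<in>H. ?s i (inv\<^bsub>G\<^esub> x) \<otimes>\<^bsub>R\<^esub> f i (inv\<^bsub>G\<^esub> (inv\<^bsub>G\<^esub> x) \<otimes>\<^bsub>G\<^esub> z))"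
        by (rule R.finsum_bij[OF bij_inv]) (auto simp: s i fc)
      also have "\<dots> = (\<Oplus>\<^bsub>R\<^esub>x\<in>H. s (i, x) \<otimes>\<^bsub>R\<^esub> f i (x \<otimes>\<^bsub>G\<^esub> z))"
        by (rule R.finsum_cong') (auto simp: s i fc)
      finally show "(?s i \<otimes>\<^bsub>RG\<^esub> f i) z = (\<Oplus>\<^bsub>R\<^esub>x\<in>H. s (i, x) \<otimes>\<^bsub>R\<^esub> f i (x \<otimes>\<^bsub>G\<^esub> z))" .
    qed (auto intro!: R.finsum_closed simp: s R.fin_supp_funs_in_carrier[OF f])
    also have "\<dots> = (\<Oplus>\<^bsub>R\<^esub>p\<in>I \<times> H. s p \<otimes>\<^bsub>R\<^esub> f (fst p) (snd p \<otimes>\<^bsub>G\<^esub> z))"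
      by (subst R.finsum_Times) (auto simp: fin finH s R.fin_supp_funs_in_carrier[OF f])
    finally show ?thesis .
  qed
  obtain b where b: "\<And>p. p \<in> J \<times> H \<Longrightarrow> b p \<in> carrier R"
    and eq: "\<And>q. q \<in> I \<times> H \<Longrightarrow>
      (\<Oplus>\<^bsub>R\<^esub>p\<in>J \<times> H. A (fst q) (fst p) (snd q \<otimes>\<^bsub>G\<^esub> inv\<^bsub>G\<^esub> (snd p)) \<otimes>\<^bsub>R\<^esub> b p) = c (fst q) (snd q)"
  proof (rule compatible_systems_solvableD[OF solv[OF finH],
        of "\<lambda>q p. A (fst q) (fst p) (snd q \<otimes>\<^bsub>G\<^esub> inv\<^bsub>G\<^esub> (snd p))" "\<lambda>q. c (fst q) (snd q)"])
    fix s assume s: "\<And>q. q \<in> I \<times> H \<Longrightarrow> s q \<in> carrier R"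
      and z: "\<And>p. p \<in> J \<times> H \<Longrightarrow>
        (\<Oplus>\<^bsub>R\<^esub>q\<in>I \<times> H. s q \<otimes>\<^bsub>R\<^esub> A (fst q) (fst p) (snd q \<otimes>\<^bsub>G\<^esub> inv\<^bsub>G\<^esub> (snd p))) = \<zero>\<^bsub>R\<^esub>"
    let ?s = "\<lambda>i z. if z \<in> H then s (i, inv\<^bsub>G\<^esub> z) else \<zero>\<^bsub>R\<^esub>"
    have s': "?s i \<in> fin_supp_funs R (carrier G)" if "i \<in> I" for i
      by (rule R.fin_supp_funsI[OF finH H.subset]) (auto simp: s that)
    have "(\<Oplus>\<^bsub>RG\<^esub>i\<in>I. ?s i \<otimes>\<^bsub>RG\<^esub> A i j) = \<zero>\<^bsub>RG\<^esub>" if j: "j \<in> J" for j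
    proof
      fix x
      show "(\<Oplus>\<^bsub>RG\<^esub>i\<in>I. ?s i \<otimes>\<^bsub>RG\<^esub> A i j) x = \<zero>\<^bsub>RG\<^esub> x"
      proof (cases "x \<in> carrier G")
        case True
        have "(\<Oplus>\<^bsub>RG\<^esub>i\<in>I. ?s i \<otimes>\<^bsub>RG\<^esub> A i j) x = (\<Oplus>\<^bsub>R\<^esub>p\<in>I \<times> H. s p \<otimes>\<^bsub>R\<^esub> A (fst p) j (snd p \<otimes>\<^bsub>G\<^esub> x))"
          by (rule sum_left) (simp_all add: s A' j True)
        also have "\<dots> = \<zero>\<^bsub>R\<^esub>"
        proof (cases "x \<in> H")
          case xH: True
          \<comment> \<open>For \<open>x\<close> in \<open>H\<close> this is the relation for the
            column whose second index is the inverse of \<open>x\<close>.\<close>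
          show ?thesis using z[of "(j, inv\<^bsub>G\<^esub> x)"] j True xH by simp
        next
          case False
          show ?thesis
          proof (rule R.add.finprod_one_eqI)
            fix p assume p: "p \<in> I \<times> H"
            then have "snd p \<otimes>\<^bsub>G\<^esub> x \<notin> H" using outside[of "inv\<^bsub>G\<^esub> (snd p)" x] False True by auto
            then show "s p \<otimes>\<^bsub>R\<^esub> A (fst p) j (snd p \<otimes>\<^bsub>G\<^esub> x) = \<zero>\<^bsub>R\<^esub>" using p j s A0 by auto
          qed
        qed
        finally show ?thesis by simp
      next
        case False
        then show ?thesis
          by (simp add: finsum_group_ring mult_closed s' A' j mult_eq_zero_outside
              R.add.finprod_one_eqI)
      qed
    qed
    \<comment> \<open>The coefficient at the identity of the relation for \<open>c\<close> is the
      required sum over \<open>I \<times> H\<close>.\<close>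
    then have "(\<Oplus>\<^bsub>RG\<^esub>i\<in>I. ?s i \<otimes>\<^bsub>RG\<^esub> c i) \<one>\<^bsub>G\<^esub> = \<zero>\<^bsub>R\<^esub>"
      using comp[of ?s] s' by simp
    moreover have "(\<Oplus>\<^bsub>RG\<^esub>i\<in>I. ?s i \<otimes>\<^bsub>RG\<^esub> c i) \<one>\<^bsub>G\<^esub> =
        (\<Oplus>\<^bsub>R\<^esub>p\<in>I \<times> H. s p \<otimes>\<^bsub>R\<^esub> c (fst p) (snd p \<otimes>\<^bsub>G\<^esub> \<one>\<^bsub>G\<^esub>))"
      by (rule sum_left) (simp_all add: s c')
    moreover have "\<dots> = (\<Oplus>\<^bsub>R\<^esub>p\<in>I \<times> H. s p \<otimes>\<^bsub>R\<^esub> c (fst p) (snd p))"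
      by (rule R.finsum_cong') (auto simp: s cc)
    ultimately show "(\<Oplus>\<^bsub>R\<^esub>p\<in>I \<times> H. s p \<otimes>\<^bsub>R\<^esub> c (fst p) (snd p)) = \<zero>\<^bsub>R\<^esub>" by simp
  qed (auto simp: Ac cc)
  define b' where "b' j = (\<lambda>y. if y \<in> H then b (j, y) else \<zero>\<^bsub>R\<^esub>)" for j
  have b': "b' j \<in> fin_supp_funs R (carrier G)" if "j \<in> J" for j
    by (rule R.fin_supp_funsI[OF finH H.subset]) (auto simp: b'_def b that)
  have "(\<Oplus>\<^bsub>RG\<^esub>j\<in>J. A i j \<otimes>\<^bsub>RG\<^esub> b' j) = c i" if i: "i \<in> I" for i
  proof
    fix x
    have eval: "(\<Oplus>\<^bsub>RG\<^esub>j\<in>J. A i j \<otimes>\<^bsub>RG\<^esub> b' j) x = (\<Oplus>\<^bsub>R\<^esub>j\<in>J. (A i j \<otimes>\<^bsub>RG\<^esub> b' j) x)"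
      by (intro finsum_group_ring mult_closed A' b' i)
    have prod: "(A i j \<otimes>\<^bsub>RG\<^esub> b' j) x = (\<Oplus>\<^bsub>R\<^esub>w\<in>H. A i j w \<otimes>\<^bsub>R\<^esub> b' j (inv\<^bsub>G\<^esub> w \<otimes>\<^bsub>G\<^esub> x))"
      if "j \<in> J" "x \<in> carrier G" for j
      by (rule mult_eq[OF A' b' finH]) (use that i A0 in auto)
    show "(\<Oplus>\<^bsub>RG\<^esub>j\<in>J. A i j \<otimes>\<^bsub>RG\<^esub> b' j) x = c i x"
    proof (cases "x \<in> H")
      case True
      have "(\<Oplus>\<^bsub>R\<^esub>j\<in>J. (A i j \<otimes>\<^bsub>RG\<^esub> b' j) x) =
          (\<Oplus>\<^bsub>R\<^esub>j\<in>J. \<Oplus>\<^bsub>R\<^esub>y\<in>H. A i j (x \<otimes>\<^bsub>G\<^esub> inv\<^bsub>G\<^esub> y) \<otimes>\<^bsub>R\<^esub> b (j, y))"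
      proof (rule R.finsum_cong'[OF refl])
        fix j assume j: "j \<in> J"
        \<comment> \<open>The substitution \<open>w = x y\<inverse>\<close> brings the coefficient
          at \<open>x\<close> into the form of row \<open>(i, x)\<close> of the system over
          \<open>R\<close>.\<close>
        have "(A i j \<otimes>\<^bsub>RG\<^esub> b' j) x = (\<Oplus>\<^bsub>R\<^esub>y\<in>H. A i j (x \<otimes>\<^bsub>G\<^esub> inv\<^bsub>G\<^esub> y) \<otimes>\<^bsub>R\<^esub>
            b' j (inv\<^bsub>G\<^esub> (x \<otimes>\<^bsub>G\<^esub> inv\<^bsub>G\<^esub> y) \<otimes>\<^bsub>G\<^esub> x))"
          unfolding prod[OF j H.mem_carrier[OF True]]
          by (rule R.finsum_bij[OF bij_div[OF True]])
             (simp add: Ac i j R.fin_supp_funs_in_carrier[OF b'])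
        also have "\<dots> = (\<Oplus>\<^bsub>R\<^esub>y\<in>H. A i j (x \<otimes>\<^bsub>G\<^esub> inv\<^bsub>G\<^esub> y) \<otimes>\<^bsub>R\<^esub> b (j, y))"
          by (rule R.finsum_cong')
             (use True in \<open>auto simp: Ac i j b b'_def G.inv_mult_group G.m_assoc\<close>)
        finally show "(A i j \<otimes>\<^bsub>RG\<^esub> b' j) x = (\<Oplus>\<^bsub>R\<^esub>y\<in>H. A i j (x \<otimes>\<^bsub>G\<^esub> inv\<^bsub>G\<^esub> y) \<otimes>\<^bsub>R\<^esub> b (j, y))" .
      qed (auto intro!: R.finsum_closed simp: Ac i b)
      also have "\<dots> = (\<Oplus>\<^bsub>R\<^esub>p\<in>J \<times> H. A i (fst p) (x \<otimes>\<^bsub>G\<^esub> inv\<^bsub>G\<^esub> (snd p)) \<otimes>\<^bsub>R\<^esub> b p)"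
        by (subst R.finsum_Times) (auto simp: fin finH Ac i b)
      also have "\<dots> = c i x" using eq[of "(i, x)"] i True by simp
      finally show ?thesis by (simp add: eval)
    next
      case False
      \<comment> \<open>Off \<open>H\<close> both sides of the equation vanish: the factors
        \<open>A i j\<close> and \<open>b' j\<close> are supported in \<open>H\<close>, and so is
        \<open>c i\<close>.\<close>
      have "(A i j \<otimes>\<^bsub>RG\<^esub> b' j) x = \<zero>\<^bsub>R\<^esub>" if j: "j \<in> J" for j
      proof (cases "x \<in> carrier G")
        case True
        show ?thesis
          unfolding prod[OF j True]
          by (rule R.add.finprod_one_eqI)
             (use outside[OF _ True False] in \<open>auto simp: b'_def Ac i j\<close>)
      qed (simp add: mult_eq_zero_outside)
      then show ?thesis using c0[OF i False] by (simp add: eval R.add.finprod_one_eqI)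
    qed
  qed
  then show "\<exists>b. (\<forall>j\<in>J. b j \<in> carrier RG) \<and> (\<forall>i\<in>I. (\<Oplus>\<^bsub>RG\<^esub>j\<in>J. A i j \<otimes>\<^bsub>RG\<^esub> b j) = c i)"
    using b' by (intro exI[of _ b']) simp
qed

end

theorem theorem3p2:
  fixes R :: "('r, 'm) ring_scheme" and G :: "('g, 'n) monoid_scheme"
  assumes "ring R" and "\<one>\<^bsub>R\<^esub> \<noteq> \<zero>\<^bsub>R\<^esub>" and "group G"
  shows "left_FP_injective_ring (group_ring R G) \<longleftrightarrow>
    left_FP_injective_ring R \<and> locally_finite_group G"
proof -
  interpret ring_and_group R G using assms(1,3) by (rule ring_and_group.intro)
  show ?thesis
  proof (intro iffI conjI)
    assume inj: "left_FP_injective_ring (group_ring R G)"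
    show "left_FP_injective_ring R"
      unfolding left_FP_injective_ring_iff
      by (intro conjI assms(1) allI solvable_coefficients left_FP_injective_ringD[OF inj]
          finite_lessThan)
    show "locally_finite_group G"
      by (rule locally_finite[OF assms(2)]) (rule left_FP_injective_ringD[OF inj], simp_all)
  next
    assume "left_FP_injective_ring R \<and> locally_finite_group G"
    then have inj: "left_FP_injective_ring R" and lf: "locally_finite_group G" by simp_all
    \<comment> \<open>The systems over \<open>R\<close> that arise here have rows and unknowns
      indexed by pairs with a component in \<open>H\<close>, which is why
      \<open>left_FP_injective_ringD\<close> admits finite index sets of any type.\<close>
    have "compatible_systems_solvable (group_ring R G) {..<m} {..<n}" for m n :: nat
      by (rule solvable_group_ring[OF lf finite_lessThan finite_lessThan])
         (rule left_FP_injective_ringD[OF inj], simp_all)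
    then show "left_FP_injective_ring (group_ring R G)"
      using ring_group_ring by (simp add: left_FP_injective_ring_iff)
  qed
qed

end
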